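(* Let $(W,S)$ be a Coxeter system of finite rank and $c$ a Coxeter element. Let $w\in W$ and let $v$ be $c$-sortable. Then $\pi_\downarrow^c(w)=v$ if and only if both (i) $\mathrm{cov}(v)\subseteq\mathrm{inv}(w)$ and (ii) $\mathrm{ufs}_c(v)\cap\mathrm{inv}(w)=\emptyset$.
   Context: $S$ finite; $T$ = reflections; $\mathrm{inv}(w)=\{t\in T:\ell(tw)<\ell(w)\}$; weak order $v\le w$ iff $\mathrm{inv}(v)\subseteq\mathrm{inv}(w)$; $\mathrm{cov}(w)=\{t\in\mathrm{inv}(w): tw=ws \text{ for some } s\in S\}$. $W_J=\langle J\rangle$, $w_J\in W_J$ defined by $\mathrm{inv}(w_J)=\mathrm{inv}(w)\cap W_J$, $\langle s\rangle=S\setminus\{s\}$. Coxeter element $c=s_1\cdots s_n$ (all of $S$ in some order); $s$ initial in $c$ if a reduced word of $c$ begins with $s$; then $scs$ is a Coxeter element and $sc$ is one of $W_{\langle s\rangle}$. $c$-sortable: the $(s_1\cdots s_n)$-sorting word of $w$ is the lexicographically first (by positions) subword of $(s_1\cdots s_n)^\infty$ that is a reduced word for $w$; $w$ is $c$-sortable if the sets of letters in successive copies of $s_1\cdots s_n$ weakly decrease under inclusion. Unforced skips: with $a_1\cdots a_k$ the sorting word of $w$ occupying positions in $(s_1\cdots s_n)^\infty$, for $r\in S$ take the leftmost occurrence of $r$ whose position is unused, and let $i$ be the number of $a_j$ at earlier positions; the skip is unforced if $a_1\cdots a_ir$ is reduced. $\mathrm{ufs}_c(w)=\{a_1\cdots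 a_ira_i\cdots a_1: r\in S\text{ with an unforced skip}\}$. $\pi_\downarrow^c$: $\pi_\downarrow^c(e)=e$, and for $s$ initial in $c$, $\pi_\downarrow^c(w)=s\pi_\downarrow^{scs}(sw)$ if $w\ge s$ and $\pi_\downarrow^{sc}(w_{\langle s\rangle})$ (computed in $W_{\langle s\rangle}$) otherwise; independent of choices. *)

theory Defs
  imports "HOL-Algebra.Algebra"
begin

section \<open>Coxeter systems\<close>

definition word_prod :: "('a, 'b) monoid_scheme \<Rightarrow> 'a list \<Rightarrow> 'a" where
  "word_prod W xs = foldr (\<otimes>\<^bsub>W\<^esub>) xs \<one>\<^bsub>W\<^esub>"

text \<open>Insertion of a relator \<open>(st)\<^sup>m\<close>, where \<open>m\<close> is the order of \<open>st\<close> in \<open>W\<close>, into a word over \<open>S\<close>.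
  For \<open>st\<close> of infinite order \<^const>\<open>group.ord\<close> is \<open>0\<close> and the relator is the empty word, i.e. there
  is no relation. The case \<open>s = t\<close> gives the relator \<open>ss\<close>.\<close>

inductive insert_relator :: "('a, 'b) monoid_scheme \<Rightarrow> 'a set \<Rightarrow> 'a list \<Rightarrow> 'a list \<Rightarrow> bool"
  for W :: "('a, 'b) monoid_scheme" and S :: "'a set" where
  "\<lbrakk>s \<in> S; t \<in> S; us \<in> lists S; vs \<in> lists S\<rbrakk> \<Longrightarrow>
    insert_relator W S (us @ vs)
      (us @ concat (replicate (group.ord W (s \<otimes>\<^bsub>W\<^esub> t)) [s, t]) @ vs)"

text \<open>The last condition says that the relations \<open>(st)\<^sup>m = 1\<close> present \<open>W\<close>. As the generators are
  involutions and \<open>ss\<close> is among the relators, it suffices to consider words without formal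
  inverses.\<close>

definition coxeter_system :: "('a, 'b) monoid_scheme \<Rightarrow> 'a set \<Rightarrow> bool" where
  "coxeter_system W S \<longleftrightarrow>
     group W \<and> S \<subseteq> carrier W \<and> generate W S = carrier W \<and>
     (\<forall>s\<in>S. group.ord W s = 2) \<and>
     (\<forall>xs\<in>lists S. word_prod W xs = \<one>\<^bsub>W\<^esub> \<longrightarrow> equivclp (insert_relator W S) xs [])"

definition cox_length :: "('a, 'b) monoid_scheme \<Rightarrow> 'a set \<Rightarrow> 'a \<Rightarrow> nat" where
  "cox_length W S w = (LEAST n. \<exists>xs\<in>lists S. length xs = n \<and> word_prod W xs = w)"

definition reduced :: "('a, 'b) monoid_scheme \<Rightarrow> 'a set \<Rightarrow> 'a list \<Rightarrow> bool" where
  "reduced W S xs \<longleftrightarrow> xs \<in> lists S \<and> length xs = cox_length W S (word_prod W xs)"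

definition reduced_word_for :: "('a, 'b) monoid_scheme \<Rightarrow> 'a set \<Rightarrow> 'a list \<Rightarrow> 'a \<Rightarrow> bool" where
  "reduced_word_for W S xs w \<longleftrightarrow> reduced W S xs \<and> word_prod W xs = w"

definition reflections :: "('a, 'b) monoid_scheme \<Rightarrow> 'a set \<Rightarrow> 'a set" where
  "reflections W S = {w \<otimes>\<^bsub>W\<^esub> s \<otimes>\<^bsub>W\<^esub> inv\<^bsub>W\<^esub> w | w s. w \<in> carrier W \<and> s \<in> S}"

definition inversions :: "('a, 'b) monoid_scheme \<Rightarrow> 'a set \<Rightarrow> 'a \<Rightarrow> 'a set" where
  "inversions W S w = {t \<in> reflections W S. cox_length W S (t \<otimes>\<^bsub>W\<^esub> w) < cox_length W S w}"

definition weak_le :: "('a, 'b) monoid_scheme \<Rightarrow> 'a set \<Rightarrow> 'a \<Rightarrow> 'a \<Rightarrow> bool" where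
  "weak_le W S v w \<longleftrightarrow> inversions W S v \<subseteq> inversions W S w"

definition cover_reflections :: "('a, 'b) monoid_scheme \<Rightarrow> 'a set \<Rightarrow> 'a \<Rightarrow> 'a set" where
  "cover_reflections W S w =
     {t \<in> inversions W S w. \<exists>s\<in>S. t \<otimes>\<^bsub>W\<^esub> w = w \<otimes>\<^bsub>W\<^esub> s}"

definition parabolic_part :: "('a, 'b) monoid_scheme \<Rightarrow> 'a set \<Rightarrow> 'a set \<Rightarrow> 'a \<Rightarrow> 'a" where
  "parabolic_part W S J w =
     (THE x. x \<in> generate W J \<and> inversions W S x = inversions W S w \<inter> generate W J)"

section \<open>Coxeter elements and sorting words\<close>

text \<open>A list \<open>cs = [s\<^sub>1, \<dots>, s\<^sub>n]\<close> enumerating \<open>S\<close>; the corresponding Coxeter element is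
  \<open>word_prod W cs\<close>.\<close>

definition coxeter_word :: "'a set \<Rightarrow> 'a list \<Rightarrow> bool" where
  "coxeter_word S cs \<longleftrightarrow> distinct cs \<and> set cs = S"

definition initial :: "('a, 'b) monoid_scheme \<Rightarrow> 'a set \<Rightarrow> 'a \<Rightarrow> 'a \<Rightarrow> bool" where
  "initial W S c s \<longleftrightarrow> (\<exists>xs. reduced_word_for W S (s # xs) c)"

text \<open>The letter of \<open>(s\<^sub>1 \<cdots> s\<^sub>n)\<^sup>\<infinity>\<close> at position \<open>p\<close>, with positions starting at \<open>0\<close>; the copy of
  \<open>s\<^sub>1 \<cdots> s\<^sub>n\<close> containing it is number \<open>p div n\<close>.\<close>

definition letter_at :: "'a list \<Rightarrow> nat \<Rightarrow> 'a" where
  "letter_at cs p = cs ! (p mod length cs)"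

text \<open>Subwords of \<open>(s\<^sub>1 \<cdots> s\<^sub>n)\<^sup>\<infinity>\<close> are represented by strictly increasing lists of positions.\<close>

definition reduced_subword_for ::
  "('a, 'b) monoid_scheme \<Rightarrow> 'a set \<Rightarrow> 'a list \<Rightarrow> 'a \<Rightarrow> nat list \<Rightarrow> bool" where
  "reduced_subword_for W S cs w ps \<longleftrightarrow>
     sorted_wrt (<) ps \<and> reduced_word_for W S (map (letter_at cs) ps) w"

definition sorting_positions ::
  "('a, 'b) monoid_scheme \<Rightarrow> 'a set \<Rightarrow> 'a list \<Rightarrow> 'a \<Rightarrow> nat list" where
  "sorting_positions W S cs w =
     (THE ps. reduced_subword_for W S cs w ps \<and>
        (\<forall>qs. reduced_subword_for W S cs w qs \<longrightarrow> qs = ps \<or> (ps, qs) \<in> lexord less_than))"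

definition c_sortable :: "('a, 'b) monoid_scheme \<Rightarrow> 'a set \<Rightarrow> 'a list \<Rightarrow> 'a \<Rightarrow> bool" where
  "c_sortable W S cs w \<longleftrightarrow>
     (let block = (\<lambda>k. letter_at cs ` {p \<in> set (sorting_positions W S cs w). p div length cs = k})
      in \<forall>k. block (Suc k) \<subseteq> block k)"

definition first_skip :: "('a, 'b) monoid_scheme \<Rightarrow> 'a set \<Rightarrow> 'a list \<Rightarrow> 'a \<Rightarrow> 'a \<Rightarrow> nat" where
  "first_skip W S cs w r =
     (LEAST p. letter_at cs p = r \<and> p \<notin> set (sorting_positions W S cs w))"

text \<open>The word \<open>a\<^sub>1 \<cdots> a\<^sub>i\<close> of those letters of the sorting word that precede the first skip of \<open>r\<close>.\<close>

definition skip_prefix :: "('a, 'b) monoid_scheme \<Rightarrow> 'a set \<Rightarrow> 'a list \<Rightarrow> 'a \<Rightarrow> 'a \<Rightarrow> 'a list" where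
  "skip_prefix W S cs w r =
     map (letter_at cs) (filter (\<lambda>p. p < first_skip W S cs w r) (sorting_positions W S cs w))"

definition unforced_skip :: "('a, 'b) monoid_scheme \<Rightarrow> 'a set \<Rightarrow> 'a list \<Rightarrow> 'a \<Rightarrow> 'a \<Rightarrow> bool" where
  "unforced_skip W S cs w r \<longleftrightarrow> reduced W S (skip_prefix W S cs w r @ [r])"

definition ufs :: "('a, 'b) monoid_scheme \<Rightarrow> 'a set \<Rightarrow> 'a list \<Rightarrow> 'a \<Rightarrow> 'a set" where
  "ufs W S cs w =
     {word_prod W (skip_prefix W S cs w r @ [r] @ rev (skip_prefix W S cs w r)) | r.
        r \<in> S \<and> unforced_skip W S cs w r}"

section \<open>The downward projection\<close>

text \<open>The recursion involves a choice of an initial letter \<open>s\<close> at every step and terminates by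
  induction on length and rank. The relation \<open>pi_down_rel W S c w v\<close> says that some sequence
  of choices yields \<open>v\<close>; \<open>pi_down W S c w\<close> is the common value of all of them.\<close>

inductive pi_down_rel ::
  "('a, 'b) monoid_scheme \<Rightarrow> 'a set \<Rightarrow> 'a \<Rightarrow> 'a \<Rightarrow> 'a \<Rightarrow> bool" where
  one: "pi_down_rel W S c \<one>\<^bsub>W\<^esub> \<one>\<^bsub>W\<^esub>"
| above: "\<lbrakk>s \<in> S; initial W S c s; weak_le W S s w;
    pi_down_rel W S (s \<otimes>\<^bsub>W\<^esub> c \<otimes>\<^bsub>W\<^esub> s) (s \<otimes>\<^bsub>W\<^esub> w) v\<rbrakk>
    \<Longrightarrow> pi_down_rel W S c w (s \<otimes>\<^bsub>W\<^esub> v)"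
| not_above: "\<lbrakk>s \<in> S; initial W S c s; \<not> weak_le W S s w;
    pi_down_rel (subgroup_generated W (S - {s})) (S - {s}) (s \<otimes>\<^bsub>W\<^esub> c)
      (parabolic_part W S (S - {s}) w) v\<rbrakk>
    \<Longrightarrow> pi_down_rel W S c w v"

definition pi_down :: "('a, 'b) monoid_scheme \<Rightarrow> 'a set \<Rightarrow> 'a \<Rightarrow> 'a \<Rightarrow> 'a" where
  "pi_down W S c w = (THE v. pi_down_rel W S c w v)"

end

theory Submission
  imports Defs Complex_Main
begin

text \<open>In the geometric representation a reflection is an inversion of \<open>w\<close> iff \<open>w\<^sup>-\<^sup>1\<close> changes
  the sign of its root. To the first skip of each letter \<open>r\<close> in the sorting word of a sortable \<open>v\<close>
  belongs the root \<open>a\<^sub>1 \<cdots> a\<^sub>i \<alpha>\<^sub>r\<close>; let \<open>C\<close> be the set of these roots. The positive elements of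
  \<open>C\<close> give \<open>ufs\<close>, the negative ones the cover reflections, so conditions (i) and (ii) together say
  that \<open>w\<^sup>-\<^sup>1\<close> makes all of \<open>C\<close> positive. This condition follows the recursion that defines the
  downward projection, with one exception: one has to see that \<open>w \<ge> s\<close> whenever \<open>s\<close> is initial and
  \<open>v \<ge> s\<close>. For this, \<open>-\<alpha>\<^sub>s\<close> is expanded in \<open>C\<close> by means of a dual basis with respect to the Euler
  form, and for initial \<open>s\<close> the coefficients are \<open>\<alpha>\<^sub>s\<close>-coordinates of positive vectors.\<close>

section \<open>Lists of positions\<close>

text \<open>For infinite \<open>W\<close> the symmetric form may be degenerate, so it need not
  provide a dual basis. The Euler form is unitriangular in the simple roots ordered by the word, and
  moving the first letter to the end amounts to reflecting both arguments in that letter. Dual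
  vectors can therefore be carried along the same recursion as the skip vectors. A second obstacle
  is that two recursions do not match: the sorting word always treats the next letter, while the
  projection may choose any initial letter. An initial letter commutes with all letters before it,
  and \<open>skips\<close> is invariant under exchanging adjacent orthogonal letters. Passing to a
  parabolic subgroup is harmless: on roots of that subgroup the inverses of \<open>w\<close> and of
  its parabolic part give the same signs, so conditions on skip vectors survive the removal of a
  skipped letter.\<close>

lemma lexord_map_Suc: "(xs, ys) \<in> lexord less_than \<Longrightarrow> (map Suc xs, map Suc ys) \<in> lexord less_than"
proof (induction xs arbitrary: ys)
  case Nil then show ?case by (cases ys) auto
next
  case (Cons x xs) then show ?case by (cases ys) auto
qed

lemma lexord_less_asym: "(xs, ys) \<in> lexord less_than \<Longrightarrow> (ys, xs) \<notin> lexord (less_than :: nat rel)"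
proof (induction xs arbitrary: ys)
  case Nil then show ?case by (cases ys) auto
next
  case (Cons x xs) then show ?case by (cases ys) auto
qed

lemma letter_at_rotate1: "cs \<noteq> [] \<Longrightarrow> letter_at (rotate1 cs) p = letter_at cs (Suc p)"
  by (simp add: letter_at_def nth_rotate1 mod_Suc_eq)

text \<open>Position 0 carries the first letter, and deleting it from the infinite word leaves the
  infinite word of \<open>rotate1 cs\<close>. The two cases say whether the first letter is used;
  \<open>qs\<close> are the positions in the rotated word.\<close>

lemma position_list_cases:
  assumes "sorted_wrt (<) (ps :: nat list)"
  obtains (pos) qs where "ps = map Suc qs" "sorted_wrt (<) qs"
    | (zero) qs where "ps = 0 # map Suc qs" "sorted_wrt (<) qs"
proof -
  have *: "\<exists>qs. rs = map Suc qs \<and> sorted_wrt (<) qs" if "sorted_wrt (<) rs" "0 \<notin> set rs" for rs :: "nat list"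
  proof -
    have "\<exists>qs. rs = map Suc qs" using that(2)
    proof (induction rs)
      case (Cons r rs)
      then obtain qs where "rs = map Suc qs" by auto
      moreover obtain q where "r = Suc q" using Cons.prems by (cases r) auto
      ultimately have "r # rs = map Suc (q # qs)" by simp
      then show ?case by (rule exI)
    qed simp
    then obtain qs where "rs = map Suc qs" by blast
    then show ?thesis using that(1) by (auto simp: sorted_wrt_map)
  qed
  show thesis
  proof (cases "0 \<in> set ps")
    case False then show ?thesis using *[OF assms] pos by blast
  next
    case True
    then obtain p rs where ps: "ps = p # rs" by (cases ps) auto
    then have "p = 0" "0 \<notin> set rs" "sorted_wrt (<) rs" using True assms by auto
    then show ?thesis using *[of rs] zero ps by blast
  qed
qed

lemma sorted_filter_split:
  assumes "sorted_wrt (<) (ps :: nat list)"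
  shows "ps = filter (\<lambda>p. p < f) ps @ filter (\<lambda>p. \<not> p < f) ps"
  using assms
proof (induction ps)
  case (Cons p ps)
  show ?case
  proof (cases "p < f")
    case False
    then have "filter (\<lambda>q. q < f) ps = []" "filter (\<lambda>q. \<not> q < f) ps = ps"
      using Cons.prems by (auto simp: filter_empty_conv filter_id_conv)
    then show ?thesis using False by simp
  qed (use Cons in simp)
qed simp

section \<open>The geometric representation\<close>

locale coxeter =
  fixes W :: "('a, 'b) monoid_scheme" (structure) and S :: "'a set"
  assumes coxeter_sys: "coxeter_system W S" and finite_S: "finite S"
begin

sublocale group W
  using coxeter_sys by (simp add: coxeter_system_def)

section \<open>Words and the subgroups generated by sets of letters\<close>

abbreviation prod :: "'a list \<Rightarrow> 'a" where "prod \<equiv> word_prod W"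
abbreviation gen :: "'a set \<Rightarrow> 'a set" where "gen \<equiv> generate W"

lemma S_carrier: "S \<subseteq> carrier W" and gen_S: "gen S = carrier W"
  using coxeter_sys by (auto simp: coxeter_system_def)

lemma S_in [simp]: "s \<in> S \<Longrightarrow> s \<in> carrier W"
  using S_carrier by auto

lemma S_square [simp]: assumes "s \<in> S" shows "s \<otimes> s = \<one>"
proof -
  have "ord s = 2" using coxeter_sys assms by (simp add: coxeter_system_def)
  then have "s [^] (2::nat) = \<one>" by (metis S_in assms pow_ord_eq_1)
  then show ?thesis using assms by (simp add: numeral_2_eq_2)
qed

lemma S_inv [simp]: "s \<in> S \<Longrightarrow> inv s = s"
  using inv_equality by simp

lemma S_cancel [simp]: "s \<in> S \<Longrightarrow> x \<in> carrier W \<Longrightarrow> s \<otimes> (s \<otimes> x) = x"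
  by (simp flip: m_assoc)

lemma word_prod_simps [simp]: "prod [] = \<one>" "prod (x # xs) = x \<otimes> prod xs"
  by (simp_all add: word_prod_def)

lemma word_prod_closed [simp]: "set xs \<subseteq> carrier W \<Longrightarrow> prod xs \<in> carrier W"
  by (induction xs) auto

lemma word_prod_in [simp]: "set xs \<subseteq> S \<Longrightarrow> prod xs \<in> carrier W"
  using S_carrier by (intro word_prod_closed) auto

lemma word_prod_append [simp]:
  "set xs \<subseteq> S \<Longrightarrow> set ys \<subseteq> S \<Longrightarrow> prod (xs @ ys) = prod xs \<otimes> prod ys"
  by (induction xs) (auto simp: m_assoc)

lemma word_prod_rev: "set xs \<subseteq> S \<Longrightarrow> prod (rev xs) = inv (prod xs)"
  by (induction xs) (auto simp: inv_mult_group)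

lemma gen_words:
  assumes "J \<subseteq> S"
  shows "gen J = prod ` lists J"
proof
  show "gen J \<subseteq> prod ` lists J"
  proof
    fix w assume "w \<in> gen J"
    then show "w \<in> prod ` lists J"
    proof induction
      case one show ?case by (intro image_eqI[of _ _ "[]"]) auto
    next
      case (incl h) then show ?case using assms
        by (intro image_eqI[of _ _ "[h]"]) auto
    next
      case (inv h) then have "inv h = h" using assms by auto
      with inv show ?case using assms
        by (intro image_eqI[of _ _ "[h]"]) auto
    next
      case (eng h1 h2)
      then obtain xs ys where *: "xs \<in> lists J" "ys \<in> lists J" "h1 = prod xs" "h2 = prod ys" by auto
      then show ?case using assms
        by (intro image_eqI[of _ _ "xs @ ys"]) (auto simp: lists_eq_set)
    qed
  qed
  show "prod ` lists J \<subseteq> gen J"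
  proof (rule image_subsetI)
    fix xs assume "xs \<in> lists J"
    then show "prod xs \<in> gen J"
      by (induction xs) (auto intro: generate.eng generate.incl generate.one)
  qed
qed

lemma gen_word_intro: "J \<subseteq> S \<Longrightarrow> set xs \<subseteq> J \<Longrightarrow> prod xs \<in> gen J"
  by (auto simp: gen_words lists_eq_set)

lemma gen_word_cases:
  assumes "w \<in> gen J" "J \<subseteq> S" obtains xs where "set xs \<subseteq> J" "w = prod xs"
  using assms by (auto simp: gen_words lists_eq_set)

lemma gen_closed [simp]: "J \<subseteq> S \<Longrightarrow> w \<in> gen J \<Longrightarrow> w \<in> carrier W"
  using S_carrier generate_in_carrier by blast

lemma gen_inv: "J \<subseteq> S \<Longrightarrow> w \<in> gen J \<Longrightarrow> inv w \<in> gen J"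
  using S_carrier by (meson generate_m_inv_closed subset_trans)

lemma gen_mult_left:
  assumes "s \<in> J" "J \<subseteq> S" "w \<in> carrier W"
  shows "s \<otimes> w \<in> gen J \<longleftrightarrow> w \<in> gen J"
proof
  assume "s \<otimes> w \<in> gen J"
  then have "s \<otimes> (s \<otimes> w) \<in> gen J" using assms by (metis generate.eng generate.incl)
  then show "w \<in> gen J" using assms by (metis S_cancel subset_iff)
qed (use assms in \<open>auto intro: generate.intros\<close>)

text \<open>\<open>ord\<close> is 0 for infinite order, and -1 is the limit of
  \<open>- cos (pi / m)\<close> as \<open>m\<close> grows. Vectors are real functions on the whole
  type, so the same vectors serve all standard parabolic subgroups.\<close>

definition B :: "'a \<Rightarrow> 'a \<Rightarrow> real" where
  "B s t = (if ord (s \<otimes> t) = 0 then -1 else - cos (pi / ord (s \<otimes> t)))"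

definition simple :: "'a \<Rightarrow> 'a \<Rightarrow> real" where
  "simple s = (\<lambda>a. if a = s then 1 else 0)"

definition pairing :: "('a \<Rightarrow> real) \<Rightarrow> 'a \<Rightarrow> real" where
  "pairing x s = (\<Sum>b\<in>S. x b * B b s)"

definition reflect :: "'a \<Rightarrow> ('a \<Rightarrow> real) \<Rightarrow> 'a \<Rightarrow> real" where
  "reflect s x = (\<lambda>a. x a - 2 * pairing x s * simple s a)"

lemma ord_commute: assumes "s \<in> S" "t \<in> S" shows "ord (s \<otimes> t) = ord (t \<otimes> s)"
proof -
  have "inv (s \<otimes> t) = t \<otimes> s" using assms by (simp add: inv_mult_group)
  moreover have "ord (inv (s \<otimes> t)) = ord (s \<otimes> t)" using assms by (intro ord_inv) auto
  ultimately show ?thesis by simp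
qed

lemma B_commute: "s \<in> S \<Longrightarrow> t \<in> S \<Longrightarrow> B s t = B t s"
  by (simp add: B_def ord_commute)

lemma B_same [simp]: "s \<in> S \<Longrightarrow> B s s = 1"
  by (simp add: B_def ord_id)

lemma ord_ge_2: assumes "s \<in> S" "t \<in> S" "s \<noteq> t" shows "ord (s \<otimes> t) \<noteq> 1"
proof
  assume "ord (s \<otimes> t) = 1"
  then have "s \<otimes> t = \<one>" using assms ord_eq_1[of "s \<otimes> t"] by simp
  then have "s \<otimes> (s \<otimes> t) = s" using assms by simp
  then show False using assms by simp
qed

lemma B_nonpos: assumes "s \<in> S" "t \<in> S" "s \<noteq> t" shows "B s t \<le> 0"
proof (cases "ord (s \<otimes> t) = 0")
  case False
  with ord_ge_2[OF assms] have "2 \<le> real (ord (s \<otimes> t))" by linarith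
  then have "pi / ord (s \<otimes> t) \<le> pi / 2" using pi_gt_zero by (intro divide_left_mono) auto
  then have "cos (pi / ord (s \<otimes> t)) \<ge> 0" using False by (intro cos_ge_zero) (auto intro: order_trans[of _ 0])
  then show ?thesis by (simp add: B_def)
qed (simp add: B_def)

lemma B_zero_commute: assumes "s \<in> S" "t \<in> S" "B s t = 0" shows "s \<otimes> t = t \<otimes> s"
proof (cases "s = t")
  case False
  define m where "m = ord (s \<otimes> t)"
  have m: "m \<noteq> 0" "cos (pi / m) = 0" using assms by (auto simp: B_def m_def split: if_splits)
  have "m \<noteq> 1" using ord_ge_2 assms False by (auto simp: m_def)
  have "m = 2"
  proof (rule ccontr)
    assume "m \<noteq> 2"
    with m \<open>m \<noteq> 1\<close> have "2 < real m" by linarith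
    then have "pi / m < pi / 2" using pi_gt_zero by (intro divide_strict_left_mono) auto
    then have "cos (pi / m) > 0" using m by (intro cos_gt_zero_pi) (auto intro: less_le_trans[of _ 0])
    then show False using m by simp
  qed
  then have "(s \<otimes> t) [^] (2::nat) = \<one>" unfolding m_def by (metis S_in assms(1,2) m_closed pow_ord_eq_1)
  then have "(s \<otimes> t) \<otimes> (s \<otimes> t) = \<one>" using assms by (simp add: numeral_2_eq_2)
  then have "inv (s \<otimes> t) = s \<otimes> t" using assms inv_equality by simp
  then show ?thesis using assms by (simp add: inv_mult_group)
qed simp

section \<open>Linear operators and the action of words\<close>

definition linear_op :: "(('a \<Rightarrow> real) \<Rightarrow> 'a \<Rightarrow> real) \<Rightarrow> bool" where
  "linear_op f \<longleftrightarrow> (\<forall>x y c. f (\<lambda>a. x a + c * y a) = (\<lambda>a. f x a + c * f y a))"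

lemma linear_op_zero: assumes "linear_op f" shows "f (\<lambda>a. 0) = (\<lambda>a. 0)"
proof -
  have "f (\<lambda>a. 0 + -1 * 0) = (\<lambda>a. f (\<lambda>a. 0) a + -1 * f (\<lambda>a. 0) a)"
    using assms[unfolded linear_op_def, rule_format, of "\<lambda>a. 0" "-1" "\<lambda>a. 0"] .
  then show ?thesis by simp
qed

lemma linear_op_add: "linear_op f \<Longrightarrow> f (\<lambda>a. x a + c * y a) = (\<lambda>a. f x a + c * f y a)"
  by (simp add: linear_op_def)

lemma linear_op_scale: assumes "linear_op f" shows "f (\<lambda>a. c * y a) = (\<lambda>a. c * f y a)"
  using linear_op_add[OF assms, of "\<lambda>a. 0" c y] linear_op_zero[OF assms] by simp

lemma linear_op_minus: assumes "linear_op f" shows "f (\<lambda>a. - y a) = (\<lambda>a. - f y a)"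
  using linear_op_scale[OF assms, of "-1" y] by simp

lemma linear_op_sum_list:
  assumes "linear_op f"
  shows "f (\<lambda>a. \<Sum>(n, d)\<leftarrow>gs. g n * d a) = (\<lambda>a. \<Sum>(n, d)\<leftarrow>gs. g n * f d a)"
proof (induction gs)
  case Nil then show ?case using linear_op_zero[OF assms] by simp
next
  case (Cons p gs)
  obtain n d where p: "p = (n, d)" by force
  have "f (\<lambda>a. (\<Sum>(n, d)\<leftarrow>gs. g n * d a) + g n * d a)
      = (\<lambda>a. f (\<lambda>a. \<Sum>(n, d)\<leftarrow>gs. g n * d a) a + g n * f d a)"
    using linear_op_add[OF assms, of "\<lambda>a. \<Sum>(n, d)\<leftarrow>gs. g n * d a" "g n" d] .
  then show ?case using Cons by (simp add: p add.commute)
qed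

lemma pairing_add: "pairing (\<lambda>a. x a + c * y a) s = pairing x s + c * pairing y s"
  by (simp add: pairing_def sum_distrib_left sum.distrib algebra_simps)

lemma pairing_simple: "t \<in> S \<Longrightarrow> pairing (simple t) s = B t s"
  using finite_S by (simp add: pairing_def simple_def if_distrib[of "\<lambda>z. z * _"] cong: if_cong)

lemma linear_reflect: "linear_op (reflect s)"
  by (simp add: linear_op_def reflect_def pairing_add algebra_simps)

lemma reflect_simple: "s \<in> S \<Longrightarrow> t \<in> S \<Longrightarrow> reflect s (simple t) = (\<lambda>a. simple t a - 2 * B t s * simple s a)"
  by (simp add: reflect_def pairing_simple)

lemma reflect_same: "s \<in> S \<Longrightarrow> reflect s (simple s) = (\<lambda>a. - simple s a)"
  by (simp add: reflect_simple)

lemma reflect_reflect [simp]: assumes "s \<in> S" shows "reflect s (reflect s x) = x"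
proof -
  have "pairing (\<lambda>a. x a + (- 2 * pairing x s) * simple s a) s = - pairing x s"
    unfolding pairing_add using assms by (simp add: pairing_simple)
  then show ?thesis by (simp add: reflect_def)
qed

lemma reflect_other: "a \<noteq> s \<Longrightarrow> reflect s x a = x a"
  by (simp add: reflect_def simple_def)

definition wact :: "'a list \<Rightarrow> ('a \<Rightarrow> real) \<Rightarrow> 'a \<Rightarrow> real" where
  "wact xs = foldr reflect xs"

lemma wact_simps [simp]: "wact [] x = x" "wact (s # xs) x = reflect s (wact xs x)"
    "wact (xs @ ys) x = wact xs (wact ys x)"
  by (simp_all add: wact_def)

lemma linear_wact: "linear_op (wact xs)"
proof (induction xs)
  case (Cons s xs) then show ?case using linear_reflect[of s] by (simp add: linear_op_def)
qed (simp add: linear_op_def)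

lemma wact_rev: "set xs \<subseteq> S \<Longrightarrow> wact (rev xs) (wact xs x) = x"
  by (induction xs arbitrary: x) auto

lemma wact_other: "a \<notin> set xs \<Longrightarrow> wact xs x a = x a"
  by (induction xs) (auto simp: reflect_other)

section \<open>Dihedral subgroups and their relators\<close>

fun alt :: "'a \<Rightarrow> 'a \<Rightarrow> nat \<Rightarrow> 'a list" where
  "alt s t 0 = []"
| "alt s t (Suc k) = (if even k then t else s) # alt s t k"

lemma length_alt [simp]: "length (alt s t k) = k"
  by (induction k) auto

lemma set_alt: "set (alt s t k) \<subseteq> {s, t}"
  by (induction k) auto

text \<open>The recursion grows the word on the left and keeps the last letter \<open>t\<close>;
  splitting off that last letter instead exchanges the roles of \<open>s\<close> and
  \<open>t\<close>.\<close>

lemma alt_snoc: "alt s t (Suc k) = alt t s k @ [t]"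
proof (induction k)
  case (Suc k)
  have "alt s t (Suc (Suc k)) = (if even (Suc k) then t else s) # alt s t (Suc k)" by simp
  also have "\<dots> = (if even k then s else t) # alt t s k @ [t]" unfolding Suc by simp
  finally show ?case by simp
qed simp

lemma alt_even: "alt s t (2 * k) = concat (replicate k [s, t])"
  by (induction k) auto

text \<open>\<open>sin (k\<theta>) / sin \<theta>\<close> for \<open>\<theta> = \<pi>/m\<close>, and its limit \<open>k\<close> for \<open>m = \<infinity>\<close> (encoded as \<open>m = 0\<close>).\<close>
definition cheb :: "nat \<Rightarrow> nat \<Rightarrow> real" where
  "cheb m k = (if m = 0 then real k else sin (k * (pi / m)) / sin (pi / m))"

lemma sin_pi_div: "m \<ge> 2 \<Longrightarrow> sin (pi / real m) > 0"
  by (rule sin_gt_zero) (auto simp: divide_less_eq)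

lemma cheb_0 [simp]: "cheb m 0 = 0"
  by (simp add: cheb_def)

lemma cheb_1: "m \<noteq> 1 \<Longrightarrow> cheb m (Suc 0) = 1"
  using sin_pi_div[of m] by (cases "m = 0") (auto simp: cheb_def)

text \<open>This is \<open>sin (a + b) + sin (a - b) = 2 * cos b * sin a\<close> divided by the sine
  of \<theta>; the factor \<open>- 2 * B s t\<close> is twice the cosine of \<theta>, and 2 in the
  infinite case.\<close>

lemma cheb_rec:
  assumes "s \<in> S" "t \<in> S" "s \<noteq> t"
  defines "m \<equiv> ord (s \<otimes> t)"
  shows "cheb m (Suc (Suc k)) = - 2 * B s t * cheb m (Suc k) - cheb m k"
proof (cases "m = 0")
  case True then show ?thesis by (simp add: cheb_def B_def flip: m_def)
next
  case False
  then have pos: "sin (pi / m) > 0" using ord_ge_2[OF assms(1-3)] by (intro sin_pi_div) (auto simp: m_def)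
  define th where "th = pi / m"
  have "sin (real (Suc k) * th + th) + sin (real (Suc k) * th - th) = 2 * cos th * sin (real (Suc k) * th)"
    by (simp add: sin_add sin_diff)
  moreover have "real (Suc k) * th + th = real (Suc (Suc k)) * th" "real (Suc k) * th - th = real k * th"
    by (auto simp: algebra_simps)
  ultimately have "sin (real (Suc (Suc k)) * th) = 2 * cos th * sin (real (Suc k) * th) - sin (real k * th)"
    by simp
  then show ?thesis using False pos
    by (simp add: cheb_def B_def field_simps flip: m_def th_def)
qed

lemma cheb_nonneg: assumes "m \<noteq> 1" "m = 0 \<or> k \<le> m" shows "cheb m k \<ge> 0"
proof (cases "m = 0")
  case False
  then have "sin (pi / m) > 0" using assms by (intro sin_pi_div) auto
  moreover have "sin (k * (pi / m)) \<ge> 0" using assms False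
    by (intro sin_ge_zero) (auto simp: field_simps)
  ultimately show ?thesis by (simp add: cheb_def)
qed (simp add: cheb_def)

text \<open>Each further reflection changes only one of the two coordinates, and the change is one
  step of the three-term recursion \<open>cheb_rec\<close>. The parity of \<open>k\<close> tells
  which coordinate carries the larger index.\<close>

lemma wact_alt:
  assumes "s \<in> S" "t \<in> S" "s \<noteq> t"
  defines "m \<equiv> ord (s \<otimes> t)"
  shows "wact (alt s t k) (simple s) =
    (\<lambda>a. cheb m (if even k then Suc k else k) * simple s a + cheb m (if even k then k else Suc k) * simple t a)"
proof (induction k)
  case 0
  then show ?case using ord_ge_2[OF assms(1-3)] by (auto simp: cheb_1 m_def)
next
  case (Suc k)
  have m: "cheb m (Suc (Suc k)) = - 2 * B s t * cheb m (Suc k) - cheb m k"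
    unfolding m_def by (rule cheb_rec[OF assms(1-3)])
  let ?p = "cheb m (if even k then Suc k else k)" and ?q = "cheb m (if even k then k else Suc k)"
  have "reflect u (\<lambda>a. ?p * simple s a + ?q * simple t a) =
        (\<lambda>a. ?p * reflect u (simple s) a + ?q * reflect u (simple t) a)" for u
    using linear_op_add[OF linear_reflect, of u "\<lambda>a. ?p * simple s a" ?q "simple t"]
      linear_op_scale[OF linear_reflect, of u ?p "simple s"] by simp
  note lin = this
  have "wact (alt s t (Suc k)) (simple s) =
      reflect (if even k then t else s) (\<lambda>a. ?p * simple s a + ?q * simple t a)"
    using Suc by simp
  also have "\<dots> = (\<lambda>a. ?p * reflect (if even k then t else s) (simple s) a +
      ?q * reflect (if even k then t else s) (simple t) a)"
    by (rule lin)
  finally show ?case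
    using assms(1-3) B_commute[OF assms(1,2)]
    by (auto simp: reflect_simple m algebra_simps fun_eq_iff)
qed

text \<open>The word of length \<open>2 * m\<close> is a full turn: \<open>cheb m\<close> takes the
  values -1, 0 and 1 at \<open>2 * m - 1\<close>, \<open>2 * m\<close> and
  \<open>2 * m + 1\<close>.\<close>

lemma wact_relator_plane:
  assumes "s \<in> S" "t \<in> S" "s \<noteq> t" "ord (s \<otimes> t) \<noteq> 0"
  defines "m \<equiv> ord (s \<otimes> t)"
  shows "wact (alt s t (2 * m)) (simple s) = simple s"
    and "wact (alt s t (2 * m)) (simple t) = simple t"
proof -
  have m2: "m \<ge> 2" using ord_ge_2[OF assms(1-3)] assms(4) by (auto simp: m_def)
  then have pos: "sin (pi / m) > 0" by (rule sin_pi_div)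
  have a: "real (2 * m) * (pi / real m) = 2 * pi" using m2 by simp
  have "real (Suc (2 * m)) * (pi / real m) = pi / real m + 2 * pi"  
  proof -
    have "real (Suc (2 * m)) = 1 + 2 * real m" by simp
    then show ?thesis using m2 by (simp add: field_simps)
  qed
  then have c1: "cheb m (Suc (2 * m)) = 1"
    using pos m2 by (simp only: cheb_def sin_periodic) simp
  have c0: "cheb m (2 * m) = 0" using m2 unfolding cheb_def a by simp
  obtain k where k: "2 * m = Suc k" using m2 by (cases "2 * m") auto
  then have ok: "odd k" by presburger
  have "real k * (pi / real m) = - (pi / real m) + 2 * pi"
  proof -
    have "real k = 2 * real m - 1" using k by linarith
    then show ?thesis unfolding \<open>real k = _\<close> using m2 by (simp add: field_simps)
  qed
  then have cm: "cheb m k = -1"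
    using pos m2 by (simp only: cheb_def sin_periodic) simp
  show "wact (alt s t (2 * m)) (simple s) = simple s"
    using wact_alt[OF assms(1-3), of "2 * m"] c0 c1 by (simp flip: m_def)
  have "wact (alt s t (2 * m)) (simple t) = wact (alt t s k) (\<lambda>a. - simple t a)"
    unfolding k alt_snoc using assms by (simp add: reflect_same)
  also have "\<dots> = (\<lambda>a. - wact (alt t s k) (simple t) a)"
    by (rule linear_op_minus[OF linear_wact])
  also have "\<dots> = simple t"
    using wact_alt[OF assms(2,1), of k] assms(3) ok c0 cm ord_commute[OF assms(2,1)] k by (simp flip: m_def)
  finally show "wact (alt s t (2 * m)) (simple t) = simple t" .
qed

lemma reflect_fixed: "pairing x s = 0 \<Longrightarrow> reflect s x = x"
  by (simp add: reflect_def)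

text \<open>For finite order the form is nondegenerate on the plane of \<open>s\<close> and \<open>t\<close>, so every vector splits
  into a part in the plane and a part fixed by both reflections.\<close>
lemma wact_relator:
  assumes "s \<in> S" "t \<in> S"
  shows "wact (concat (replicate (ord (s \<otimes> t)) [s, t])) x = x"
proof -
  define m where "m = ord (s \<otimes> t)"
  consider "m = 0" | "s = t" | "m \<noteq> 0" "s \<noteq> t" by blast
  then show ?thesis
  proof cases
    case 1 then show ?thesis by (simp add: m_def)
  next
    case 2 then show ?thesis using assms by (simp add: ord_id)
  next
    case 3
    have m2: "m \<ge> 2" using ord_ge_2[OF assms 3(2)] 3 by (auto simp: m_def)
    define b where "b = B s t"
    have D: "1 - b\<^sup>2 > 0"
    proof -
      have "b = - cos (pi / m)" using 3 by (simp add: b_def B_def m_def)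
      then have "1 - b\<^sup>2 = (sin (pi / m))\<^sup>2" using sin_cos_squared_add[of "pi / m"] by (simp add: algebra_simps)
      then show ?thesis using sin_pi_div[OF m2] by simp
    qed
    \<comment> \<open>Cramer's rule: \<open>p\<close> and \<open>q\<close> are the coefficients of
      the plane part of \<open>x\<close>, and \<open>1 - b\<^sup>2\<close> is the Gram determinant
      of the plane.\<close>
    define p where "p = (pairing x s - b * pairing x t) / (1 - b\<^sup>2)"
    define q where "q = (pairing x t - b * pairing x s) / (1 - b\<^sup>2)"
    have pD: "p * (1 - b\<^sup>2) = pairing x s - b * pairing x t"
      and qD: "q * (1 - b\<^sup>2) = pairing x t - b * pairing x s"
      using D by (auto simp: p_def q_def)
    have "(p + q * b) * (1 - b\<^sup>2) = p * (1 - b\<^sup>2) + b * (q * (1 - b\<^sup>2))"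
      "(p * b + q) * (1 - b\<^sup>2) = b * (p * (1 - b\<^sup>2)) + q * (1 - b\<^sup>2)"
      by (simp_all add: algebra_simps)
    then have "(p + q * b) * (1 - b\<^sup>2) = pairing x s * (1 - b\<^sup>2)"
      "(p * b + q) * (1 - b\<^sup>2) = pairing x t * (1 - b\<^sup>2)"
      unfolding pD qD by (simp_all add: algebra_simps power2_eq_square)
    then have pq: "p + q * b = pairing x s" "p * b + q = pairing x t"
      using D by auto
    define y where "y = (\<lambda>a. (x a + (- p) * simple s a) + (- q) * simple t a)"
    have ys: "pairing y s = 0" "pairing y t = 0"
      unfolding y_def pairing_add using assms pq B_commute[OF assms]
      by (simp_all add: pairing_simple b_def algebra_simps)
    have fix_y: "wact us y = y" if "set us \<subseteq> {s, t}" for us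
      using that ys by (induction us) (auto simp: reflect_fixed)
    have x: "x = (\<lambda>a. (y a + p * simple s a) + q * simple t a)" by (simp add: y_def)
    let ?f = "wact (alt s t (2 * m))"
    have "?f (\<lambda>a. (y a + p * simple s a) + q * simple t a) =
        (\<lambda>a. ?f (\<lambda>a. y a + p * simple s a) a + q * ?f (simple t) a)"
      by (rule linear_op_add[OF linear_wact])
    also have "?f (\<lambda>a. y a + p * simple s a) = (\<lambda>a. ?f y a + p * ?f (simple s) a)"
      by (rule linear_op_add[OF linear_wact])
    also have "?f y = y" by (rule fix_y[OF set_alt])
    finally have "?f x = x"
      using wact_relator_plane[OF assms 3(2)] 3 x by (simp add: m_def)
    then show ?thesis by (simp add: alt_even m_def)
  qed
qed

section \<open>The action of group elements\<close>

lemma wact_equiv: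
  assumes "equivclp (insert_relator W S) xs ys"
  shows "wact xs = wact ys"
  using assms
proof (induction rule: equivclp_induct)
  case (step y z)
  have "wact u = wact v" if "insert_relator W S u v" for u v
    using that by cases (auto simp: wact_relator fun_eq_iff)
  with step show ?case by metis
qed simp

text \<open>The presentation enters here: \<open>ys @ rev xs\<close> is a word for the identity, so
  insertions and deletions of relators lead from it to the empty word, and none of them changes the
  action.\<close>

lemma wact_word_prod:
  assumes "set xs \<subseteq> S" "set ys \<subseteq> S" "prod xs = prod ys"
  shows "wact xs = wact ys"
proof
  fix x
  have "prod (ys @ rev xs) = \<one>" using assms by (simp add: word_prod_rev)
  moreover have "ys @ rev xs \<in> lists S" using assms by auto
  ultimately have "wact (ys @ rev xs) = wact []"
    using coxeter_sys wact_equiv unfolding coxeter_system_def by blast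
  then have "wact (ys @ rev xs) (wact xs x) = wact xs x" by (simp del: wact_simps(3))
  then show "wact xs x = wact ys x" using wact_rev[OF assms(1)] by simp
qed

definition act :: "'a \<Rightarrow> ('a \<Rightarrow> real) \<Rightarrow> 'a \<Rightarrow> real" where
  "act w = wact (SOME xs. set xs \<subseteq> S \<and> prod xs = w)"

lemma act_word: assumes "set xs \<subseteq> S" shows "act (prod xs) = wact xs"
proof -
  have "set (SOME ys. set ys \<subseteq> S \<and> prod ys = prod xs) \<subseteq> S \<and> prod (SOME ys. set ys \<subseteq> S \<and> prod ys = prod xs) = prod xs"
    by (rule someI[of _ xs]) (use assms in simp)
  then show ?thesis unfolding act_def using assms wact_word_prod by blast
qed

lemma carrier_word: assumes "w \<in> carrier W" obtains xs where "set xs \<subseteq> S" "w = prod xs"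
  using assms gen_word_cases[of w S] gen_S by blast

lemma act_one [simp]: "act \<one> x = x"
  using act_word[of "[]"] by simp

lemma act_S: "s \<in> S \<Longrightarrow> act s = reflect s"
  using act_word[of "[s]"] by (simp add: fun_eq_iff)

lemma act_mult: assumes "u \<in> carrier W" "w \<in> carrier W" shows "act (u \<otimes> w) x = act u (act w x)"
proof -
  obtain us ws where "set us \<subseteq> S" "u = prod us" "set ws \<subseteq> S" "w = prod ws"
    using assms carrier_word by metis
  then show ?thesis using act_word[of "us @ ws"] by (simp add: act_word)
qed

lemma act_inv [simp]: "w \<in> carrier W \<Longrightarrow> act (inv w) (act w x) = x"
    "w \<in> carrier W \<Longrightarrow> act w (act (inv w) x) = x"
  by (simp_all flip: act_mult)

lemma linear_act: "linear_op (act w)"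
  by (simp add: act_def linear_wact)

lemma act_minus: "act w (\<lambda>a. - x a) = (\<lambda>a. - act w x a)"
  by (rule linear_op_minus[OF linear_act])

text \<open>A reflection in a letter changes only the coordinate at that letter. Coordinates outside
  \<open>J\<close> are therefore invariants of the subgroup; later they detect letters that do not
  occur and show that roots stay positive.\<close>

lemma act_other: assumes "J \<subseteq> S" "w \<in> gen J" "a \<notin> J" shows "act w x a = x a"
proof -
  obtain xs where xs: "set xs \<subseteq> J" "w = prod xs" using assms gen_word_cases by metis
  then have "act w = wact xs" using assms act_word by blast
  then show ?thesis using wact_other xs assms by auto
qed

section \<open>The invariant form and the roots\<close>

definition form :: "('a \<Rightarrow> real) \<Rightarrow> ('a \<Rightarrow> real) \<Rightarrow> real" where
  "form x y = (\<Sum>b\<in>S. pairing x b * y b)"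

lemma form_commute: "form x y = form y x"
proof -
  have "form x y = (\<Sum>b\<in>S. \<Sum>a\<in>S. x a * B a b * y b)"
    by (simp add: form_def pairing_def sum_distrib_right)
  also have "\<dots> = (\<Sum>a\<in>S. \<Sum>b\<in>S. x a * B a b * y b)" by (rule sum.swap)
  also have "\<dots> = (\<Sum>a\<in>S. \<Sum>b\<in>S. y b * B b a * x a)"
    by (intro sum.cong) (auto simp: B_commute)
  also have "\<dots> = form y x"
    by (simp add: form_def pairing_def sum_distrib_right)
  finally show ?thesis .
qed

lemma form_add: "form (\<lambda>a. x a + c * y a) z = form x z + c * form y z"
  by (simp add: form_def pairing_add sum_distrib_left sum.distrib algebra_simps)

lemma form_add_right: "form z (\<lambda>a. x a + c * y a) = form z x + c * form z y"
  by (simp add: form_commute[of z] form_add)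

lemma form_simple: "s \<in> S \<Longrightarrow> form x (simple s) = pairing x s"
  using finite_S by (simp add: form_def simple_def if_distrib[of "\<lambda>z. _ * z"] cong: if_cong)

lemma form_reflect: assumes "s \<in> S" shows "form (reflect s x) (reflect s y) = form x y"
proof -
  have r: "reflect s z = (\<lambda>a. z a + (- 2 * pairing z s) * simple s a)" for z
    by (simp add: reflect_def)
  have "form (simple s) (simple s) = 1" using assms by (simp add: form_simple pairing_simple)
  then show ?thesis
    unfolding r form_add form_add_right
    using form_simple[OF assms, of x] form_simple[OF assms, of y] form_commute[of "simple s" y]
    by (simp add: algebra_simps)
qed

lemma form_act: assumes "w \<in> carrier W" shows "form (act w x) (act w y) = form x y"
proof -
  obtain xs where xs: "set xs \<subseteq> S" "w = prod xs" using assms carrier_word by metis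
  from xs(1) have "form (wact xs x) (wact xs y) = form x y"
    by (induction xs) (auto simp: form_reflect)
  then show ?thesis by (simp add: xs act_word)
qed

definition roots :: "'a set \<Rightarrow> ('a \<Rightarrow> real) set" where
  "roots J = {act u (simple r) | u r. u \<in> gen J \<and> r \<in> J}"

definition nonneg :: "('a \<Rightarrow> real) \<Rightarrow> bool" where "nonneg x \<longleftrightarrow> (\<forall>a. 0 \<le> x a)"
definition nonpos :: "('a \<Rightarrow> real) \<Rightarrow> bool" where "nonpos x \<longleftrightarrow> (\<forall>a. x a \<le> 0)"

lemma nonneg_minus [simp]: "nonneg (\<lambda>a. - x a) \<longleftrightarrow> nonpos x"
    "nonpos (\<lambda>a. - x a) \<longleftrightarrow> nonneg x"
  by (auto simp: nonneg_def nonpos_def)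

lemma nonneg_simple [simp]: "nonneg (simple s)" "\<not> nonpos (simple s)"
  by (auto simp: nonneg_def nonpos_def simple_def intro!: exI[of _ s])

lemma root_norm: assumes "x \<in> roots J" "J \<subseteq> S" shows "form x x = 1"
proof -
  obtain u r where "u \<in> gen J" "r \<in> J" "x = act u (simple r)" using assms by (auto simp: roots_def)
  then show ?thesis using assms by (auto simp: form_act form_simple pairing_simple)
qed

lemma not_both_signs: assumes "x \<in> roots J" "J \<subseteq> S" shows "\<not> (nonneg x \<and> nonpos x)"
proof
  assume "nonneg x \<and> nonpos x"
  then have "x = (\<lambda>a. 0)" by (intro ext order_antisym) (auto simp: nonneg_def nonpos_def)
  then have "form x x = 0" by (simp add: form_def)
  then show False using root_norm[OF assms] by simp
qed

lemma gen_mono: "K \<subseteq> J \<Longrightarrow> J \<subseteq> S \<Longrightarrow> gen K \<subseteq> gen J"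
  using mono_generate by blast

lemma roots_mono: "K \<subseteq> J \<Longrightarrow> J \<subseteq> S \<Longrightarrow> roots K \<subseteq> roots J"
  using gen_mono unfolding roots_def by blast

lemma gen_closed_mult: "J \<subseteq> S \<Longrightarrow> u \<in> gen J \<Longrightarrow> w \<in> gen J \<Longrightarrow> u \<otimes> w \<in> gen J"
  by (rule generate.eng)

lemma roots_act: assumes "x \<in> roots J" "w \<in> gen J" "J \<subseteq> S" shows "act w x \<in> roots J"
proof -
  obtain u r where "u \<in> gen J" "r \<in> J" "x = act u (simple r)" using assms by (auto simp: roots_def)
  moreover have "act w (act u (simple r)) = act (w \<otimes> u) (simple r)"
    using calculation assms by (simp add: act_mult)
  ultimately show ?thesis using assms gen_closed_mult[of J w u] unfolding roots_def by auto
qed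

lemma roots_reflect: "x \<in> roots J \<Longrightarrow> s \<in> J \<Longrightarrow> J \<subseteq> S \<Longrightarrow> reflect s x \<in> roots J"
  using roots_act[of x J s] by (auto simp: act_S generate.incl)

lemma simple_root: "s \<in> J \<Longrightarrow> J \<subseteq> S \<Longrightarrow> simple s \<in> roots J"
  unfolding roots_def using generate.one[of W J] by (force intro: exI[of _ "\<one>"])

lemma root_support: assumes "x \<in> roots J" "J \<subseteq> S" "a \<notin> J" shows "x a = 0"
  using assms by (auto simp: roots_def act_other simple_def)

section \<open>Length and positivity\<close>

abbreviation len :: "'a set \<Rightarrow> 'a \<Rightarrow> nat" where "len J \<equiv> cox_length W J"

lemma len_word:
  assumes "w \<in> gen J" "J \<subseteq> S"
  obtains xs where "set xs \<subseteq> J" "prod xs = w" "length xs = len J w"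
proof -
  obtain xs where "set xs \<subseteq> J" "w = prod xs" using assms gen_word_cases by metis
  then have "\<exists>xs\<in>lists J. length xs = length xs \<and> prod xs = w" by (auto intro!: bexI[of _ xs])
  then have "\<exists>n. \<exists>xs\<in>lists J. length xs = n \<and> prod xs = w" by blast
  from LeastI_ex[OF this] show ?thesis
    using that unfolding cox_length_def by (auto simp: lists_eq_set)
qed

lemma len_le: "set xs \<subseteq> J \<Longrightarrow> len J (prod xs) \<le> length xs"
  unfolding cox_length_def by (rule Least_le) (auto simp: lists_eq_set)

lemma len_mult_le:
  assumes "w \<in> gen J" "J \<subseteq> S" "set xs \<subseteq> J"
  shows "len J (w \<otimes> prod xs) \<le> len J w + length xs"
proof -
  obtain ws where "set ws \<subseteq> J" "prod ws = w" "length ws = len J w" using len_word assms by metis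
  then show ?thesis using len_le[of "ws @ xs" J] assms by auto
qed

lemma len_one [simp]: "len J \<one> = 0"
  using len_le[of "[]" J] by simp

text \<open>Cancelling the first \<open>j\<close> letters of the relator leaves the inverse of the
  cancelled part, which is that part read backwards. If \<open>j\<close> is the order of
  \<open>s \<otimes> t\<close>, this is the braid relation.\<close>

lemma alt_relation:
  assumes "s \<in> S" "t \<in> S" "j \<le> 2 * ord (s \<otimes> t)"
  shows "prod (alt s t (2 * ord (s \<otimes> t) - j)) = prod (alt t s j)"
  using assms(3)
proof (induction j)
  case 0
  have "prod (concat (replicate k [s, t])) = (s \<otimes> t) [^] k" for k
  proof (induction k)
    case (Suc k)
    have "(s \<otimes> t) [^] Suc k = (s \<otimes> t) \<otimes> (s \<otimes> t) [^] k"
      using assms by (intro nat_pow_Suc2) simp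
    then show ?case using Suc assms by (simp add: m_assoc)
  qed simp
  then show ?case using assms by (simp add: alt_even)
next
  case (Suc j)
  let ?n = "2 * ord (s \<otimes> t)"
  define i where "i = ?n - Suc j"
  have i: "?n - j = Suc i" using Suc by (simp add: i_def)
  then have p: "even i \<longleftrightarrow> odd j" using Suc.prems by presburger
  have "set (alt s t i) \<subseteq> S" "set (alt t s j) \<subseteq> S" using set_alt assms by fastforce+
  moreover have "prod (alt s t (Suc i)) = prod (alt t s j)" using Suc i by simp
  moreover define l where "l = (if even j then s else t)"
  moreover have "alt s t (Suc i) = l # alt s t i" "alt t s (Suc j) = l # alt t s j" using p by (auto simp: l_def)
  moreover have "l \<in> S" using assms by (simp add: l_def)
  ultimately have "prod (alt s t i) = prod (alt t s (Suc j))" by (metis S_cancel word_prod_in word_prod_simps(2))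
  then show ?case by (simp add: i_def)
qed

lemma alt_append: "\<exists>zs. alt s t (j + k) = zs @ alt s t k \<and> length zs = j \<and> set zs \<subseteq> {s, t}"
proof (induction j)
  case (Suc j)
  then obtain zs where "alt s t (j + k) = zs @ alt s t k" "length zs = j" "set zs \<subseteq> {s, t}" by blast
  then show ?case by (intro exI[of _ "(if even (j + k) then t else s) # zs"]) auto
qed simp

text \<open>Write \<open>w = v d\<close> with \<open>d\<close> an alternating word in \<open>s\<close> and a right descent \<open>t\<close> of \<open>w\<close>, lengths
  adding up and \<open>d\<close> as long as possible; then the induction hypothesis applies to \<open>v\<close>.\<close>
lemma positivity_aux:
  assumes "w \<in> carrier W" "s \<in> S" "\<not> len S (w \<otimes> s) < len S w"
  shows "nonneg (act w (simple s))"
  using assms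
proof (induction "len S w" arbitrary: w s rule: less_induct)
  case less
  note gS = gen_S
  show ?case
  proof (cases "w = \<one>")
    case True then show ?thesis by simp
  next
    case False
    obtain xs where xs: "set xs \<subseteq> S" "prod xs = w" "length xs = len S w"
      using len_word[of w S] less.prems gS by auto
    with False obtain us t where us: "xs = us @ [t]" by (cases xs rule: rev_cases) auto
    have S: "s \<in> S" "t \<in> S" "set us \<subseteq> S" using xs us less.prems by auto
    have w: "w = prod us \<otimes> t" using xs us by auto
    have "len S (prod us) < len S w" using len_le[of us S] S xs us by simp
    moreover have wt: "w \<otimes> t = prod us" using w S by (simp add: m_assoc)
    ultimately have st: "s \<noteq> t" using less.prems by auto
    define P where "P = (\<lambda>k. \<exists>v\<in>carrier W. w = v \<otimes> prod (alt s t k) \<and> len S w = len S v + k)"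
    have alt_S: "set (alt s t k) \<subseteq> S" "set (alt t s k) \<subseteq> S" for k using set_alt S by fastforce+
    have "len S w \<le> len S (prod us) + 1"
      using len_mult_le[of "prod us" S "[t]"] S gS w by simp
    then have "len S w = len S (prod us) + 1" using \<open>len S (prod us) < len S w\<close> by simp
    then have P1: "P 1" unfolding P_def using S w by (intro bexI[of _ "prod us"]) auto
    have bound: "P k \<Longrightarrow> k \<le> len S w" for k by (auto simp: P_def)
    define k where "k = (GREATEST k. P k)"
    have Pk: "P k" unfolding k_def using P1 bound by (rule GreatestI_nat)
    have k_max: "P j \<Longrightarrow> j \<le> k" for j unfolding k_def by (rule Greatest_le_nat) (use bound in auto)
    from k_max[OF P1] obtain k' where k': "k = Suc k'" by (cases k) auto
    from Pk obtain v where v: "v \<in> carrier W" "w = v \<otimes> prod (alt s t k)" "len S w = len S v + k"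
      by (auto simp: P_def)
    have lt: "len S v < len S w" using v k' by simp
    \<comment> \<open>\<open>x\<close> is the letter that would prolong the alternating word on the
      left, \<open>y\<close> is its first letter. By the choice of \<open>k\<close> and by the
      additivity of lengths, respectively, neither shortens \<open>v\<close> from the right, so the
      induction hypothesis covers both.\<close>
    define x where "x = (if even k then t else s)"
    define y where "y = (if even k then s else t)"
    have xy: "x \<in> S" "y \<in> S" using S by (auto simp: x_def y_def)
    have nx: "\<not> len S (v \<otimes> x) < len S v"
    proof
      assume d: "len S (v \<otimes> x) < len S v"
      have "alt s t (Suc k) = x # alt s t k" by (simp add: x_def)
      then have "w = (v \<otimes> x) \<otimes> prod (alt s t (Suc k))"
        using v xy alt_S[of k] by (simp add: m_assoc)
      moreover have "len S w \<le> len S (v \<otimes> x) + Suc k"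
        using len_mult_le[of "v \<otimes> x" S "alt s t (Suc k)"] calculation alt_S[of "Suc k"] v xy gS by simp
      ultimately have "P (Suc k)" unfolding P_def using d v xy by (intro bexI[of _ "v \<otimes> x"]) auto
      then show False using k_max by fastforce
    qed
    have ny: "\<not> len S (v \<otimes> y) < len S v"
    proof
      assume d: "len S (v \<otimes> y) < len S v"
      have "alt s t k = y # alt s t k'" by (simp add: y_def k')
      then have "w = (v \<otimes> y) \<otimes> prod (alt s t k')"
        using v xy alt_S[of k'] by (simp add: m_assoc)
      then have "len S w \<le> len S (v \<otimes> y) + k'"
        using len_mult_le[of "v \<otimes> y" S "alt s t k'"] alt_S v xy gS by simp
      then show False using d v k' by simp
    qed
    have "nonneg (act v (simple x))" "nonneg (act v (simple y))"
      using less.hyps[OF lt v(1)] xy nx ny by auto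
    then have pos: "nonneg (act v (simple s))" "nonneg (act v (simple t))"
      by (auto simp: x_def y_def split: if_splits)
    define m where "m = ord (s \<otimes> t)"
    have m1: "m \<noteq> 1" unfolding m_def using ord_ge_2 S st by blast
    \<comment> \<open>If the alternating word had at least the finite order \<open>m\<close> as its
      length, the braid relation would let \<open>w\<close> end in \<open>s\<close>, and
      \<open>w \<otimes> s\<close> would be shorter. Below \<open>m\<close> the coefficients
      \<open>cheb m k\<close> and \<open>cheb m (Suc k)\<close> are nonnegative.\<close>
    have km: "m = 0 \<or> k < m"
    proof (rule ccontr)
      assume "\<not> (m = 0 \<or> k < m)"
      then have km: "m \<noteq> 0" "m \<le> k" by auto
      obtain zs where zs: "alt s t k = zs @ alt s t m" "length zs = k - m" "set zs \<subseteq> {s, t}"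
        using alt_append[of s t "k - m" m] km by auto
      have zS: "set zs \<subseteq> S" using zs S by auto
      have "prod (alt s t m) = prod (alt t s m)"
        using alt_relation[of s t m] S by (simp add: m_def)
      also obtain m' where m': "m = Suc m'" using km by (cases m) auto
      have "alt t s m = alt s t m' @ [s]" unfolding m' by (rule alt_snoc)
      finally have "prod (alt s t m) = prod (alt s t m') \<otimes> s" using alt_S[of m'] S by simp
      then have "w \<otimes> s = v \<otimes> prod (zs @ alt s t m')"
        using v zs zS alt_S S by (simp add: m_assoc)
      then have "len S (w \<otimes> s) \<le> len S v + (k - m + m')"
        using len_mult_le[of v S "zs @ alt s t m'"] zs zS v gS alt_S by simp
      then show False using less.prems(3) v km m' by simp
    qed
    let ?p = "cheb m (if even k then Suc k else k)" and ?q = "cheb m (if even k then k else Suc k)"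
    have "act w (simple s) = act v (\<lambda>a. ?p * simple s a + ?q * simple t a)"
      using v alt_S[of k] S wact_alt[OF S(1,2) st, of k] by (simp add: act_mult act_word flip: m_def)
    also have "\<dots> = (\<lambda>a. ?p * act v (simple s) a + ?q * act v (simple t) a)"
      using linear_op_add[OF linear_act, of v "\<lambda>a. ?p * simple s a" ?q "simple t"]
        linear_op_scale[OF linear_act, of v ?p "simple s"] by simp
    finally show ?thesis
      using pos cheb_nonneg[OF m1, of k] cheb_nonneg[OF m1, of "Suc k"] km by (auto simp: nonneg_def)
  qed
qed

lemma act_simple_sign:
  assumes "w \<in> carrier W" "s \<in> S"
  shows "nonneg (act w (simple s)) \<or> nonpos (act w (simple s))"
proof (cases "len S (w \<otimes> s) < len S w")
  case True
  then have "\<not> len S ((w \<otimes> s) \<otimes> s) < len S (w \<otimes> s)" using assms by (simp add: m_assoc)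
  then have "nonneg (act (w \<otimes> s) (simple s))" using assms by (intro positivity_aux) auto
  then have "nonpos (act w (simple s))" using assms by (simp add: act_mult act_S reflect_same act_minus)
  then show ?thesis ..
qed (use positivity_aux assms in auto)

lemma root_sign: assumes "x \<in> roots J" "J \<subseteq> S" shows "nonpos x \<longleftrightarrow> \<not> nonneg x"
proof -
  obtain u r where "u \<in> gen J" "r \<in> J" "x = act u (simple r)" using assms by (auto simp: roots_def)
  then have "nonneg x \<or> nonpos x" using act_simple_sign[of u r] assms by auto
  then show ?thesis using not_both_signs[OF assms] by blast
qed

lemma norm_one_simple:
  assumes "x \<in> roots J" "J \<subseteq> S" "s \<in> S" "nonneg x" "\<And>a. a \<noteq> s \<Longrightarrow> x a = 0"
  shows "x = simple s"
proof -
  define c where "c = x s"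
  have x: "x = (\<lambda>a. 0 + c * simple s a)" using assms(5) by (force simp: simple_def c_def)
  have z: "form (\<lambda>_. 0) y = 0" "form y (\<lambda>_. 0) = 0" for y by (simp_all add: form_def pairing_def)
  have "form x x = c * c"
    unfolding x form_add form_add_right z using assms(3) by (simp add: form_simple pairing_simple)
  then have "c = 1 \<or> c = -1" using root_norm[OF assms(1,2)] square_eq_1_iff by metis
  moreover have "c \<ge> 0" using assms(4) by (simp add: c_def nonneg_def)
  ultimately show ?thesis unfolding x by auto
qed

text \<open>Only the coordinate at \<open>s\<close> changes, so a change of sign forces all other
  coordinates to vanish, and the norm leaves only \<open>simple s\<close>.\<close>

lemma reflect_pos:
  assumes "x \<in> roots J" "J \<subseteq> S" "s \<in> J" "nonneg x" "\<not> nonneg (reflect s x)"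
  shows "x = simple s"
proof (rule norm_one_simple[OF assms(1,2)])
  have n: "nonpos (reflect s x)" using root_sign[OF roots_reflect[OF assms(1,3,2)] assms(2)] assms(5) by simp
  show "x a = 0" if "a \<noteq> s" for a
    using n assms(4) reflect_other[OF that, of x] by (metis nonneg_def nonpos_def order_antisym)
qed (use assms in auto)

section \<open>Faithfulness and the exchange condition\<close>

lemma act_faithful: assumes "w \<in> carrier W" "\<And>x. act w x = x" shows "w = \<one>"
proof (rule ccontr)
  assume "w \<noteq> \<one>"
  obtain xs where xs: "set xs \<subseteq> S" "prod xs = w" "length xs = len S w"
    using len_word[of w S] assms gen_S by auto
  with \<open>w \<noteq> \<one>\<close> obtain us t where us: "xs = us @ [t]" by (cases xs rule: rev_cases) auto
  have S: "t \<in> S" "set us \<subseteq> S" using xs us by auto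
  have w: "w = prod us \<otimes> t" using xs us by auto
  have "len S (prod us) < len S w" using len_le[of us S] S xs us by simp
  then have "nonneg (act (prod us) (simple t))"
    using w S by (intro positivity_aux) auto
  moreover have "act w (simple t) = (\<lambda>a. - act (prod us) (simple t) a)"
    using w S by (simp add: act_mult act_S reflect_same act_minus)
  then have "nonpos (act w (simple t)) \<longleftrightarrow> nonneg (act (prod us) (simple t))" by simp
  ultimately show False by (simp add: assms)
qed

lemma act_inject:
  assumes "u \<in> carrier W" "w \<in> carrier W" "\<And>x. act u x = act w x" shows "u = w"
proof -
  have "inv w \<otimes> u = \<one>"
    using assms by (intro act_faithful) (auto simp: act_mult)
  then have "w \<otimes> (inv w \<otimes> u) = w" using assms by simp
  then show ?thesis using assms by (simp flip: m_assoc)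
qed

lemma inv_cancel [simp]:
  assumes "x \<in> carrier W" "y \<in> carrier W"
  shows "inv x \<otimes> (x \<otimes> y) = y" "x \<otimes> (inv x \<otimes> y) = y"
  using assms by (simp_all flip: m_assoc)

abbreviation conj :: "'a \<Rightarrow> 'a \<Rightarrow> 'a" where "conj u r \<equiv> u \<otimes> r \<otimes> inv u"

lemma act_conj:
  assumes "u \<in> carrier W" "r \<in> S"
  shows "act (conj u r) x = (\<lambda>a. x a - 2 * form x (act u (simple r)) * act u (simple r) a)"
proof -
  let ?y = "act (inv u) x"
  have "pairing ?y r = form ?y (simple r)" using assms by (simp add: form_simple)
  also have "\<dots> = form x (act u (simple r))" using form_act[of u ?y "simple r"] assms by simp
  finally have p: "pairing ?y r = form x (act u (simple r))" .
  have "act (conj u r) x = act u (reflect r ?y)" using assms by (simp add: act_mult act_S)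
  also have "reflect r ?y = (\<lambda>a. ?y a + (- 2 * pairing ?y r) * simple r a)" by (simp add: reflect_def)
  also have "act u \<dots> = (\<lambda>a. act u ?y a + (- 2 * pairing ?y r) * act u (simple r) a)"
    by (rule linear_op_add[OF linear_act])
  finally show ?thesis using assms by (simp add: p)
qed

lemma conj_eq:
  assumes "u \<in> carrier W" "r \<in> S" "u' \<in> carrier W" "r' \<in> S"
    and "act u (simple r) = act u' (simple r') \<or> act u (simple r) = (\<lambda>a. - act u' (simple r') a)"
  shows "conj u r = conj u' r'"
proof (rule act_inject)
  fix x
  let ?b = "act u' (simple r')"
  have "form x (\<lambda>a. - ?b a) = - form x ?b" by (simp add: form_def sum_negf)
  then show "act (conj u r) x = act (conj u' r') x"
    using assms(5) by (auto simp: act_conj assms(1-4))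
qed (use assms in auto)

lemma act_conj_root:
  assumes "u \<in> carrier W" "r \<in> S"
  shows "act (conj u r) (act u (simple r)) = (\<lambda>a. - act u (simple r) a)"
  using assms by (simp add: act_mult act_S reflect_same act_minus)

text \<open>Apply the letters to the root one after another, the first letter first. Where the sign
  changes, the root has become simple by \<open>reflect_pos\<close>.\<close>

lemma exchange:
  assumes "set xs \<subseteq> S" "x \<in> roots S" "nonneg x" "nonpos (act (inv (prod xs)) x)"
  shows "\<exists>ys q zs. xs = ys @ q # zs \<and> act (prod ys) (simple q) = x"
  using assms
proof (induction xs arbitrary: x)
  case Nil then show ?case using not_both_signs[of x S] by simp
next
  case (Cons q xs)
  have q: "q \<in> S" "set xs \<subseteq> S" using Cons.prems by auto
  show ?case
  proof (cases "nonneg (reflect q x)")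
    case True
    have "act (inv (prod (q # xs))) x = act (inv (prod xs)) (reflect q x)"
      using q by (simp add: inv_mult_group act_mult act_S)
    then obtain ys p zs where "xs = ys @ p # zs" "act (prod ys) (simple p) = reflect q x"
      using Cons.IH[of "reflect q x"] q True Cons.prems roots_reflect[of x S q] by auto
    moreover have "act (prod (q # ys)) (simple p) = x" using calculation q by (simp add: act_mult act_S)
    ultimately show ?thesis by (metis append_Cons)
  next
    case False
    then have "x = simple q" using reflect_pos[of x S q] q Cons.prems by auto
    then show ?thesis by (intro exI[of _ "[]"]) auto
  qed
qed

text \<open>Deleting the letter \<open>q\<close> found by \<open>exchange\<close> from a shortest
  word over \<open>J\<close> multiplies \<open>w\<close> by the reflection. The letters in front of
  it lie in \<open>J\<close>, so the reflection and its root belong to \<open>J\<close> although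
  \<open>u\<close> is an arbitrary element.\<close>

lemma len_conj_less:
  assumes J: "J \<subseteq> S" and "w \<in> gen J" "u \<in> carrier W" "r \<in> S"
    and x: "x = act u (simple r) \<or> x = (\<lambda>a. - act u (simple r) a)" "x \<in> roots S"
    and "nonneg x" "nonpos (act (inv w) x)"
  shows "len J (conj u r \<otimes> w) < len J w" "conj u r \<in> gen J" "x \<in> roots J"
proof -
  obtain xs where xs: "set xs \<subseteq> J" "prod xs = w" "length xs = len J w"
    using len_word assms by metis
  then obtain ys q zs where yz: "xs = ys @ q # zs" "act (prod ys) (simple q) = x"
    using exchange[of xs x] assms by (metis order_trans)
  have in_J: "set ys \<subseteq> J" "q \<in> J" "set zs \<subseteq> J" using xs yz by auto
  then have in_S: "set ys \<subseteq> S" "q \<in> S" "set zs \<subseteq> S" using J by auto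
  have "conj (prod ys) q = conj u r" using assms in_S yz by (intro conj_eq) auto
  note t = this[symmetric]
  have "conj u r \<otimes> w = prod ys \<otimes> (q \<otimes> (inv (prod ys) \<otimes> prod ys) \<otimes> (q \<otimes> prod zs))"
    unfolding t using in_S xs(2)[symmetric] by (simp add: yz m_assoc)
  also have "\<dots> = prod (ys @ zs)" using in_S by (simp add: m_assoc)
  finally show "len J (conj u r \<otimes> w) < len J w"
    using len_le[of "ys @ zs" J] in_J xs(3) yz by simp
  have "prod ys \<in> gen J" using in_J J by (intro gen_word_intro)
  then show "conj u r \<in> gen J" unfolding t using in_J J
    by (intro generate.eng gen_inv) (auto intro: generate.incl)
  show "x \<in> roots J" using yz \<open>prod ys \<in> gen J\<close> in_J by (auto simp: roots_def)
qed

lemma roots_S: "u \<in> carrier W \<Longrightarrow> r \<in> S \<Longrightarrow> act u (simple r) \<in> roots S"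
  by (auto simp: roots_def gen_S)

lemma minus_root: assumes "x \<in> roots J" "J \<subseteq> S" shows "(\<lambda>a. - x a) \<in> roots J"
proof -
  obtain u r where u: "u \<in> gen J" "r \<in> J" "x = act u (simple r)" using assms by (auto simp: roots_def)
  have r: "r \<in> S" "u \<in> carrier W" using u assms by auto
  have "act (u \<otimes> r) (simple r) = (\<lambda>a. - x a)"
    using u r by (simp add: act_mult act_S reflect_same act_minus)
  moreover have "u \<otimes> r \<in> gen J" using u by (auto intro: generate.eng generate.incl)
  ultimately show ?thesis using u by (force simp: roots_def)
qed

text \<open>An equivalence of two signs does not depend on which of the two opposite roots
  represents the reflection. Since \<open>J\<close> is arbitrary, no comparison of
  \<open>len J\<close> with \<open>len S\<close> is involved.\<close>

lemma len_conj_iff: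
  assumes J: "J \<subseteq> S" and w: "w \<in> gen J" and u: "u \<in> gen J" "r \<in> J"
  shows "len J (conj u r \<otimes> w) < len J w \<longleftrightarrow>
    (nonneg (act u (simple r)) \<longleftrightarrow> nonpos (act (inv w) (act u (simple r))))"
proof -
  let ?x = "act u (simple r)"
  have [simp]: "u \<in> carrier W" "r \<in> S" "w \<in> carrier W" using assms by auto
  have x: "?x \<in> roots S" by (simp add: roots_S)
  have sgn: "nonpos ?x \<longleftrightarrow> \<not> nonneg ?x" using root_sign x by blast
  have less: "len J (conj u r \<otimes> z) < len J z"
    if z: "z \<in> gen J" and s: "nonneg ?x \<longleftrightarrow> nonpos (act (inv z) ?x)" for z
  proof (cases "nonneg ?x")
    case True then show ?thesis using s x z J by (intro len_conj_less[of J z u r ?x]) auto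
  next
    case False
    have zc: "z \<in> carrier W" using z J by auto
    have "act (inv z) ?x \<in> roots S" using roots_act[OF x] zc gen_S by auto
    then have "nonneg (act (inv z) ?x)" using root_sign[of "act (inv z) ?x" S] False s by blast
    then show ?thesis using False sgn z J minus_root[OF x]
      by (intro len_conj_less[of J z u r "\<lambda>a. - ?x a"]) (auto simp: act_minus)
  qed
  show ?thesis
  proof
    assume lt: "len J (conj u r \<otimes> w) < len J w"
    show "nonneg ?x \<longleftrightarrow> nonpos (act (inv w) ?x)"
    proof (rule ccontr)
      assume ne: "\<not> (nonneg ?x \<longleftrightarrow> nonpos (act (inv w) ?x))"
      \<comment> \<open>Multiplying by the reflection flips the sign of its root under the inverse.
        If the criterion fails for \<open>w\<close>, it holds for \<open>?z\<close>, and the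
        direction already shown makes \<open>w\<close> shorter than \<open>?z\<close>.\<close>
      let ?z = "conj u r \<otimes> w"
      have zz: "conj u r \<otimes> conj u r = \<one>"
        by (simp add: m_assoc)
      have "inv (conj u r) = conj u r" using zz by (intro inv_equality) auto
      then have "act (inv ?z) ?x = act (inv w) (act (conj u r) ?x)"
        by (simp add: inv_mult_group[of "conj u r" w] act_mult del: inv_mult_group)
      also have "\<dots> = (\<lambda>a. - act (inv w) ?x a)" by (simp only: act_conj_root act_minus \<open>u \<in> carrier W\<close> \<open>r \<in> S\<close>)
      finally have e: "act (inv ?z) ?x = (\<lambda>a. - act (inv w) ?x a)" .
      have "act (inv w) ?x \<in> roots S" using roots_act[OF x] gen_S by auto
      then have "nonneg ?x \<longleftrightarrow> nonpos (act (inv ?z) ?x)"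
        using ne e root_sign[of "act (inv w) ?x" S] by auto
      moreover have "conj u r \<in> gen J" using u J
        by (intro generate.eng gen_inv) (auto intro: generate.incl)
      then have "?z \<in> gen J" using w by (rule generate.eng)
      ultimately have "len J (conj u r \<otimes> ?z) < len J ?z" by (intro less)
      moreover have "conj u r \<otimes> ?z = w" using zz m_assoc[of "conj u r" "conj u r" w] by simp
      ultimately show False using lt by simp
    qed
  qed (rule less[OF w])
qed

section \<open>The Euler form of a Coxeter word\<close>

text \<open>The upper triangular half of the doubled symmetric form in the order of the letters:
  diagonal entries 1, an entry \<open>2 * B a b\<close> if \<open>a\<close> stands before
  \<open>b\<close>, and 0 if it stands after. Its symmetrisation is twice the form.\<close>

fun euler :: "'a list \<Rightarrow> ('a \<Rightarrow> real) \<Rightarrow> ('a \<Rightarrow> real) \<Rightarrow> real" where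
  "euler [] x y = 0"
| "euler (s # cs) x y = x s * y s + 2 * x s * (\<Sum>b\<leftarrow>cs. B s b * y b) + euler cs x y"

definition supported :: "'a set \<Rightarrow> ('a \<Rightarrow> real) \<Rightarrow> bool" where
  "supported J x \<longleftrightarrow> (\<forall>a. a \<notin> J \<longrightarrow> x a = 0)"

lemma euler_snoc:
  "euler (cs @ [s]) x y = euler cs x y + x s * y s + 2 * (\<Sum>a\<leftarrow>cs. x a * B a s) * y s"
  by (induction cs) (auto simp: algebra_simps)

lemma euler_cong:
  assumes "\<And>a. a \<in> set cs \<Longrightarrow> x a = x' a" "\<And>a. a \<in> set cs \<Longrightarrow> y a = y' a"
  shows "euler cs x y = euler cs x' y'"
  using assms
proof (induction cs)
  case (Cons s cs)
  moreover have "(\<Sum>b\<leftarrow>cs. B s b * y b) = (\<Sum>b\<leftarrow>cs. B s b * y' b)"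
    by (rule arg_cong[where f = sum_list]) (use Cons.prems in simp)
  ultimately show ?case by simp
qed simp

lemma sum_list_zero: "(\<And>b. b \<in> set bs \<Longrightarrow> f b = 0) \<Longrightarrow> (\<Sum>b\<leftarrow>bs. f b) = (0 :: real)"
  by (induction bs) auto

lemma euler_zero_left: assumes "\<And>a. a \<in> set cs \<Longrightarrow> x a = 0" shows "euler cs x y = 0"
  using assms by (induction cs) auto

lemma euler_zero_right: assumes "\<And>a. a \<in> set cs \<Longrightarrow> y a = 0" shows "euler cs x y = 0"
  using assms
proof (induction cs)
  case (Cons s cs)
  moreover have "(\<Sum>b\<leftarrow>cs. B s b * y b) = 0"
    by (rule sum_list_zero) (use Cons.prems in simp)
  ultimately show ?case by simp
qed simp

lemma euler_minus_left: "euler cs (\<lambda>a. - x a) y = - euler cs x y"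
  by (induction cs) auto

lemma pairing_list:
  assumes "distinct (s # cs)" "set (s # cs) \<subseteq> S" "supported (set (s # cs)) x"
  shows "pairing x s = x s + (\<Sum>a\<leftarrow>cs. x a * B a s)"
proof -
  have "pairing x s = (\<Sum>a\<in>set (s # cs). x a * B a s)"
    unfolding pairing_def using assms finite_S
    by (intro sum.mono_neutral_right) (auto simp: supported_def)
  also have "\<dots> = x s + (\<Sum>a\<in>set cs. x a * B a s)" using assms by simp
  finally show ?thesis using assms by (simp add: sum_list_distinct_conv_sum_set)
qed

text \<open>The numerical side of a reflection functor. Only the coordinate at \<open>s\<close>
  changes, to \<open>- x s - 2 * px\<close> with \<open>px\<close> the contribution of the other
  letters; the support condition reduces \<open>pairing x s\<close> to the letters of the
  word.\<close>

lemma euler_rotate: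
  assumes "distinct (s # cs)" "set (s # cs) \<subseteq> S"
    and "supported (set (s # cs)) x" "supported (set (s # cs)) y"
  shows "euler (s # cs) (reflect s x) (reflect s y) = euler (cs @ [s]) x y"
proof -
  define px where "px = (\<Sum>a\<leftarrow>cs. x a * B a s)"
  define py where "py = (\<Sum>b\<leftarrow>cs. B s b * y b)"
  have "(\<Sum>a\<leftarrow>cs. y a * B a s) = (\<Sum>b\<leftarrow>cs. B s b * y b)"
    by (rule arg_cong[where f = sum_list]) (use assms B_commute[of s] in \<open>auto simp: mult.commute\<close>)
  then have Y: "pairing y s = y s + py" using pairing_list[OF assms(1,2,4)] unfolding py_def by simp
  have X: "pairing x s = x s + px" using pairing_list[OF assms(1,2,3)] unfolding px_def by simp
  have rs: "reflect s z s = z s - 2 * pairing z s" for z by (simp add: reflect_def simple_def)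
  have ro: "reflect s z b = z b" if "b \<in> set cs" for z b
    using that assms(1) reflect_other[of b s z] by auto
  then have Y': "(\<Sum>b\<leftarrow>cs. B s b * reflect s y b) = py"
    unfolding py_def by (intro arg_cong[where f = sum_list] map_cong) auto
  have "euler cs (reflect s x) (reflect s y) = euler cs x y"
    using ro by (intro euler_cong) auto
  then show ?thesis
    unfolding euler_snoc by (simp add: Y' rs X Y flip: px_def) (simp add: algebra_simps)
qed

lemma supported_mono: "supported K x \<Longrightarrow> K \<subseteq> J \<Longrightarrow> supported J x"
  by (auto simp: supported_def)

lemma supported_simple: "s \<in> J \<Longrightarrow> supported J (simple s)"
  by (auto simp: supported_def simple_def)

lemma supported_reflect: "s \<in> J \<Longrightarrow> supported J x \<Longrightarrow> supported J (reflect s x)"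
  by (auto simp: supported_def simple_def reflect_def)

lemma supported_root: "x \<in> roots J \<Longrightarrow> J \<subseteq> S \<Longrightarrow> supported J x"
  by (auto simp: supported_def root_support)

lemma supported_wact: "set xs \<subseteq> J \<Longrightarrow> supported J x \<Longrightarrow> supported J (wact xs x)"
  unfolding supported_def using wact_other by (metis subsetD)

text \<open>In the representation theory of quivers, \<open>wact (rev cs) (simple s)\<close> is the dimension vector
  of an injective module.\<close>
lemma euler_injective:
  assumes "distinct (s # cs)" "set (s # cs) \<subseteq> S" "supported (set (s # cs)) x"
  shows "euler (s # cs) (wact (rev cs) (simple s)) x = x s"
  using assms
proof (induction cs arbitrary: x rule: rev_induct)
  case Nil then show ?case by (simp add: simple_def)
next
  case (snoc t ds)
  let ?z = "wact (rev ds) (simple s)"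
  have d: "distinct (t # s # ds)" "set (t # s # ds) \<subseteq> S" using snoc.prems by auto
  have x: "supported (set (t # s # ds)) x" using snoc.prems(3) by (rule supported_mono) auto
  have z: "supported (set (s # ds)) ?z" by (intro supported_wact supported_simple) auto
  have "supported (set (t # s # ds)) (reflect t ?z)"
    by (intro supported_reflect supported_mono[OF z]) auto
  \<comment> \<open>The last letter \<open>t\<close> is rotated to the front and drops out there
    because \<open>?z\<close> has no coordinate at \<open>t\<close>. As \<open>reflect t x\<close>
    may still have one, it is cut off before the induction hypothesis applies.\<close>
  from euler_rotate[OF d this x]
  have "euler (s # ds @ [t]) (reflect t ?z) x = euler (t # s # ds) ?z (reflect t x)"
    using d by simp
  also have "\<dots> = euler (s # ds) ?z (reflect t x)"
    using z d by (simp add: supported_def)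
  also have "\<dots> = euler (s # ds) ?z (\<lambda>a. if a \<in> set (s # ds) then reflect t x a else 0)"
    by (intro euler_cong) auto
  also have "\<dots> = reflect t x s"
    using snoc.IH[of "\<lambda>a. if a \<in> set (s # ds) then reflect t x a else 0"] d
    by (simp add: supported_def)
  also have "\<dots> = x s" using d reflect_other[of s t x] by auto
  finally show ?case by simp
qed

section \<open>Skip vectors\<close>

text \<open>\<open>skips cs v C\<close>: \<open>v\<close> is sortable with respect to \<open>cs\<close>, and \<open>C\<close> is the set of the roots
  \<open>a\<^sub>1 \<cdots> a\<^sub>i \<alpha>\<^sub>r\<close> belonging to the first skips of the letters \<open>r\<close>. A skipped letter is never used
  again, so it is dropped from the word.\<close>
inductive skips :: "'a list \<Rightarrow> 'a \<Rightarrow> ('a \<Rightarrow> real) set \<Rightarrow> bool" where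
  Nil: "skips [] \<one> {}"
| used: "\<lbrakk>v \<in> carrier W; nonpos (act (inv v) (simple s)); skips (cs @ [s]) (s \<otimes> v) C\<rbrakk>
    \<Longrightarrow> skips (s # cs) v (reflect s ` C)"
| skipped: "skips cs v C \<Longrightarrow> skips (s # cs) v (insert (simple s) C)"

text \<open>The elements of \<open>C\<close> are inward normals of a Cambrian cone; the condition
  places the chamber of \<open>w\<close> in this cone.\<close>

definition region :: "('a \<Rightarrow> real) set \<Rightarrow> 'a \<Rightarrow> bool" where
  "region C w \<longleftrightarrow> (\<forall>d\<in>C. nonneg (act (inv w) d))"

lemma skips_gen: "skips cs v C \<Longrightarrow> set cs \<subseteq> S \<Longrightarrow> v \<in> gen (set cs)"
proof (induction rule: skips.induct)
  case Nil show ?case by (rule generate.one)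
next
  case (used v s cs C)
  then have "s \<otimes> v \<in> gen (set (s # cs))" by simp
  then show ?case using gen_mult_left[of s "set (s # cs)" v] used by simp
next
  case (skipped cs v C s)
  then show ?case using gen_mono[of "set cs" "set (s # cs)"] by auto
qed

lemma skips_carrier: "skips cs v C \<Longrightarrow> set cs \<subseteq> S \<Longrightarrow> v \<in> carrier W"
  using skips_gen gen_closed by blast

lemma skips_roots: "skips cs v C \<Longrightarrow> set cs \<subseteq> S \<Longrightarrow> C \<subseteq> roots (set cs)"
proof (induction rule: skips.induct)
  case (used v s cs C)
  then have "C \<subseteq> roots (set (s # cs))" by simp
  then show ?case using used.prems roots_reflect[of _ "set (s # cs)" s] by auto
next
  case (skipped cs v C s)
  then show ?case using roots_mono[of "set cs" "set (s # cs)"] simple_root[of s "set (s # cs)"] by auto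
qed simp

text \<open>The coordinate at \<open>s\<close> stays 1 under the subgroup of \<open>K\<close>, and
  one positive coordinate decides the sign of a root.\<close>

lemma act_skipped:
  assumes "K \<subseteq> S" "s \<in> S" "s \<notin> K" "w \<in> gen K"
  shows "nonneg (act w (simple s))" "\<not> nonpos (act w (simple s))"
proof -
  have "act w (simple s) s = 1" using assms by (simp add: act_other simple_def)
  then show n: "\<not> nonpos (act w (simple s))" by (auto simp: nonpos_def intro!: exI[of _ s])
  then show "nonneg (act w (simple s))" using act_simple_sign[of w s] assms by auto
qed

lemma act_used:
  assumes "s \<in> S" "v \<in> carrier W" shows "act (inv (s \<otimes> v)) x = act (inv v) (reflect s x)"
  using assms by (simp add: inv_mult_group act_mult act_S)

text \<open>The vectors dual to the skip vectors with respect to the Euler form are the roots of the last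
  uses of the letters in the sorting word of \<open>v\<close> and, for letters that do not occur in \<open>v\<close>, the
  negatives of the injectives. Only the properties below are needed.\<close>
definition summand :: "'a list \<Rightarrow> 'a \<Rightarrow> ('a \<Rightarrow> real) \<Rightarrow> bool" where
  "summand cs v g \<longleftrightarrow> supported (set cs) g \<and>
     ((g \<in> roots (set cs) \<and> nonneg g \<and> nonpos (act (inv v) g)) \<or>
      (\<exists>us r vs. cs = us @ r # vs \<and> g = (\<lambda>a. - wact (rev vs) (simple r) a) \<and> v \<in> gen (set cs - {r})))"

text \<open>The pairs \<open>(g, d)\<close> are followed through the recursion. A used letter
  reflects both members, compatibly with \<open>euler_rotate\<close>; a skipped letter adds the pair
  of its negative injective and \<open>simple s\<close>, whose coefficient is \<open>- x s\<close>
  by \<open>euler_injective\<close>. A list of pairs avoids any statement on linear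
  independence.\<close>

lemma expansion:
  assumes "skips cs v C" "distinct cs" "set cs \<subseteq> S"
  shows "\<exists>gs. (\<forall>(g, d)\<in>set gs. d \<in> C \<and> summand cs v g) \<and>
    (\<forall>x. supported (set cs) x \<longrightarrow> (\<lambda>a. - x a) = (\<lambda>a. \<Sum>(g, d)\<leftarrow>gs. euler cs g x * d a))"
  using assms
proof (induction rule: skips.induct)
  case Nil
  show ?case by (intro exI[of _ "[]"]) (auto simp: supported_def)
next
  case (used v s cs C)
  have d: "distinct (s # cs)" "set (s # cs) \<subseteq> S" and s: "s \<in> S" using used.prems by auto
  have eq: "set (cs @ [s]) = set (s # cs)" by simp
  from used obtain gs where gs: "\<forall>(g, d)\<in>set gs. d \<in> C \<and> summand (cs @ [s]) (s \<otimes> v) g"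
    "\<And>x. supported (set (s # cs)) x \<Longrightarrow> (\<lambda>a. - x a) = (\<lambda>a. \<Sum>(g, d)\<leftarrow>gs. euler (cs @ [s]) g x * d a)"
    unfolding eq by auto
  have sm: "summand (s # cs) v (reflect s g)" if g: "summand (cs @ [s]) (s \<otimes> v) g" for g
  proof -
    have supp: "supported (set (s # cs)) (reflect s g)"
      using g unfolding summand_def eq by (intro supported_reflect) auto
    have sv: "s \<otimes> (s \<otimes> v) = v" using s used.hyps by simp
    consider (pos) "g \<in> roots (set (s # cs))" "nonneg g" "nonpos (act (inv (s \<otimes> v)) g)"
      | (neg) us r vs where "cs @ [s] = us @ r # vs" "g = (\<lambda>a. - wact (rev vs) (simple r) a)"
          "s \<otimes> v \<in> gen (set (s # cs) - {r})"
      using g unfolding summand_def eq by blast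
    then show ?thesis
    proof cases
      case pos
      \<comment> \<open>This is the only positive root that the reflection in \<open>s\<close> makes
        negative; it is excluded because \<open>s\<close> is an inversion of \<open>v\<close>, hence
        not of \<open>s \<otimes> v\<close>.\<close>
      have "g \<noteq> simple s"
      proof
        assume "g = simple s"
        then have "nonneg (act (inv v) (simple s))"
          using pos s used.hyps by (simp add: act_used reflect_same act_minus)
        moreover have "act (inv v) (simple s) \<in> roots S" using s used.hyps by (simp add: roots_S)
        ultimately show False using not_both_signs[of _ S] used.hyps by blast
      qed
      then have "nonneg (reflect s g)" using reflect_pos[OF pos(1) d(2) _ pos(2)] by auto
      moreover have "nonpos (act (inv v) (reflect s g))"
        using pos s used.hyps by (simp add: act_used)
      ultimately show ?thesis unfolding summand_def using supp pos roots_reflect[OF pos(1) _ d(2)] by auto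
    next
      case neg
      show ?thesis
      proof (cases vs rule: rev_cases)
        \<comment> \<open>Here \<open>r\<close> is \<open>s\<close> itself, which does not occur in
          \<open>s \<otimes> v\<close>. Its negative injective is \<open>- simple s\<close>, and the
          reflection turns it into the positive root of the only use of \<open>s\<close> in
          \<open>v\<close>.\<close>
        case Nil
        then have "g = (\<lambda>a. - simple s a)" using neg by simp
        then have "reflect s g = simple s"
          using linear_op_minus[OF linear_reflect, of s "simple s"] s by (simp add: reflect_same)
        then show ?thesis unfolding summand_def
          using used.hyps simple_root[of s "set (s # cs)"] d supp by auto
      next
        case (snoc vs' t)
        then have t: "t = s" "cs = us @ r # vs'" using neg(1) by auto
        have "s \<noteq> r" using d t by auto
        then have "v \<in> gen (set (s # cs) - {r})"
          using neg(3) used.hyps d gen_mult_left[of s "set (s # cs) - {r}" v] by auto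
        moreover have "reflect s g = (\<lambda>a. - wact (rev vs') (simple r) a)"
          using neg(2) snoc t linear_op_minus[OF linear_reflect, of s "reflect s (wact (rev vs') (simple r))"] s
          by simp
        moreover have "s # cs = (s # us) @ r # vs'" using t by simp
        ultimately show ?thesis unfolding summand_def using supp by blast
      qed
    qed
  qed
  let ?gs = "map (\<lambda>(g, d). (reflect s g, reflect s d)) gs"
  show ?case
  proof (intro exI[of _ ?gs] conjI allI impI)
    show "\<forall>(g, d)\<in>set ?gs. d \<in> reflect s ` C \<and> summand (s # cs) v g"
      using gs(1) sm by fastforce
    fix x assume x: "supported (set (s # cs)) x"
    have "(\<lambda>a. - reflect s x a) = (\<lambda>a. \<Sum>(g, d)\<leftarrow>gs. euler (cs @ [s]) g (reflect s x) * d a)"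
      using x by (intro gs(2) supported_reflect) auto
    then have "reflect s (\<lambda>a. - reflect s x a) = reflect s (\<lambda>a. \<Sum>(g, d)\<leftarrow>gs. euler (cs @ [s]) g (reflect s x) * d a)"
      by simp
    then have "(\<lambda>a. - x a) = (\<lambda>a. \<Sum>(g, d)\<leftarrow>gs. euler (cs @ [s]) g (reflect s x) * reflect s d a)"
      unfolding linear_op_sum_list[OF linear_reflect] linear_op_minus[OF linear_reflect] using s by simp
    moreover have "euler (cs @ [s]) g (reflect s x) = euler (s # cs) (reflect s g) x" if "(g, d) \<in> set gs" for g d
    proof -
      have "supported (set (s # cs)) g" using gs(1) that unfolding summand_def eq by auto
      moreover have "supported (set (s # cs)) (reflect s x)" using x by (intro supported_reflect) auto
      ultimately show ?thesis using euler_rotate[OF d, of g "reflect s x"] s by simp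
    qed
    then have "(\<lambda>a. \<Sum>(g, d)\<leftarrow>gs. euler (cs @ [s]) g (reflect s x) * reflect s d a)
        = (\<lambda>a. \<Sum>(g, d)\<leftarrow>gs. euler (s # cs) (reflect s g) x * reflect s d a)"
      by (intro ext arg_cong[where f = sum_list] map_cong) auto
    ultimately show "(\<lambda>a. - x a) = (\<lambda>a. \<Sum>(g, d)\<leftarrow>?gs. euler (s # cs) g x * d a)"
      by (simp add: case_prod_unfold comp_def del: euler.simps)
  qed
next
  case (skipped cs v C s)
  have d: "distinct (s # cs)" "set (s # cs) \<subseteq> S" and s: "s \<in> S" "s \<notin> set cs" using skipped.prems by auto
  have v: "v \<in> gen (set cs)" using skipped.hyps d skips_gen by auto
  from skipped obtain gs where gs: "\<forall>(g, d)\<in>set gs. d \<in> C \<and> summand cs v g"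
    "\<And>x. supported (set cs) x \<Longrightarrow> (\<lambda>a. - x a) = (\<lambda>a. \<Sum>(g, d)\<leftarrow>gs. euler cs g x * d a)"
    by auto
  let ?I = "wact (rev cs) (simple s)"
  have "summand (s # cs) v g" if sg: "summand cs v g" for g
  proof -
    have supp: "supported (set (s # cs)) g"
      using sg supported_mono[of "set cs" g "set (s # cs)"] by (auto simp: summand_def)
    consider "g \<in> roots (set cs)" "nonneg g" "nonpos (act (inv v) g)"
      | us r vs where "cs = us @ r # vs" "g = (\<lambda>a. - wact (rev vs) (simple r) a)" "v \<in> gen (set cs - {r})"
      using sg unfolding summand_def by blast
    then show ?thesis
    proof cases
      case 1 then show ?thesis using supp roots_mono[of "set cs" "set (s # cs)"] d unfolding summand_def by auto
    next
      case 2
      have "v \<in> gen (set (s # cs) - {r})"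
        using 2(3) gen_mono[of "set cs - {r}" "set (s # cs) - {r}"] d by auto
      moreover have "s # cs = (s # us) @ r # vs" using 2 by simp
      ultimately show ?thesis using supp 2(2) unfolding summand_def by blast
    qed
  qed
  moreover have "summand (s # cs) v (\<lambda>a. - ?I a)"
  proof -
    have "supported (set (s # cs)) ?I" by (intro supported_wact supported_simple) auto
    then have "supported (set (s # cs)) (\<lambda>a. - ?I a)" by (simp add: supported_def)
    moreover have "s # cs = [] @ s # cs" "set (s # cs) - {s} = set cs" using s by auto
    ultimately show ?thesis using v unfolding summand_def by metis
  qed
  ultimately have 1: "\<forall>(g, d)\<in>set ((\<lambda>a. - ?I a, simple s) # gs). d \<in> insert (simple s) C \<and> summand (s # cs) v g"
    using gs(1) by auto
  have 2: "(\<lambda>a. - x a) = (\<lambda>a. \<Sum>(g, d)\<leftarrow>(\<lambda>a. - ?I a, simple s) # gs. euler (s # cs) g x * d a)"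
    if x: "supported (set (s # cs)) x" for x
  proof -
    define x' where "x' = (\<lambda>a. if a = s then 0 else x a)"
    have "supported (set cs) x'" using x by (auto simp: x'_def supported_def)
    then have "(\<lambda>a. - x' a) = (\<lambda>a. \<Sum>(g, d)\<leftarrow>gs. euler cs g x' * d a)" by (rule gs(2))
    moreover have "euler cs g x' = euler (s # cs) g x" if "(g, d) \<in> set gs" for g d
    proof -
      have "g s = 0" using gs(1) that s by (auto simp: summand_def supported_def)
      moreover have "euler cs g x' = euler cs g x" using s by (intro euler_cong) (auto simp: x'_def)
      ultimately show ?thesis by simp
    qed
    then have "(\<lambda>a. \<Sum>(g, d)\<leftarrow>gs. euler cs g x' * d a) = (\<lambda>a. \<Sum>(g, d)\<leftarrow>gs. euler (s # cs) g x * d a)"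
      by (intro ext arg_cong[where f = sum_list] map_cong) auto
    moreover have "euler (s # cs) (\<lambda>a. - ?I a) x = - x s"
      unfolding euler_minus_left using euler_injective[OF d x] by simp
    ultimately have "(\<lambda>a. \<Sum>(g, d)\<leftarrow>(\<lambda>a. - ?I a, simple s) # gs. euler (s # cs) g x * d a)
        = (\<lambda>a. - x s * simple s a + - x' a)"
      by (simp add: fun_eq_iff del: euler.simps)
    then show ?thesis by (auto simp: x'_def simple_def)
  qed
  from 1 2 show ?case by blast
qed

section \<open>Cones of skip vectors and the weak order\<close>

definition cone :: "('a \<Rightarrow> real) set \<Rightarrow> ('a \<Rightarrow> real) \<Rightarrow> bool" where
  "cone C y \<longleftrightarrow> (\<exists>gs. (\<forall>(n, d)\<in>set gs. 0 \<le> n \<and> d \<in> C) \<and> y = (\<lambda>a. \<Sum>(n, d)\<leftarrow>gs. n * d a))"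

lemma initial_cone:
  assumes "skips (s # cs) v C" "distinct (s # cs)" "set (s # cs) \<subseteq> S" "nonpos (act (inv v) (simple s))"
  shows "cone C (\<lambda>a. - simple s a)"
proof -
  obtain gs where gs: "\<forall>(g, d)\<in>set gs. d \<in> C \<and> summand (s # cs) v g"
    "\<And>x. supported (set (s # cs)) x \<Longrightarrow> (\<lambda>a. - x a) = (\<lambda>a. \<Sum>(g, d)\<leftarrow>gs. euler (s # cs) g x * d a)"
    using expansion[OF assms(1-3)] by blast
  have ns: "v \<notin> gen (set cs)" using act_skipped[of "set cs" s "inv v"] gen_inv[of "set cs" v] assms by auto
  \<comment> \<open>In the triangular matrix of the Euler form the column of the first letter has
    only its diagonal entry.\<close>
  have coeff: "euler (s # cs) g (simple s) = g s" for g
  proof -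
    have "(\<Sum>b\<leftarrow>cs. B s b * simple s b) = 0"
    using assms by (intro sum_list_zero) (auto simp: simple_def)
    moreover have "euler cs g (simple s) = 0" using assms by (intro euler_zero_right) (auto simp: simple_def)
    ultimately show ?thesis by (simp add: simple_def)
  qed
  have "0 \<le> g s" if "summand (s # cs) v g" for g
    using that unfolding summand_def
  proof (elim conjE disjE exE)
    fix us r vs
    assume g: "s # cs = us @ r # vs" "g = (\<lambda>a. - wact (rev vs) (simple r) a)" "v \<in> gen (set (s # cs) - {r})"
    \<comment> \<open>A negative injective contributes 0: its letter \<open>r\<close> is not
      \<open>s\<close>, since \<open>v\<close> lies outside the subgroup of the other letters. So
      \<open>s\<close> stands before \<open>r\<close>, and no reflection in a letter after
      \<open>r\<close> reaches the coordinate at \<open>s\<close>.\<close>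
    have "us \<noteq> []"
    proof
      assume "us = []"
      then have "set (s # cs) - {r} = set cs" using g(1) assms by auto
      then show False using g ns by simp
    qed
    then obtain us' where "cs = us' @ r # vs" using g(1) by (cases us) auto
    then have "s \<notin> set vs" "r \<noteq> s" using assms(2) by auto
    then show "0 \<le> g s" unfolding g(2) by (simp add: wact_other simple_def)
  qed (auto simp: nonneg_def)
  then have "\<forall>(n, d)\<in>set (map (\<lambda>(g, d). (g s, d)) gs). 0 \<le> n \<and> d \<in> C" using gs(1) by fastforce
  moreover have "(\<lambda>a. - simple s a) = (\<lambda>a. \<Sum>(g, d)\<leftarrow>gs. g s * d a)"
    using gs(2)[of "simple s"] unfolding coeff by (simp add: supported_simple)
  then have "(\<lambda>a. - simple s a) = (\<lambda>a. \<Sum>(n, d)\<leftarrow>map (\<lambda>(g, d). (g s, d)) gs. n * d a)"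
    by (simp add: case_prod_unfold comp_def)
  ultimately show ?thesis unfolding cone_def by blast
qed

lemma cone_region:
  assumes "cone C y" "region C w" shows "nonneg (act (inv w) y)"
proof -
  obtain gs where gs: "\<forall>(n, d)\<in>set gs. 0 \<le> n \<and> d \<in> C" "y = (\<lambda>a. \<Sum>(n, d)\<leftarrow>gs. n * d a)"
    using assms by (auto simp: cone_def)
  have "act (inv w) y = (\<lambda>a. \<Sum>(n, d)\<leftarrow>gs. n * act (inv w) d a)"
    unfolding gs(2) using linear_op_sum_list[OF linear_act, of "inv w" "\<lambda>n. n"] by simp
  moreover have "0 \<le> (\<Sum>(n, d)\<leftarrow>gs. n * act (inv w) d a)" for a
    using gs(1) assms(2) by (intro sum_list_nonneg) (auto simp: region_def nonneg_def)
  ultimately show ?thesis by (simp add: nonneg_def)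
qed

lemma region_used:
  assumes "s \<in> S" "w \<in> carrier W" shows "region (reflect s ` C) w \<longleftrightarrow> region C (s \<otimes> w)"
  using assms by (simp add: region_def act_used)

text \<open>Reflecting in \<open>s\<close> transports the claim to \<open>s \<otimes> v\<close> and
  \<open>s \<otimes> w\<close> for every positive root except \<open>simple s\<close>, and for that
  root \<open>initial_cone\<close> yields \<open>w \<ge> s\<close> directly. In terms of inversions
  the result is \<open>v \<le> w\<close> in the weak order.\<close>

lemma region_below:
  assumes "skips cs v C" "distinct cs" "set cs \<subseteq> S" "w \<in> carrier W" "region C w"
    and "x \<in> roots S" "nonneg x" "nonpos (act (inv v) x)"
  shows "nonpos (act (inv w) x)"
  using assms
proof (induction arbitrary: w x rule: skips.induct)
  case Nil then show ?case using not_both_signs[of x S] by simp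
next
  case (used v s cs C)
  have s: "s \<in> S" using used.prems by simp
  show ?case
  proof (cases "nonneg (reflect s x)")
    case True
    have "nonpos (act (inv (s \<otimes> w)) (reflect s x))"
    proof (rule used.IH)
      show "region C (s \<otimes> w)" using used.prems s by (simp add: region_used)
      show "reflect s x \<in> roots S" using used.prems s by (intro roots_reflect) auto
      show "nonpos (act (inv (s \<otimes> v)) (reflect s x))" using used.prems used.hyps s by (simp add: act_used)
    qed (use used.prems s True in auto)
    then show ?thesis using s used.prems by (simp add: act_used)
  next
    case False
    then have x: "x = simple s" using reflect_pos[of x S s] used.prems s by auto
    have "cone (reflect s ` C) (\<lambda>a. - simple s a)"
      using used.hyps used.prems by (intro initial_cone[OF skips.used]) auto
    then have "nonneg (act (inv w) (\<lambda>a. - simple s a))" using used.prems by (intro cone_region) auto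
    then show ?thesis by (simp add: x act_minus)
  qed
next
  case (skipped cs v C s)
  show ?case
    by (rule skipped.IH) (use skipped.prems in \<open>auto simp: region_def\<close>)
qed

lemma region_self: "skips cs v C \<Longrightarrow> distinct cs \<Longrightarrow> set cs \<subseteq> S \<Longrightarrow> region C v"
proof (induction rule: skips.induct)
  case (used v s cs C) then show ?case by (simp add: region_used)
next
  case (skipped cs v C s)
  then show ?case using act_skipped[of "set cs" s "inv v"] gen_inv[of "set cs" v] skips_gen[of cs v C]
    by (auto simp: region_def)
qed (simp add: region_def)

lemma skips_Cons:
  assumes "skips (s # cs) v C"
  obtains (used) C0 where "v \<in> carrier W" "nonpos (act (inv v) (simple s))"
      "skips (cs @ [s]) (s \<otimes> v) C0" "C = reflect s ` C0"
    | (skipped) C0 where "skips cs v C0" "C = insert (simple s) C0"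
  using assms by (cases rule: skips.cases) (use that in blast)+

text \<open>One induction serves two purposes: with \<open>v = v'\<close> the skip vectors are
  determined by \<open>v\<close>, and with a common \<open>w\<close> the regions of different
  elements are disjoint. For the latter, if one side uses the first letter, then \<open>s\<close> is
  an inversion of \<open>w\<close> by \<open>region_below\<close>; if the other side skips it,
  \<open>simple s\<close> is a skip vector and forbids this.\<close>

lemma skips_unique:
  assumes "skips cs v C" "skips cs v' C'" "distinct cs" "set cs \<subseteq> S"
    and "v = v' \<or> (\<exists>w\<in>carrier W. region C w \<and> region C' w)"
  shows "v = v' \<and> C = C'"
  using assms
proof (induction arbitrary: v' C' rule: skips.induct)
  case Nil
  from Nil(1) show ?case by cases auto
next
  case used': (used v s cs C)
  have s: "s \<in> S" "set cs \<subseteq> S" "s \<notin> set cs" using used'.prems by auto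
  have sk: "skips (s # cs) v (reflect s ` C)" using used'.hyps by (intro skips.used)
  from used'.prems(1) show ?case
  proof (cases rule: skips_Cons)
    case (used C0)
    have "s \<otimes> v = s \<otimes> v' \<and> C = C0"
    proof (rule used'.IH)
      show "s \<otimes> v = s \<otimes> v' \<or> (\<exists>w\<in>carrier W. region C w \<and> region C0 w)"
        using used'.prems(4) s used by (metis S_in m_closed region_used)
    qed (use used used'.prems in auto)
    then show ?thesis using used s used'.hyps by (metis S_cancel)
  next
    case (skipped C0)
    have v': "v' \<in> gen (set cs)" using skipped s skips_gen by blast
    from used'.prems(4) show ?thesis
    proof
      assume "v = v'"
      then show ?thesis using act_skipped[OF s(2,1,3) gen_inv[OF s(2) v']] used'.hyps by auto
    next
      assume "\<exists>w\<in>carrier W. region (reflect s ` C) w \<and> region C' w"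
      then obtain w where w: "w \<in> carrier W" "region (reflect s ` C) w" "region C' w" by blast
      have "nonpos (act (inv w) (simple s))"
        using region_below[OF sk used'.prems(2,3) w(1,2)] used'.hyps s by (simp add: simple_root)
      moreover have "nonneg (act (inv w) (simple s))" using w skipped by (auto simp: region_def)
      ultimately show ?thesis using not_both_signs[OF roots_S[of "inv w" s]] w s by auto
    qed
  qed
next
  case skipped': (skipped cs v C s)
  have s: "s \<in> S" "set cs \<subseteq> S" "s \<notin> set cs" using skipped'.prems by auto
  have v: "v \<in> gen (set cs)" using skipped'.hyps s skips_gen by blast
  from skipped'.prems(1) show ?case
  proof (cases rule: skips_Cons)
    case (used C0)
    from skipped'.prems(4) show ?thesis
    proof
      assume "v = v'"
      then show ?thesis using act_skipped[OF s(2,1,3) gen_inv[OF s(2) v]] used by auto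
    next
      assume "\<exists>w\<in>carrier W. region (insert (simple s) C) w \<and> region C' w"
      then obtain w where w: "w \<in> carrier W" "region (insert (simple s) C) w" "region C' w" by blast
      have "nonpos (act (inv w) (simple s))"
        using region_below[OF skipped'.prems(1,2,3) w(1,3)] used s by (simp add: simple_root)
      moreover have "nonneg (act (inv w) (simple s))" using w by (auto simp: region_def)
      ultimately show ?thesis using not_both_signs[OF roots_S[of "inv w" s]] w s by auto
    qed
  next
    case (skipped C0)
    have "v = v' \<and> C = C0"
    proof (rule skipped'.IH)
      show "v = v' \<or> (\<exists>w\<in>carrier W. region C w \<and> region C0 w)"
        using skipped'.prems(4) skipped by (auto simp: region_def)
    qed (use skipped skipped'.prems in auto)
    then show ?thesis using skipped by simp
  qed
qed

section \<open>Negative skip vectors and cover reflections\<close>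

lemma euler_simple:
  assumes "distinct (s # cs)"
  shows "euler (s # cs) (simple s) y = y s + 2 * (\<Sum>b\<leftarrow>cs. B s b * y b)"
    "euler (s # cs) y (simple s) = y s"
proof -
  have "simple s a = 0" if "a \<in> set cs" for a using assms that by (auto simp: simple_def)
  then have "euler cs (simple s) y = 0" "euler cs y (simple s) = 0"
    by (simp_all add: euler_zero_left euler_zero_right)
  moreover have "(\<Sum>b\<leftarrow>cs. B s b * simple s b) = 0"
    using assms by (intro sum_list_zero) (auto simp: simple_def)
  ultimately show "euler (s # cs) (simple s) y = y s + 2 * (\<Sum>b\<leftarrow>cs. B s b * y b)"
    "euler (s # cs) y (simple s) = y s" by (simp_all add: simple_def)
qed

lemma len_reduced_prefix:
  assumes "J \<subseteq> S" "set (xs @ ys) \<subseteq> J" "length (xs @ ys) = len J (prod (xs @ ys))"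
  shows "length xs = len J (prod xs)"
proof (rule antisym)
  have "prod xs \<in> gen J" using assms by (intro gen_word_intro) auto
  then have "len J (prod xs \<otimes> prod ys) \<le> len J (prod xs) + length ys" using assms by (intro len_mult_le) auto
  moreover have "set xs \<subseteq> S" "set ys \<subseteq> S" using assms by auto
  ultimately show "length xs \<le> len J (prod xs)" using assms(3) by simp
qed (use assms len_le[of xs J] in auto)

lemma len_snoc:
  assumes "J \<subseteq> S" "set xs \<subseteq> J" "s \<in> J" "length xs = len J (prod xs)"
  shows "length (xs @ [s]) = len J (prod (xs @ [s])) \<longleftrightarrow> nonneg (wact xs (simple s))"
proof -
  have xs: "set xs \<subseteq> S" "s \<in> S" using assms by auto
  have g: "prod xs \<in> gen J" "prod (xs @ [s]) \<in> gen J" using assms gen_word_intro[of J] by simp_all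
  have e: "len J (conj (prod xs) s \<otimes> prod (xs @ [s])) = len J (prod xs)" using xs by (simp add: m_assoc)
  have "len J (prod xs) < len J (prod (xs @ [s])) \<longleftrightarrow>
      (nonneg (act (prod xs) (simple s)) \<longleftrightarrow> nonpos (act (inv (prod (xs @ [s]))) (act (prod xs) (simple s))))"
    unfolding e[symmetric] using assms g by (intro len_conj_iff) auto
  also have "act (inv (prod (xs @ [s]))) (act (prod xs) (simple s)) = (\<lambda>a. - simple s a)"
    using xs by (simp add: inv_mult_group act_mult act_S reflect_same)
  finally have "len J (prod xs) < len J (prod (xs @ [s])) \<longleftrightarrow> nonneg (wact xs (simple s))"
    using xs by (simp add: act_word)
  moreover have "len J (prod (xs @ [s])) \<le> len J (prod xs) + 1"
    using len_mult_le[of "prod xs" J "[s]"] g assms xs by simp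
  ultimately show ?thesis using assms(4) by auto
qed

text \<open>Take the first letter \<open>p\<close> of a shortest word of \<open>v\<close> that is
  not orthogonal to \<open>s\<close>. Its root is an inversion, with coordinate 1 at
  \<open>p\<close> because \<open>p\<close> does not occur earlier in the word.\<close>

lemma inversion_nonorthogonal:
  assumes "K \<subseteq> S" "s \<in> S" "s \<notin> K" "v \<in> gen K" "act (inv v) (simple s) \<noteq> simple s"
  obtains x p where "x \<in> roots K" "nonneg x" "nonpos (act (inv v) x)" "p \<in> K" "B s p \<noteq> 0" "x p > 0"
proof -
  obtain ys where ys: "set ys \<subseteq> K" "prod ys = v" "length ys = len K v" using len_word assms by metis
  have yS: "set ys \<subseteq> S" using ys assms by auto
  have "\<exists>y\<in>set ys. B s y \<noteq> 0"
  proof (rule ccontr)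
    assume "\<not> ?thesis"
    then have "wact (rev ys) (simple s) = simple s"
    proof -
      assume a: "\<not> (\<exists>y\<in>set ys. B s y \<noteq> 0)"
      have "wact zs (simple s) = simple s" if "set zs \<subseteq> set ys" for zs
        using that a yS assms by (induction zs) (auto simp: reflect_simple)
      then show ?thesis by simp
    qed
    then show False using assms(5) ys(2) yS by (auto simp: act_word simp flip: word_prod_rev)
  qed
  from split_list_first_prop[OF this] obtain y1 p y2 where
    y: "ys = y1 @ p # y2" "B s p \<noteq> 0" "\<forall>q\<in>set y1. \<not> B s q \<noteq> 0" by blast
  have p: "p \<in> K" "p \<notin> set y1" "p \<in> S" "set y1 \<subseteq> K" "set y1 \<subseteq> S" "set y2 \<subseteq> S" using y ys yS assms by auto
  let ?x = "wact y1 (simple p)"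
  have red: "length (y1 @ [p]) = len K (prod (y1 @ [p]))"
    using len_reduced_prefix[of K "y1 @ [p]" y2] ys y assms by simp
  then have "length y1 = len K (prod y1)" using len_reduced_prefix[of K y1 "[p]"] p assms by simp
  then have nn: "nonneg ?x" using len_snoc[OF assms(1) p(4,1)] red by blast
  have g: "prod y1 \<in> gen K" using assms p by (intro gen_word_intro)
  have "conj (prod y1) p \<otimes> v = prod (y1 @ y2)"
    using ys(2)[symmetric] p y by (simp add: m_assoc)
  then have "len K (conj (prod y1) p \<otimes> v) < len K v"
    using len_le[of "y1 @ y2" K] ys y by simp
  then have "nonpos (act (inv v) ?x)"
    using len_conj_iff[OF assms(1,4) g p(1)] nn p by (simp add: act_word)
  moreover have "?x \<in> roots K" using g p act_word[of y1] unfolding roots_def by force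
  moreover have "?x p = 1" using p by (simp add: wact_other simple_def)
  ultimately show ?thesis using that[of ?x p] nn p y by auto
qed

text \<open>The vectors \<open>d\<close> in the second alternative are positive: the skew-symmetrised Euler form is
  invariant, and its sign against a later inversion would be wrong if \<open>d\<close> were the negative of an
  inversion root.\<close>
lemma skip_dichotomy:
  assumes "skips cs v C" "distinct cs" "set cs \<subseteq> S" "d \<in> C"
  shows "(\<exists>p\<in>set cs. act (inv v) d = simple p) \<or>
    (nonneg d \<and> (\<exists>x\<in>roots (set cs). nonneg x \<and> nonpos (act (inv v) x) \<and> euler cs d x < euler cs x d))"
  using assms
proof (induction arbitrary: d rule: skips.induct)
  case Nil then show ?case by simp
next
  case (used v s cs C)
  have dist: "distinct (s # cs)" "set (s # cs) \<subseteq> S" and s: "s \<in> S" using used.prems by auto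
  have eq: "set (cs @ [s]) = set (s # cs)" by simp
  obtain d0 where d0: "d0 \<in> C" "d = reflect s d0" using used.prems by auto
  have dr: "d0 \<in> roots (set (s # cs))" using skips_roots[OF used.hyps(3)] d0 dist unfolding eq by auto
  from used.IH[of d0] d0 dist
  consider p where "p \<in> set (s # cs)" "act (inv (s \<otimes> v)) d0 = simple p"
    | x where "nonneg d0" "x \<in> roots (set (s # cs))" "nonneg x" "nonpos (act (inv (s \<otimes> v)) x)"
        "euler (cs @ [s]) d0 x < euler (cs @ [s]) x d0"
    unfolding eq by auto
  then show ?case
  proof cases
    case 1 then show ?thesis using d0 s used.hyps by (auto simp: act_used)
  next
    case 2
    let ?y = "reflect s x"
    have "x \<noteq> simple s"
    proof
      assume "x = simple s"
      then have "nonneg (act (inv v) (simple s))"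
        using 2 s used.hyps by (simp add: act_used reflect_same act_minus)
      moreover have "act (inv v) (simple s) \<in> roots S" using s used.hyps by (simp add: roots_S)
      ultimately show False using not_both_signs[of _ S] used.hyps by blast
    qed
    then have yn: "nonneg ?y" using reflect_pos[OF 2(2) dist(2) _ 2(3)] by auto
    have yr: "?y \<in> roots (set (s # cs))" using 2 dist by (intro roots_reflect) auto
    have yi: "nonpos (act (inv v) ?y)" using 2 s used.hyps by (simp add: act_used)
    have lt: "euler (s # cs) d ?y < euler (s # cs) ?y d"
      using 2 d0 euler_rotate[OF dist, of d0 x] euler_rotate[OF dist, of x d0] dr dist
      by (simp add: supported_root del: euler.simps)
    have "nonneg d"
    proof (rule ccontr)
      assume "\<not> nonneg d"
      then have "d0 = simple s" using reflect_pos[OF dr dist(2) _ 2(1)] d0 by auto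
      then have d: "d = (\<lambda>a. - simple s a)" using d0 s by (simp add: reflect_same)
      \<comment> \<open>For \<open>d = - simple s\<close> the difference of the two Euler values in
        \<open>lt\<close> is -2 times this sum, because \<open>s\<close> comes first. It is
        therefore nonnegative, whereas \<open>lt\<close> makes it negative.\<close>
      have "(\<Sum>b\<leftarrow>cs. B s b * ?y b) \<le> 0"
        using dist yn s by (intro sum_list_nonpos) (auto simp: nonneg_def intro!: mult_nonpos_nonneg B_nonpos)
      moreover have "euler (s # cs) ?y d = - ?y s"
      proof -
        have "euler (s # cs) z (\<lambda>a. - simple s a) = - euler (s # cs) z (simple s)" for z :: "'a \<Rightarrow> real"
        proof -
          have m: "euler ds z (\<lambda>a. - y a) = - euler ds z y" for ds y
          proof (induction ds)
            case (Cons q ds)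
            have "(\<Sum>b\<leftarrow>ds. B q b * - y b) = - (\<Sum>b\<leftarrow>ds. B q b * y b)" by (induction ds) auto
            with Cons show ?case by simp
          qed simp
          show ?thesis by (rule m)
        qed
        then show ?thesis unfolding d euler_simple(2)[OF dist(1)] by simp
      qed
      ultimately show False
        using lt unfolding d euler_minus_left euler_simple(1)[OF dist(1)] by simp
    qed
    then show ?thesis using yn yr yi lt by blast
  qed
next
  case (skipped cs v C s)
  have dist: "distinct (s # cs)" "set (s # cs) \<subseteq> S" and s: "s \<in> S" "s \<notin> set cs" "set cs \<subseteq> S"
    using skipped.prems by auto
  have v: "v \<in> gen (set cs)" using skipped.hyps s skips_gen by blast
  have mono: "roots (set cs) \<subseteq> roots (set (s # cs))" using dist by (intro roots_mono) auto
  have cases: "d = simple s \<or> d \<in> C" using skipped.prems by auto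
  show ?case
  proof (cases "d = simple s")
    case True
    \<comment> \<open>A fixed \<open>simple s\<close> gives the first alternative with
      \<open>p = s\<close>. Otherwise an inversion of \<open>v\<close> not orthogonal to
      \<open>s\<close> witnesses the inequality: its coordinates are nonnegative and 0 at
      \<open>s\<close>, and \<open>B s b\<close> is nonpositive for the other letters.\<close>
    show ?thesis
    proof (cases "act (inv v) (simple s) = simple s")
      case False
      then obtain x p where x: "x \<in> roots (set cs)" "nonneg x" "nonpos (act (inv v) x)"
        "p \<in> set cs" "B s p \<noteq> 0" "x p > 0"
        using inversion_nonorthogonal[OF s(3,1,2) v] by metis
      have xs: "x s = 0" using root_support[OF x(1) s(3,2)] .
      have le: "B s b * x b \<le> 0" if "b \<in> set cs" for b
        using that x s by (intro mult_nonpos_nonneg B_nonpos) (auto simp: nonneg_def)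
      have "B s p < 0" using B_nonpos[of s p] x s by force
      then have "B s p * x p < 0" using x by (intro mult_neg_pos)
      moreover have "(\<Sum>b\<leftarrow>cs. B s b * x b) = B s p * x p + (\<Sum>b\<in>set cs - {p}. B s b * x b)"
        using dist x by (simp add: sum_list_distinct_conv_sum_set sum.remove)
      moreover have "(\<Sum>b\<in>set cs - {p}. B s b * x b) \<le> 0" using le by (intro sum_nonpos) auto
      ultimately have "euler (s # cs) (simple s) x < euler (s # cs) x (simple s)"
        unfolding euler_simple[OF dist(1)] using xs by simp
      then show ?thesis using True x mono by auto
    qed (use True in auto)
  next
    case False
    then have dC: "d \<in> C" using cases by simp
    then have "d \<in> roots (set cs)" using skips_roots[OF skipped.hyps s(3)] by auto
    then have ds: "d s = 0" using root_support s by blast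
    from skipped.IH[OF _ s(3) dC] dist
    consider p where "p \<in> set cs" "act (inv v) d = simple p"
      | x where "nonneg d" "x \<in> roots (set cs)" "nonneg x" "nonpos (act (inv v) x)" "euler cs d x < euler cs x d"
      by auto
    then show ?thesis
    proof cases
      case 2
      then have "x s = 0" using root_support s by blast
      then have "euler (s # cs) d x < euler (s # cs) x d" using ds 2 by simp
      then show ?thesis using 2 mono by blast
    qed auto
  qed
qed

text \<open>Simple roots span extremal rays: the images of \<open>C\<close> under
  \<open>inv v\<close> are nonnegative, so those that contribute to \<open>simple p\<close> are
  multiples of it, and a root among the positive multiples equals it.\<close>

lemma cone_simple:
  assumes "cone C y" "region C v" "C \<subseteq> roots S" "act (inv v) y = simple p" "p \<in> S" "v \<in> carrier W"
  shows "y \<in> C"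
proof -
  obtain gs where gs: "\<forall>(n, d)\<in>set gs. 0 \<le> n \<and> d \<in> C" "y = (\<lambda>a. \<Sum>(n, d)\<leftarrow>gs. n * d a)"
    using assms by (auto simp: cone_def)
  define f where "f = (\<lambda>a (n, d). n * act (inv v) d a)"
  have sum: "simple p a = (\<Sum>g\<leftarrow>gs. f a g)" for a
  proof -
    have "act (inv v) y = (\<lambda>a. \<Sum>(n, d)\<leftarrow>gs. n * act (inv v) d a)"
      unfolding gs(2) using linear_op_sum_list[OF linear_act, of "inv v" "\<lambda>n. n"] by simp
    then show ?thesis using assms by (simp add: f_def)
  qed
  have ge: "0 \<le> f a g" if "g \<in> set gs" for a g
    using that gs(1) assms(2) by (auto simp: f_def region_def nonneg_def)
  have "\<exists>g\<in>set gs. f p g \<noteq> 0"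
  proof (rule ccontr)
    assume "\<not> ?thesis"
    then have "simple p p = 0" unfolding sum by (intro sum_list_zero) auto
    then show False by (simp add: simple_def)
  qed
  then obtain n d where nd: "(n, d) \<in> set gs" "f p (n, d) \<noteq> 0" by auto
  then have n: "n \<noteq> 0" "d \<in> C" using gs(1) by (auto simp: f_def)
  have "act (inv v) d a = 0" if "a \<noteq> p" for a
  proof -
    have "sum_list (map (f a) gs) = 0" using sum[of a] that by (simp add: simple_def)
    moreover have "\<And>z. z \<in> set (map (f a) gs) \<Longrightarrow> 0 \<le> z" using ge by auto
    ultimately have "\<forall>z\<in>set (map (f a) gs). z = 0" using sum_list_nonneg_eq_0_iff by blast
    then have "f a (n, d) = 0" using nd by auto
    then show ?thesis using n by (simp add: f_def)
  qed
  moreover have "act (inv v) d \<in> roots S" using assms n by (intro roots_act) (auto simp: gen_S)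
  ultimately have "act (inv v) d = simple p"
    using assms n by (intro norm_one_simple[of _ S]) (auto simp: region_def)
  then have "act v (act (inv v) d) = act v (act (inv v) y)" using assms(4) by metis
  then have "d = y" using assms(6) by (simp only: act_inv)
  then show ?thesis using n by simp
qed

text \<open>The vector is followed through the recursion like a skip vector. Its sign can change
  only at \<open>- simple s\<close>; there \<open>initial_cone\<close> puts it into the cone of the
  skip vectors, and \<open>cone_simple\<close> makes it one of them.\<close>

lemma cover_in_skips:
  assumes "skips cs v C" "distinct cs" "set cs \<subseteq> S" "nonpos x" "act (inv v) x = simple p" "p \<in> set cs"
  shows "x \<in> C"
  using assms
proof (induction arbitrary: x rule: skips.induct)
  case Nil then show ?case by simp
next
  case (used v s cs C)
  have dist: "distinct (s # cs)" "set (s # cs) \<subseteq> S" and s: "s \<in> S" using used.prems by auto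
  have sk: "skips (s # cs) v (reflect s ` C)" using used.hyps by (intro skips.used)
  have x: "x = act v (simple p)" using used.prems used.hyps by (metis act_inv(2))
  have "x \<in> roots S" unfolding x using used.hyps used.prems dist by (intro roots_S) auto
  then have mx: "(\<lambda>a. - x a) \<in> roots S" by (simp add: minus_root)
  show ?case
  proof (cases "nonpos (reflect s x)")
    case True
    then have "reflect s x \<in> C" using used by (intro used.IH) (auto simp: act_used)
    then show ?thesis using s by (metis image_eqI reflect_reflect)
  next
    case False
    then have "\<not> nonneg (reflect s (\<lambda>a. - x a))" by (simp add: linear_op_minus[OF linear_reflect])
    then have "(\<lambda>a. - x a) = simple s" using reflect_pos[OF mx _ s] used.prems by auto
    then have xs: "x = (\<lambda>a. - simple s a)" by (metis minus_minus)
    have "cone (reflect s ` C) x" unfolding xs using sk dist used.hyps by (intro initial_cone) auto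
    moreover have "reflect s ` C \<subseteq> roots S" using skips_roots[OF sk dist(2)] roots_mono[OF dist(2)] by auto
    ultimately show ?thesis
      using region_self[OF sk dist] used.prems used.hyps dist by (intro cone_simple[of _ x v p]) auto
  qed
next
  case (skipped cs v C s)
  have s: "s \<in> S" "s \<notin> set cs" "set cs \<subseteq> S" using skipped.prems by auto
  have v: "v \<in> gen (set cs)" "v \<in> carrier W" using skipped.hyps s skips_gen skips_carrier by blast+
  have "x = act v (simple p)" using skipped.prems v by (metis act_inv(2))
  then have "p \<noteq> s" using act_skipped[OF s(3,1,2) v(1)] skipped.prems by auto
  then show ?case using skipped by simp
qed

section \<open>Parabolic subgroups\<close>

lemma len_left_less:
  assumes "J \<subseteq> S" "w \<in> gen J" "s \<in> J"
  shows "len J (s \<otimes> w) < len J w \<longleftrightarrow> nonpos (act (inv w) (simple s))"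
  using len_conj_iff[OF assms(1,2) generate.one assms(3)] assms by auto

lemma nonneg_supported:
  assumes "K \<subseteq> S" "supported K y" "nonneg y" "\<And>r. r \<in> K \<Longrightarrow> nonneg (act u (simple r))"
  shows "nonneg (act u y)"
proof -
  have "finite K" using assms(1) finite_S finite_subset by blast
  then obtain ks where ks: "set ks = K" "distinct ks" using finite_distinct_list by blast
  let ?gs = "map (\<lambda>r. (y r, simple r)) ks"
  have "y a = (\<Sum>(n, d)\<leftarrow>?gs. n * d a)" for a
  proof -
    have "(\<Sum>(n, d)\<leftarrow>?gs. n * d a) = (\<Sum>r\<leftarrow>ks. y r * simple r a)" by (simp add: comp_def)
    also have "\<dots> = (\<Sum>r\<in>K. y r * simple r a)" using ks by (simp add: sum_list_distinct_conv_sum_set)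
    also have "\<dots> = (\<Sum>r\<in>K. if a = r then y r else 0)" by (intro sum.cong) (auto simp: simple_def)
    also have "\<dots> = y a" using \<open>finite K\<close> assms(2) by (auto simp: supported_def)
    finally show ?thesis by simp
  qed
  then have y: "y = (\<lambda>a. \<Sum>(n, d)\<leftarrow>?gs. n * d a)" by blast
  have "act u y = (\<lambda>a. \<Sum>(n, d)\<leftarrow>?gs. n * act u d a)"
    using linear_op_sum_list[OF linear_act, of u "\<lambda>n. n" ?gs] y by simp
  moreover have "0 \<le> (\<Sum>(n, d)\<leftarrow>?gs. n * act u d a)" for a
    using assms(3,4) ks by (intro sum_list_nonneg) (auto simp: nonneg_def)
  ultimately show ?thesis by (simp add: nonneg_def)
qed

text \<open>The factorisation \<open>w = x \<otimes> y\<close> with \<open>x\<close> in the subgroup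
  of \<open>K\<close> and \<open>y\<close> minimal in its coset; minimality is expressed by
  positivity of the simple roots of \<open>K\<close> under \<open>inv y\<close>.\<close>

definition parabolic_factor :: "'a set \<Rightarrow> 'a \<Rightarrow> 'a \<Rightarrow> bool" where
  "parabolic_factor K w x \<longleftrightarrow> x \<in> gen K \<and> (\<forall>r\<in>K. nonneg (act (inv (inv x \<otimes> w)) (simple r)))"

lemma parabolic_factor_exists:
  assumes "w \<in> carrier W" "K \<subseteq> S" shows "\<exists>x. parabolic_factor K w x"
  using assms(1)
proof (induction "len S w" arbitrary: w rule: less_induct)
  case less
  show ?case
  proof (cases "\<forall>r\<in>K. nonneg (act (inv w) (simple r))")
    case True
    then have "parabolic_factor K w \<one>" using less.prems by (simp add: parabolic_factor_def generate.one)
    then show ?thesis by blast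
  next
    case False
    then obtain r where r: "r \<in> K" "\<not> nonneg (act (inv w) (simple r))" by blast
    have rS: "r \<in> S" using r assms by auto
    then have "nonpos (act (inv w) (simple r))" using act_simple_sign[of "inv w" r] r less.prems by auto
    then have "len S (r \<otimes> w) < len S w" using len_left_less[of S w r] rS less.prems gen_S by auto
    then obtain x where x: "parabolic_factor K (r \<otimes> w) x" using less.hyps[of "r \<otimes> w"] rS less.prems by auto
    have xc: "x \<in> carrier W" using x assms unfolding parabolic_factor_def by auto
    have "inv (r \<otimes> x) \<otimes> w = inv x \<otimes> (r \<otimes> w)" using xc rS less.prems by (simp add: inv_mult_group m_assoc)
    moreover have "r \<otimes> x \<in> gen K"
      using x r by (intro generate.eng[OF generate.incl]) (auto simp: parabolic_factor_def)
    ultimately have "parabolic_factor K w (r \<otimes> x)" using x unfolding parabolic_factor_def by simp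
    then show ?thesis by blast
  qed
qed

text \<open>The inverse of the second factor sends nonnegative combinations of the simple roots of
  \<open>K\<close> to nonnegative vectors, so it preserves the signs of roots of \<open>K\<close>.
  Region conditions for a word in the letters of \<open>K\<close> thus see only
  \<open>x\<close>.\<close>

lemma parabolic_factor_sign:
  assumes "K \<subseteq> S" "w \<in> carrier W" "parabolic_factor K w x" "d \<in> roots K"
  shows "nonneg (act (inv w) d) \<longleftrightarrow> nonneg (act (inv x) d)"
proof -
  have x: "x \<in> gen K" "x \<in> carrier W" "\<And>r. r \<in> K \<Longrightarrow> nonneg (act (inv (inv x \<otimes> w)) (simple r))"
    using assms unfolding parabolic_factor_def by auto
  let ?u = "inv (inv x \<otimes> w)" and ?y = "act (inv x) d"
  have "?u \<otimes> inv x = inv w" using x assms by (simp add: inv_mult_group m_assoc)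
  then have eq: "act (inv w) d = act ?u ?y"
    using act_mult[of ?u "inv x" d] x(2) assms(2) by (metis inv_closed m_closed)
  have y: "?y \<in> roots K" using x assms gen_inv[of K x] by (intro roots_act) auto
  have pos: "nonneg (act ?u z)" if "z \<in> roots K" "nonneg z" for z
    using assms(1) supported_root[OF that(1) assms(1)] that(2) x(3) by (rule nonneg_supported)
  have "d \<in> roots S" using assms roots_mono[of K S] by auto
  then have dw: "act (inv w) d \<in> roots S" using assms by (intro roots_act) (auto simp: gen_S)
  show ?thesis
  proof
    assume n: "nonneg (act (inv w) d)"
    show "nonneg ?y"
    proof (rule ccontr)
      assume "\<not> nonneg ?y"
      then have "nonneg (\<lambda>a. - ?y a)" using root_sign[OF y assms(1)] by simp
      then have "nonneg (act ?u (\<lambda>a. - ?y a))" using minus_root[OF y assms(1)] by (intro pos)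
      then have "nonpos (act (inv w) d)" unfolding eq act_minus by simp
      then show False using not_both_signs[OF dw] n by simp
    qed
  qed (use pos[OF y] eq in simp)
qed

text \<open>Follow \<open>w\<close>: use the first letter if it is an inversion of \<open>w\<close>,
  otherwise skip it. The same \<open>w\<close> is kept when a letter is dropped, since a region
  condition makes sense for any element.\<close>

lemma skips_exists:
  assumes "distinct cs" "set cs \<subseteq> S" "w \<in> carrier W"
  shows "\<exists>v C. skips cs v C \<and> region C w"
  using assms
proof (induction "(length cs, len S w)" arbitrary: cs w rule: wf_induct_rule[OF wf_lex_prod[OF wf_less_than wf_less_than]])
  case 1
  show ?case
  proof (cases cs)
    case Nil then show ?thesis using skips.Nil by (auto simp: region_def)
  next
    case (Cons s ds)
    have s: "s \<in> S" "distinct (ds @ [s])" "set (ds @ [s]) \<subseteq> S" using 1 Cons by auto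
    show ?thesis
    proof (cases "nonpos (act (inv w) (simple s))")
      case True
      have "len S (s \<otimes> w) < len S w" using True len_left_less[of S w s] s 1 gen_S by auto
      then have "\<exists>v C. skips (ds @ [s]) v C \<and> region C (s \<otimes> w)"
        using s 1(4) Cons by (intro 1(1)) simp_all
      then obtain v C where v: "skips (ds @ [s]) v C" "region C (s \<otimes> w)" by blast
      have vc: "v \<in> carrier W" using v s skips_carrier by blast
      \<comment> \<open>Only if \<open>v\<close> does not have \<open>s\<close> as an inversion does
        \<open>s \<otimes> v\<close> use \<open>s\<close>. This holds because \<open>v\<close> lies
        below \<open>s \<otimes> w\<close>, which has lost this inversion.\<close>
      have "\<not> nonpos (act (inv (s \<otimes> w)) (simple s))"
        using True s 1 not_both_signs[OF roots_S[of "inv w" s]]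
        by (simp add: act_used reflect_same act_minus)
      then have "\<not> nonpos (act (inv v) (simple s))"
        using region_below[OF v(1) s(2,3) _ v(2)] s 1 by (auto simp: simple_root)
      then have "nonneg (act (inv v) (simple s))" using act_simple_sign[of "inv v" s] s vc by auto
      then have "nonpos (act (inv (s \<otimes> v)) (simple s))" using s vc by (simp add: act_used reflect_same act_minus)
      then have "skips (s # ds) (s \<otimes> v) (reflect s ` C)" using v s vc by (intro skips.used) auto
      moreover have "region (reflect s ` C) w" using v s 1 by (simp add: region_used)
      ultimately show ?thesis using Cons by blast
    next
      case False
      have "\<exists>v C. skips ds v C \<and> region C w" using 1(2-4) Cons by (intro 1(1)) simp_all
      then obtain v C where v: "skips ds v C" "region C w" by blast
      have "nonneg (act (inv w) (simple s))" using False act_simple_sign[of "inv w" s] s 1 by auto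
      then have "region (insert (simple s) C) w" using v by (simp add: region_def)
      then show ?thesis using v Cons skips.skipped by blast
    qed
  qed
qed

section \<open>Commuting letters\<close>

lemma orthogonal_reflect:
  assumes "s \<in> S" "t \<in> S" "B s t = 0" shows "reflect s (simple t) = simple t" "reflect t (simple s) = simple s"
    and "reflect s (reflect t x) = reflect t (reflect s x)"
proof -
  show "reflect s (simple t) = simple t" "reflect t (simple s) = simple s"
    using assms B_commute[of s t] by (auto simp: reflect_simple)
  have "act (s \<otimes> t) x = act (t \<otimes> s) x" using B_zero_commute[OF assms] by simp
  then show "reflect s (reflect t x) = reflect t (reflect s x)" using assms by (simp add: act_mult act_S)
qed

text \<open>Once the two letters reach the front, each of the four combinations of use and skip can
  be done in the other order. If both are used they move to the end, still adjacent, and the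
  induction hypothesis applies to a shorter element.\<close>

lemma skips_swap:
  assumes "skips (xs @ s # t # ys) v C" "distinct (xs @ s # t # ys)" "set (xs @ s # t # ys) \<subseteq> S" "B s t = 0"
  shows "skips (xs @ t # s # ys) v C"
  using assms
proof (induction "(length (xs @ s # t # ys), len S v)" arbitrary: xs ys v C
    rule: wf_induct_rule[OF wf_lex_prod[OF wf_less_than wf_less_than]])
  case 1
  have st: "s \<in> S" "t \<in> S" "s \<noteq> t" using 1 by auto
  have v: "v \<in> carrier W" using 1 skips_carrier by blast
  show ?case
  proof (cases xs)
    case (Cons x xs')
    have x: "x \<in> S" using 1 Cons by auto
    from 1(2) have "skips (x # xs' @ s # t # ys) v C" by (simp add: Cons)
    then show ?thesis
    proof (cases rule: skips_Cons)
      case (used C0)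
      have "len S (x \<otimes> v) < len S v" using used len_left_less[of S v x] x gen_S by auto
      moreover have "skips (xs' @ s # t # (ys @ [x])) (x \<otimes> v) C0" using used by simp
      ultimately have "skips (xs' @ t # s # (ys @ [x])) (x \<otimes> v) C0"
        by (intro 1(1)) (use 1 Cons in auto)
      then have "skips (x # (xs' @ t # s # ys)) v (reflect x ` C0)"
        using used v by (intro skips.used) auto
      then show ?thesis using used Cons by simp
    next
      case (skipped C0)
      then have "skips (xs' @ t # s # ys) v C0" by (intro 1(1)) (use 1 Cons in auto)
      then show ?thesis using skipped Cons by (auto intro: skips.skipped)
    qed
  next
    case Nil
    note orth = orthogonal_reflect[OF st(1,2) 1(5)]
    have comm: "s \<otimes> (t \<otimes> v) = t \<otimes> (s \<otimes> v)"
      using B_zero_commute[OF st(1,2) 1(5)] st v by (simp flip: m_assoc)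
    have sv: "act (inv (s \<otimes> v)) (simple t) = act (inv v) (simple t)"
      "act (inv (t \<otimes> v)) (simple s) = act (inv v) (simple s)" using st v orth by (simp_all add: act_used)
    have img: "reflect s ` reflect t ` D = reflect t ` reflect s ` D" for D
      by (simp add: image_image orth)
    from 1(2) have "skips (s # t # ys) v C" by (simp add: Nil)
    then show ?thesis
    proof (cases rule: skips_Cons)
      case s_used: (used C1)
      from s_used(3) have "skips (t # (ys @ [s])) (s \<otimes> v) C1" by simp
      then show ?thesis
      proof (cases rule: skips_Cons)
        case t_used: (used C2)
        have "len S (s \<otimes> v) < len S v" using s_used len_left_less[of S v s] st gen_S by auto
        moreover have "len S (t \<otimes> (s \<otimes> v)) < len S (s \<otimes> v)"
          using t_used len_left_less[of S "s \<otimes> v" t] st gen_S v by auto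
        moreover have "skips (ys @ s # t # []) (t \<otimes> (s \<otimes> v)) C2" using t_used by simp
        ultimately have "skips (ys @ t # s # []) (t \<otimes> (s \<otimes> v)) C2"
          by (intro 1(1)) (use 1 Nil in auto)
        then have "skips ((ys @ [t]) @ [s]) (s \<otimes> (t \<otimes> v)) C2" by (simp add: comm)
        then have "skips (s # (ys @ [t])) (t \<otimes> v) (reflect s ` C2)"
          using st v s_used by (intro skips.used) (auto simp: sv)
        then have "skips (t # s # ys) v (reflect t ` reflect s ` C2)"
          using st v t_used by (intro skips.used) (auto simp: sv)
        then show ?thesis using s_used t_used Nil img by simp
      next
        case t_skipped: (skipped C2)
        then have "skips (s # ys) v (reflect s ` C2)" using s_used by (intro skips.used) auto
        then have "skips (t # s # ys) v (insert (simple t) (reflect s ` C2))" by (rule skips.skipped)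
        then show ?thesis using s_used t_skipped Nil orth by simp
      qed
    next
      case s_skipped: (skipped C1)
      from s_skipped(1) show ?thesis
      proof (cases rule: skips_Cons)
        case t_used: (used C2)
        then have "skips (s # (ys @ [t])) (t \<otimes> v) (insert (simple s) C2)" by (intro skips.skipped)
        then have "skips (t # s # ys) v (reflect t ` insert (simple s) C2)"
          using t_used by (intro skips.used) auto
        then show ?thesis using s_skipped t_used Nil orth by simp
      next
        case t_skipped: (skipped C2)
        then have "skips (t # s # ys) v (insert (simple t) (insert (simple s) C2))"
          by (intro skips.skipped)
        then show ?thesis using s_skipped t_skipped Nil by (simp add: insert_commute)
      qed
    qed
  qed
qed

lemma skips_move:
  assumes "skips (s # us @ vs) v C" "distinct (s # us @ vs)" "set (s # us @ vs) \<subseteq> S" "\<forall>u\<in>set us. B u s = 0"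
  shows "skips (us @ s # vs) v C"
  using assms
proof (induction us arbitrary: vs rule: rev_induct)
  case (snoc u us)
  have "skips (us @ s # u # vs) v C"
    using snoc.IH[of "u # vs"] snoc.prems by simp
  moreover have "B s u = 0" using snoc.prems B_commute[of s u] by simp
  ultimately show ?case using skips_swap[of us s u vs v C] snoc.prems by auto
qed simp

lemma prod_move:
  assumes "set (s # us) \<subseteq> S" "\<forall>u\<in>set us. B u s = 0"
  shows "prod us \<otimes> s = s \<otimes> prod us"
  using assms
proof (induction us)
  case (Cons u us)
  have us: "u \<in> S" "s \<in> S" "set us \<subseteq> S" using Cons.prems by auto
  have "u \<otimes> s = s \<otimes> u" using Cons.prems us by (intro B_zero_commute) auto
  moreover have "prod us \<otimes> s = s \<otimes> prod us" using Cons by auto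
  ultimately show ?case using us by (simp add: m_assoc) (simp flip: m_assoc)
qed simp

text \<open>The reflection in the first letter \<open>u\<close> is applied first, and no later
  letter touches the coordinate at \<open>u\<close> again, so its value \<open>- 2 * B s u\<close>
  must vanish.\<close>

lemma fixed_orthogonal:
  assumes "distinct us" "set us \<subseteq> S" "s \<in> S" "s \<notin> set us" "wact (rev us) (simple s) = simple s"
  shows "\<forall>u\<in>set us. B u s = 0"
  using assms
proof (induction us)
  case (Cons u us)
  have u: "u \<in> S" "u \<notin> set us" "u \<noteq> s" using Cons.prems by auto
  have "wact (rev us) (reflect u (simple s)) u = reflect u (simple s) u" using u by (simp add: wact_other)
  then have "reflect u (simple s) u = 0" using Cons.prems u by (simp add: simple_def)
  then have "simple s u - 2 * B s u * simple u u = 0" unfolding reflect_simple[OF u(1) Cons.prems(3)] .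
  then have B: "B s u = 0" using u by (simp add: simple_def)
  then have "wact (rev us) (simple s) = simple s"
    using Cons.prems u by (simp add: reflect_simple)
  then show ?case using Cons B u B_commute[of s u] by auto
qed simp

text \<open>Apply the inverse of the product to \<open>simple s\<close> and read the coordinates at
  the letters before \<open>s\<close>: neither \<open>s\<close> nor the later letters change them.
  They are nonpositive by assumption, and nonnegative because before \<open>s\<close> acts the
  coordinate at \<open>s\<close> is still 1. So they vanish.\<close>

lemma initial_orthogonal:
  assumes "distinct (us @ s # vs)" "set (us @ s # vs) \<subseteq> S" "nonpos (act (inv (prod (us @ s # vs))) (simple s))"
  shows "\<forall>u\<in>set us. B u s = 0"
proof (rule fixed_orthogonal)
  let ?z = "wact (rev us) (simple s)"
  have S: "set us \<subseteq> S" "s \<in> S" "set vs \<subseteq> S" using assms by auto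
  have "act (inv (prod (us @ s # vs))) (simple s) = wact (rev vs) (reflect s ?z)"
    using S act_word[of "rev (us @ s # vs)"] word_prod_rev[of "us @ s # vs"] by auto
  moreover have "wact (rev vs) (reflect s ?z) u = ?z u" if "u \<in> set us" for u
  proof -
    have "u \<notin> set (rev vs)" "u \<noteq> s" using that assms by auto
    then show ?thesis by (simp add: wact_other reflect_other)
  qed
  ultimately have le: "?z u \<le> 0" if "u \<in> set us" for u using assms(3) that by (metis nonpos_def)
  have g: "prod (rev us) \<in> gen (set us)" using S by (intro gen_word_intro) auto
  have nn: "nonneg ?z" using act_skipped(1)[OF S(1,2) _ g] assms S by (auto simp: act_word)
  have "?z a = simple s a" for a
  proof (cases "a \<in> set us")
    case True
    then have "?z a = 0" using le nn by (simp add: nonneg_def order_antisym)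
    then show ?thesis using True assms by (auto simp: simple_def)
  qed (simp add: wact_other)
  then show "?z = simple s" by blast
qed (use assms in auto)

section \<open>Standard parabolic subgroups as Coxeter groups\<close>

abbreviation PW :: "'a set \<Rightarrow> ('a, 'b) monoid_scheme" where "PW J \<equiv> subgroup_generated W J"

lemma PW_eq: assumes "J \<subseteq> S" shows "PW J = W\<lparr>carrier := gen J\<rparr>"
proof -
  have "carrier W \<inter> J = J" using assms S_carrier by auto
  then show ?thesis by (simp add: subgroup_generated_def)
qed

lemma PW_S: "PW S = W"
  using PW_eq[of S] gen_S by simp

lemma gen_subgroup: "J \<subseteq> S \<Longrightarrow> subgroup (gen J) W"
  using S_carrier by (intro generate_is_subgroup) auto

lemma generate_PW: assumes "K \<subseteq> J" "J \<subseteq> S" shows "generate (PW J) K = gen K"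
proof -
  have "K \<subseteq> gen J" using assms by (auto intro: generate.incl)
  then show ?thesis using assms by (simp add: PW_eq generate_consistent gen_subgroup)
qed

lemma PW_PW: assumes "K \<subseteq> J" "J \<subseteq> S" shows "subgroup_generated (PW J) K = PW K"
proof -
  have "K \<subseteq> gen J" using assms by (auto intro: generate.incl)
  then have "carrier (PW J) \<inter> K = K" using assms by (auto simp: PW_eq)
  then have "subgroup_generated (PW J) K = PW J\<lparr>carrier := gen K\<rparr>"
    using generate_PW[OF assms] by (simp add: subgroup_generated_def)
  also have "\<dots> = PW K" using assms by (simp add: PW_eq)
  finally show ?thesis .
qed

lemma word_prod_PW [simp]: "word_prod (PW J) = prod"
  by (simp add: word_prod_def fun_eq_iff)

lemma cox_length_PW [simp]: "cox_length (PW J) K = len K"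
  by (simp add: cox_length_def fun_eq_iff)

lemma reduced_PW [simp]: "reduced (PW J) K xs \<longleftrightarrow> reduced W K xs"
  by (simp add: reduced_def)

lemma reflections_PW: assumes "J \<subseteq> S" shows "reflections (PW J) J = {conj u r | u r. u \<in> gen J \<and> r \<in> J}"
proof -
  have "inv\<^bsub>PW J\<^esub> u = inv u" if "u \<in> gen J" for u
    using that assms m_inv_consistent[OF gen_subgroup] by (simp add: PW_eq)
  moreover have "carrier (PW J) = gen J" using assms by (simp add: PW_eq)
  ultimately show ?thesis unfolding reflections_def by (intro Collect_cong ex_cong1) auto
qed

lemma conj_inversion_iff:
  assumes "J \<subseteq> S" "w \<in> gen J" "u \<in> gen J" "r \<in> J"
  shows "conj u r \<in> inversions (PW J) J w \<longleftrightarrow> (nonneg (act u (simple r)) \<longleftrightarrow> nonpos (act (inv w) (act u (simple r))))"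
proof -
  have "conj u r \<in> reflections (PW J) J" using assms by (auto simp: reflections_PW)
  then show ?thesis using len_conj_iff[OF assms] by (simp add: inversions_def)
qed

lemma inversion_cases:
  assumes "J \<subseteq> S" "t \<in> inversions (PW J) J w"
  obtains u r where "u \<in> gen J" "r \<in> J" "t = conj u r"
  using assms by (auto simp: inversions_def reflections_PW)

text \<open>Every reflection can be written with a positive root, since \<open>conj u r = conj (u \<otimes> r) r\<close>.\<close>
lemma inversion_pos:
  assumes "J \<subseteq> S" "w \<in> gen J" "t \<in> inversions (PW J) J w"
  obtains u r where "u \<in> gen J" "r \<in> J" "t = conj u r" "nonneg (act u (simple r))"
    "nonpos (act (inv w) (act u (simple r)))"
proof -
  obtain u r where ur: "u \<in> gen J" "r \<in> J" "t = conj u r" using inversion_cases assms by metis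
  have c: "u \<in> carrier W" "r \<in> S" using ur assms by auto
  show ?thesis
  proof (cases "nonneg (act u (simple r))")
    case True then show ?thesis using that[of u r] ur conj_inversion_iff[OF assms(1,2) ur(1,2)] assms(3) by simp
  next
    case False
    have e: "act (u \<otimes> r) (simple r) = (\<lambda>a. - act u (simple r) a)"
      using c by (simp add: act_mult act_S reflect_same act_minus)
    have g: "u \<otimes> r \<in> gen J" using ur by (auto intro: generate.eng generate.incl)
    have t: "t = conj (u \<otimes> r) r" unfolding ur(3) using c by (intro conj_eq) (auto simp: e)
    have n: "nonneg (act (u \<otimes> r) (simple r))"
      using False act_simple_sign[OF c] by (simp add: e)
    then show ?thesis
      using that[OF g ur(2) t n] conj_inversion_iff[OF assms(1,2) g ur(2)] assms(3) t by simp
  qed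
qed

lemma weak_le_simple_iff:
  assumes "J \<subseteq> S" "w \<in> gen J" "s \<in> J"
  shows "weak_le (PW J) J s w \<longleftrightarrow> nonpos (act (inv w) (simple s))"
proof -
  have s: "s \<in> S" "s \<in> gen J" using assms by (auto intro: generate.incl)
  have one: "conj \<one> s = s" using s by simp
  have iff: "s \<in> inversions (PW J) J z \<longleftrightarrow> nonpos (act (inv z) (simple s))" if "z \<in> gen J" for z
    using conj_inversion_iff[OF assms(1) that generate.one assms(3)] one by simp
  have inv_s: "inversions (PW J) J s = {s}"
  proof (intro equalityI subsetI)
    fix t assume "t \<in> inversions (PW J) J s"
    then obtain u r where ur: "u \<in> gen J" "r \<in> J" "t = conj u r" "nonneg (act u (simple r))"
      "nonpos (act (inv s) (act u (simple r)))"
      using inversion_pos[OF assms(1) s(2)] by metis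
    have c: "u \<in> carrier W" "r \<in> S" using ur assms by auto
    have root: "act u (simple r) \<in> roots S" using c by (rule roots_S)
    have np: "nonpos (reflect s (act u (simple r)))" using ur(5) s by (simp add: act_S)
    have "\<not> nonneg (reflect s (act u (simple r)))"
      using not_both_signs[OF roots_reflect[OF root s(1) order.refl] order.refl] np by blast
    then have "act u (simple r) = act \<one> (simple s)"
      using reflect_pos[OF root order.refl s(1) ur(4)] by simp
    then have "conj u r = conj \<one> s" using c s by (intro conj_eq) auto
    then show "t \<in> {s}" using ur one by simp
  next
    fix t assume "t \<in> {s}"
    then show "t \<in> inversions (PW J) J s" using iff[OF s(2)] s by (simp add: act_S reflect_same)
  qed
  show ?thesis using iff[OF assms(2)] by (simp add: weak_le_def inv_s)
qed

text \<open>If \<open>x\<close> and \<open>y\<close> differ, let \<open>r\<close> be the last letter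
  of a shortest word of \<open>inv x \<otimes> y\<close>. The root \<open>act y (simple r)\<close>
  is positive under \<open>inv y\<close> and negative under \<open>inv x\<close>, so its reflection
  is an inversion of exactly one of the two.\<close>

lemma inversions_inject:
  assumes J: "J \<subseteq> S" and "x \<in> gen J" "y \<in> gen J" and eq: "inversions (PW J) J x = inversions (PW J) J y"
  shows "x = y"
proof (rule ccontr)
  assume ne: "x \<noteq> y"
  have c: "x \<in> carrier W" "y \<in> carrier W" using assms by auto
  let ?z = "inv x \<otimes> y"
  have z: "?z \<in> gen J" using assms gen_inv[OF J, of x] by (auto intro: generate.eng)
  obtain zs where zs: "set zs \<subseteq> J" "prod zs = ?z" "length zs = len J ?z" using len_word[OF z J] by metis
  have "zs \<noteq> []"
  proof
    assume "zs = []"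
    then have "?z = \<one>" using zs by simp
    then have "x \<otimes> ?z = x" using c by simp
    then show False using c ne by simp
  qed
  then obtain us r where us: "zs = us @ [r]" by (cases zs rule: rev_cases) auto
  have S: "r \<in> S" "set us \<subseteq> S" "r \<in> J" using us zs J by auto
  have red: "length us = len J (prod us)" using len_reduced_prefix[of J us "[r]"] us zs J by simp
  then have "nonneg (wact us (simple r))" using len_snoc[OF J _ S(3) red] us zs by simp
  moreover have "act ?z (simple r) = (\<lambda>a. - wact us (simple r) a)"
    using S us linear_op_minus[OF linear_wact, of us "simple r"]
    unfolding zs(2)[symmetric] by (simp add: act_mult act_word act_S reflect_same)
  ultimately have np: "nonpos (act ?z (simple r))" by simp
  let ?b = "act y (simple r)"
  have b: "?b \<in> roots S" using c S by (intro roots_S)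
  have np': "nonpos (act (inv x) ?b)" using np c by (simp add: act_mult)
  have pp: "act (inv y) ?b = simple r" using c by simp
  have "conj y r \<in> inversions (PW J) J x \<longleftrightarrow> nonneg ?b"
    using conj_inversion_iff[OF J assms(2,3) S(3)] np' by simp
  moreover have "conj y r \<in> inversions (PW J) J y \<longleftrightarrow> \<not> nonneg ?b"
    using conj_inversion_iff[OF J assms(3,3) S(3)] pp by simp
  ultimately show False using eq by blast
qed

lemma parabolic_part_eq:
  assumes "J \<subseteq> S" "K \<subseteq> J" "w \<in> gen J" "parabolic_factor K w x"
  shows "parabolic_part (PW J) J K w = x"
proof -
  have KS: "K \<subseteq> S" using assms by auto
  have xK: "x \<in> gen K" using assms unfolding parabolic_factor_def by blast
  have KJ: "gen K \<subseteq> gen J" using assms gen_mono by blast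
  have xJ: "x \<in> gen J" using xK KJ by blast
  have c: "w \<in> carrier W" "x \<in> carrier W" using assms xJ by auto
  have "inversions (PW J) J x = inversions (PW J) J w \<inter> gen K"
  proof (intro equalityI subsetI)
    fix t assume t: "t \<in> inversions (PW J) J x"
    then obtain u r where ur: "u \<in> gen J" "r \<in> J" "t = conj u r" "nonneg (act u (simple r))"
      "nonpos (act (inv x) (act u (simple r)))"
      using inversion_pos[OF assms(1) xJ] by metis
    let ?b = "act u (simple r)"
    have uc: "u \<in> carrier W" "r \<in> S" using ur assms by auto
    have root: "?b \<in> roots S" using uc by (rule roots_S)
    note K = len_conj_less[OF KS xK uc disjI1[OF refl] root ur(4,5)]
    have "\<not> nonneg (act (inv x) ?b)"
      using ur(5) not_both_signs[OF roots_act[OF K(3) gen_inv[OF KS xK] KS] KS] by blast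
    then have n: "\<not> nonneg (act (inv w) ?b)" using parabolic_factor_sign[OF KS c(1) assms(4) K(3)] by simp
    have "act (inv w) ?b \<in> roots S" using c by (intro roots_act[OF root]) (auto simp: gen_S)
    then have "nonpos (act (inv w) ?b)" using n root_sign[of _ S] by blast
    then have "t \<in> inversions (PW J) J w"
      unfolding ur(3) using conj_inversion_iff[OF assms(1,3) ur(1,2)] ur(4) by simp
    then show "t \<in> inversions (PW J) J w \<inter> gen K" using K(2) ur(3) by simp
  next
    fix t assume t: "t \<in> inversions (PW J) J w \<inter> gen K"
    then obtain u r where ur: "u \<in> gen J" "r \<in> J" "t = conj u r" "nonneg (act u (simple r))"
      "nonpos (act (inv w) (act u (simple r)))"
      using inversion_pos[OF assms(1,3)] by (metis IntD1)
    let ?b = "act u (simple r)"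
    have uc: "u \<in> carrier W" "r \<in> S" using ur assms by auto
    have root: "?b \<in> roots S" using uc by (rule roots_S)
    \<comment> \<open>A reflection in the subgroup of \<open>K\<close> fixes all coordinates outside
      \<open>K\<close>, yet it negates its own root, so these coordinates of the root
      vanish.\<close>
    have supp: "supported K ?b" unfolding supported_def
    proof (intro allI impI)
      fix a assume "a \<notin> K"
      then have "act t ?b a = ?b a" using t by (intro act_other[OF KS]) auto
      then show "?b a = 0" unfolding ur(3) act_conj_root[OF uc] by simp
    qed
    have y: "act (inv x) ?b \<in> roots S" using c by (intro roots_act[OF root]) (auto simp: gen_S)
    have "\<not> nonneg (act (inv x) ?b)"
    proof
      assume nn: "nonneg (act (inv x) ?b)"
      have "supported K (act (inv x) ?b)"
        using supp act_other[OF KS gen_inv[OF KS xK]] by (simp add: supported_def)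
      then have "nonneg (act (inv (inv x \<otimes> w)) (act (inv x) ?b))"
        using nn by (rule nonneg_supported[OF KS]) (use assms(4) in \<open>simp add: parabolic_factor_def\<close>)
      moreover have "inv (inv x \<otimes> w) \<otimes> inv x = inv w" using c by (simp add: inv_mult_group m_assoc)
      then have "act (inv (inv x \<otimes> w)) (act (inv x) ?b) = act (inv w) ?b"
        using act_mult[of "inv (inv x \<otimes> w)" "inv x"] c by (metis inv_closed m_closed)
      ultimately have "nonneg (act (inv w) ?b)" by simp
      moreover have "act (inv w) ?b \<in> roots S" using c by (intro roots_act[OF root]) (auto simp: gen_S)
      ultimately show False using ur(5) not_both_signs[of _ S] by blast
    qed
    then have "nonpos (act (inv x) ?b)" using root_sign[OF y order.refl] by blast
    then show "t \<in> inversions (PW J) J x"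
      unfolding ur(3) using conj_inversion_iff[OF assms(1) xJ ur(1,2)] ur(4) by simp
  qed
  then have x: "x \<in> generate (PW J) K \<and> inversions (PW J) J x = inversions (PW J) J w \<inter> generate (PW J) K"
    using xK generate_PW[OF assms(2,1)] by simp
  show ?thesis unfolding parabolic_part_def
  proof (rule the_equality, rule x)
    fix y assume "y \<in> generate (PW J) K \<and> inversions (PW J) J y = inversions (PW J) J w \<inter> generate (PW J) K"
    then show "y = x" using x KJ generate_PW[OF assms(2,1)] by (intro inversions_inject[OF assms(1)]) auto
  qed
qed

text \<open>The simple root of a new letter keeps its coordinate 1 there under the earlier letters,
  so it stays positive and the length grows.\<close>

lemma distinct_reduced:
  assumes "J \<subseteq> S" "distinct xs" "set xs \<subseteq> J" shows "length xs = len J (prod xs)"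
  using assms(2,3)
proof (induction xs rule: rev_induct)
  case (snoc s xs)
  have g: "prod xs \<in> gen (set xs)" using snoc.prems assms(1) by (intro gen_word_intro) auto
  have "nonneg (wact xs (simple s))"
    using act_skipped(1)[OF _ _ _ g, of s] snoc.prems assms(1) by (auto simp: act_word)
  then show ?case using len_snoc[OF assms(1), of xs s] snoc by auto
qed simp

lemma initial_head:
  assumes "distinct (s # cs)" "set (s # cs) \<subseteq> S"
  shows "initial (PW (set (s # cs))) (set (s # cs)) (prod (s # cs)) s"
  unfolding initial_def reduced_word_for_def
  using distinct_reduced[OF assms(2,1)] by (intro exI[of _ cs]) (auto simp: reduced_def)

lemma initial_cases:
  assumes "distinct cs" "set cs \<subseteq> S" "s \<in> set cs" "initial (PW (set cs)) (set cs) (prod cs) s"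
  obtains us vs where "cs = us @ s # vs" "\<forall>u\<in>set us. B u s = 0"
proof -
  obtain xs where xs: "set (s # xs) \<subseteq> set cs" "length (s # xs) = len (set cs) (prod cs)" "prod (s # xs) = prod cs"
    using assms(4) by (auto simp: initial_def reduced_word_for_def reduced_def lists_eq_set)
  have S: "s \<in> S" "set xs \<subseteq> S" using xs assms by auto
  have g: "prod cs \<in> gen (set cs)" using assms by (intro gen_word_intro) auto
  have "s \<otimes> prod cs = prod xs" unfolding xs(3)[symmetric] using S by simp
  then have "len (set cs) (s \<otimes> prod cs) < len (set cs) (prod cs)"
    using len_le[of xs "set cs"] xs by simp
  then have "nonpos (act (inv (prod cs)) (simple s))" using len_left_less[OF assms(2) g assms(3)] by simp
  moreover obtain us vs where "cs = us @ s # vs" using assms(3) split_list by metis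
  ultimately show ?thesis using that initial_orthogonal assms by metis
qed

section \<open>The downward projection\<close>

lemma conj_head: "set (s # cs) \<subseteq> S \<Longrightarrow> s \<otimes> prod (s # cs) \<otimes> s = prod (cs @ [s])"
  by simp

text \<open>The head of the word is always initial, so the recursion of \<open>skips\<close> is one
  admissible sequence of choices. A used head satisfies \<open>w \<ge> s\<close> by
  \<open>region_below\<close>; a skipped one violates it because \<open>simple s\<close> is a skip
  vector.\<close>

lemma skips_pi_down:
  assumes "skips cs v C" "distinct cs" "set cs \<subseteq> S" "w \<in> gen (set cs)" "region C w"
  shows "pi_down_rel (PW (set cs)) (set cs) (prod cs) w v"
  using assms
proof (induction arbitrary: w rule: skips.induct)
  case Nil
  have "w = \<one>" using Nil generate_empty by simp
  moreover have "pi_down_rel (PW {}) {} \<one> \<one>\<^bsub>PW {}\<^esub> \<one>\<^bsub>PW {}\<^esub>" by (rule pi_down_rel.one)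
  ultimately show ?case by simp
next
  case (used v s cs C)
  let ?J = "set (s # cs)"
  have d: "distinct (s # cs)" "?J \<subseteq> S" and s: "s \<in> S" "s \<in> ?J" using used.prems by auto
  have w: "w \<in> carrier W" using gen_closed[OF d(2) used.prems(3)] .
  have sk: "skips (s # cs) v (reflect s ` C)" using used.hyps by (intro skips.used)
  have below: "nonpos (act (inv w) (simple s))"
    using region_below[OF sk d w] used.prems used.hyps s by (simp add: simple_root)
  have eq: "set (cs @ [s]) = ?J" by simp
  have "pi_down_rel (PW (set (cs @ [s]))) (set (cs @ [s])) (prod (cs @ [s])) (s \<otimes> w) (s \<otimes> v)"
  proof (rule used.IH)
    show "s \<otimes> w \<in> gen (set (cs @ [s]))" unfolding eq using gen_mult_left[OF s(2) d(2) w] used.prems by simp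
    show "region C (s \<otimes> w)" using used.prems s w by (simp add: region_used)
  qed (use d in auto)
  then have "pi_down_rel (PW ?J) ?J (s \<otimes>\<^bsub>PW ?J\<^esub> prod (s # cs) \<otimes>\<^bsub>PW ?J\<^esub> s) (s \<otimes>\<^bsub>PW ?J\<^esub> w) (s \<otimes> v)"
    unfolding eq mult_subgroup_generated conj_head[OF d(2)] .
  moreover have "weak_le (PW ?J) ?J s w"
    using weak_le_simple_iff[OF d(2) used.prems(3) s(2)] below by simp
  ultimately have "pi_down_rel (PW ?J) ?J (prod (s # cs)) w (s \<otimes>\<^bsub>PW ?J\<^esub> (s \<otimes> v))"
    using pi_down_rel.above[OF s(2) initial_head[OF d]] by blast
  then show ?case using s used.hyps by simp
next
  case (skipped cs v C s)
  let ?J = "set (s # cs)"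
  have d: "distinct (s # cs)" "?J \<subseteq> S" and s: "s \<in> S" "s \<in> ?J" and cs: "set cs \<subseteq> S" using skipped.prems by auto
  have w: "w \<in> carrier W" using gen_closed[OF d(2) skipped.prems(3)] .
  have K: "?J - {s} = set cs" using d by auto
  have "nonneg (act (inv w) (simple s))" using skipped.prems by (simp add: region_def)
  then have nw: "\<not> weak_le (PW ?J) ?J s w"
    using weak_le_simple_iff[OF d(2) skipped.prems(3) s(2)] not_both_signs[OF roots_S[of "inv w" s]] w s by auto
  obtain x where x: "parabolic_factor (set cs) w x" using parabolic_factor_exists[OF w cs] by blast
  have "C \<subseteq> roots (set cs)" using skips_roots skipped.hyps cs by blast
  then have "region C x"
    using skipped.prems(4) parabolic_factor_sign[OF cs w x] by (auto simp: region_def)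
  moreover have "x \<in> gen (set cs)" using x by (simp add: parabolic_factor_def)
  ultimately have "pi_down_rel (PW (set cs)) (set cs) (prod cs) x v"
    using d by (intro skipped.IH) auto
  moreover have "parabolic_part (PW ?J) ?J (set cs) w = x"
    using x d skipped.prems by (intro parabolic_part_eq) auto
  moreover have "subgroup_generated (PW ?J) (set cs) = PW (set cs)" using d by (intro PW_PW) auto
  moreover have "s \<otimes>\<^bsub>PW ?J\<^esub> prod (s # cs) = prod cs" using s cs by simp
  ultimately have "pi_down_rel (subgroup_generated (PW ?J) (?J - {s})) (?J - {s}) (s \<otimes>\<^bsub>PW ?J\<^esub> prod (s # cs))
      (parabolic_part (PW ?J) ?J (?J - {s}) w) v" unfolding K by simp
  then show ?case by (rule pi_down_rel.not_above[OF s(2) initial_head[OF d] nw])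
qed

lemma skips_one: "distinct cs \<Longrightarrow> set cs \<subseteq> S \<Longrightarrow> \<exists>C. skips cs \<one> C \<and> region C \<one>"
proof (induction cs)
  case Nil then show ?case using skips.Nil by (auto simp: region_def)
next
  case (Cons s cs)
  then obtain C where "skips cs \<one> C" "region C \<one>" by auto
  then have "skips (s # cs) \<one> (insert (simple s) C)" "region (insert (simple s) C) \<one>"
    by (auto simp: region_def intro: skips.skipped)
  then show ?case by blast
qed

text \<open>The chosen letter may stand anywhere in the word. As it commutes with all letters before
  it, the word with it in front has the same product, and \<open>skips_move\<close> carries the
  result back. The record \<open>G\<close> is kept general because the recursion replaces the group
  by a parabolic subgroup.\<close>

lemma pi_down_skips:
  assumes "pi_down_rel G J c w v" "G = PW J" "distinct cs" "set cs = J" "J \<subseteq> S" "c = prod cs" "w \<in> gen J"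
  shows "\<exists>C. skips cs v C \<and> region C w"
  using assms
proof (induction arbitrary: cs rule: pi_down_rel.induct)
  case (one G J c)
  then show ?case using skips_one[of cs] by simp
next
  case (above s J G c w v)
  have s: "s \<in> S" using above.hyps above.prems by auto
  have "initial (PW (set cs)) (set cs) (prod cs) s" "set cs \<subseteq> S" "s \<in> set cs"
    using above.hyps above.prems by simp_all
  from initial_cases[OF above.prems(2) this(2,3,1)]
  obtain us vs where uv: "cs = us @ s # vs" "\<forall>u\<in>set us. B u s = 0" .
  have uS: "set us \<subseteq> S" "set vs \<subseteq> S" using uv above.prems by auto
  have w: "w \<in> carrier W" using gen_closed above.prems by blast
  have d: "distinct (s # us @ vs)" "set (s # us @ vs) = J" "set (s # us @ vs) \<subseteq> S" using uv above.prems by auto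
  have c: "c = prod (s # us @ vs)" using prod_move[of s us] uv s uS above.prems by (simp flip: m_assoc)
  have np: "nonpos (act (inv w) (simple s))"
    using weak_le_simple_iff[of J w s] above.hyps above.prems by simp
  have "\<exists>C. skips ((us @ vs) @ [s]) v C \<and> region C (s \<otimes>\<^bsub>G\<^esub> w)"
  proof (rule above.IH)
    show "s \<otimes>\<^bsub>G\<^esub> c \<otimes>\<^bsub>G\<^esub> s = prod ((us @ vs) @ [s])"
      using conj_head[OF d(3)] c above.prems by simp
    show "s \<otimes>\<^bsub>G\<^esub> w \<in> gen J" using gen_mult_left[of s J w] above.hyps above.prems w by simp
  qed (use d above.prems in auto)
  then obtain C where C: "skips ((us @ vs) @ [s]) v C" "region C (s \<otimes> w)" using above.prems by auto
  have dr: "distinct ((us @ vs) @ [s])" "set ((us @ vs) @ [s]) \<subseteq> S" using d by auto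
  have v: "v \<in> carrier W" using skips_carrier[OF C(1) dr(2)] .
  have "\<not> nonpos (act (inv (s \<otimes> w)) (simple s))"
    using np s w not_both_signs[OF roots_S[of "inv w" s]]
    by (simp add: act_used reflect_same act_minus)
  then have "\<not> nonpos (act (inv v) (simple s))"
    using region_below[OF C(1) dr _ C(2)] s w by (auto simp: simple_root)
  then have "nonneg (act (inv v) (simple s))" using act_simple_sign[of "inv v" s] s v by auto
  then have "nonpos (act (inv (s \<otimes> v)) (simple s))" using s v by (simp add: act_used reflect_same act_minus)
  then have "skips (s # us @ vs) (s \<otimes> v) (reflect s ` C)"
    using C s v by (intro skips.used) auto
  then have "skips cs (s \<otimes> v) (reflect s ` C)" unfolding uv(1) using d uv by (intro skips_move) auto
  moreover have "region (reflect s ` C) w" using C s w by (simp add: region_used)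
  ultimately show ?case using above.prems by auto
next
  case (not_above s J G c w v)
  have s: "s \<in> S" using not_above.hyps not_above.prems by auto
  have "initial (PW (set cs)) (set cs) (prod cs) s" "set cs \<subseteq> S" "s \<in> set cs"
    using not_above.hyps not_above.prems by simp_all
  from initial_cases[OF not_above.prems(2) this(2,3,1)]
  obtain us vs where uv: "cs = us @ s # vs" "\<forall>u\<in>set us. B u s = 0" .
  let ?K = "J - {s}"
  have uS: "set us \<subseteq> S" "set vs \<subseteq> S" using uv not_above.prems by auto
  have w: "w \<in> carrier W" using gen_closed not_above.prems by blast
  have d: "distinct (s # us @ vs)" "set (us @ vs) = ?K" "set (s # us @ vs) \<subseteq> S" using uv not_above.prems by auto
  have KS: "?K \<subseteq> S" using not_above.prems by auto
  have c: "c = prod (s # us @ vs)" using prod_move[of s us] uv s uS not_above.prems by (simp flip: m_assoc)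
  have "\<not> nonpos (act (inv w) (simple s))"
    using weak_le_simple_iff[of J w s] not_above.hyps not_above.prems by simp
  then have nn: "nonneg (act (inv w) (simple s))" using act_simple_sign[of "inv w" s] s w by auto
  obtain x where x: "parabolic_factor ?K w x" using parabolic_factor_exists[OF w KS] by blast
  have px: "parabolic_part G J ?K w = x"
    using parabolic_part_eq[OF _ _ _ x, of J] not_above.prems by auto
  have "\<exists>C. skips (us @ vs) v C \<and> region C (parabolic_part G J ?K w)"
  proof (rule not_above.IH)
    show "subgroup_generated G ?K = PW ?K" using PW_PW[of ?K J] not_above.prems by auto
    show "s \<otimes>\<^bsub>G\<^esub> c = prod (us @ vs)" using c s uS not_above.prems by simp
    show "parabolic_part G J ?K w \<in> gen ?K" unfolding px using x by (simp add: parabolic_factor_def)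
  qed (use d KS in auto)
  then obtain C where C: "skips (us @ vs) v C" "region C x" using px by auto
  have "C \<subseteq> roots ?K" using skips_roots[OF C(1)] unfolding d(2) using KS by blast
  then have "region (insert (simple s) C) w"
    using C(2) nn parabolic_factor_sign[OF KS w x] by (auto simp: region_def)
  moreover have "skips cs v (insert (simple s) C)"
    unfolding uv(1) using d uv C by (intro skips_move skips.skipped) auto
  ultimately show ?case by blast
qed

lemma pi_down_iff:
  assumes "distinct cs" "set cs = S" "w \<in> carrier W"
  shows "pi_down W S (prod cs) w = v \<longleftrightarrow> (\<exists>C. skips cs v C \<and> region C w)"
proof -
  have sub: "set cs \<subseteq> S" using assms by simp
  have w: "w \<in> gen S" using assms(3) gen_S by simp
  have rel: "pi_down_rel W S (prod cs) w x \<longleftrightarrow> (\<exists>C. skips cs x C \<and> region C w)" for x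
  proof
    assume "pi_down_rel W S (prod cs) w x"
    from pi_down_skips[OF this PW_S[symmetric] assms(1,2) order.refl refl w]
    show "\<exists>C. skips cs x C \<and> region C w" .
  next
    assume "\<exists>C. skips cs x C \<and> region C w"
    then obtain C where C: "skips cs x C" "region C w" by blast
    from skips_pi_down[OF C(1) assms(1) sub _ C(2)] w
    show "pi_down_rel W S (prod cs) w x" unfolding assms(2) PW_S by blast
  qed
  obtain x C where x: "skips cs x C" "region C w" using skips_exists[OF assms(1) sub assms(3)] by blast
  have uniq: "y = x" if "skips cs y D" "region D w" for y D
  proof -
    have "\<exists>u\<in>carrier W. region D u \<and> region C u" using that(2) x(2) assms(3) by (intro bexI[of _ w]) simp_all
    then show ?thesis using skips_unique[OF that(1) x(1) assms(1) sub disjI2] by blast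
  qed
  have "pi_down W S (prod cs) w = x"
    unfolding pi_down_def rel
  proof (rule the_equality)
    show "\<exists>C. skips cs x C \<and> region C w" using x by (intro exI[of _ C] conjI)
  next
    fix y assume "\<exists>C. skips cs y C \<and> region C w"
    then obtain D where "skips cs y D" "region D w" by (elim exE conjE)
    then show "y = x" by (rule uniq)
  qed
  moreover have "(\<exists>D. skips cs v D \<and> region D w) \<longleftrightarrow> v = x"
  proof
    assume "\<exists>D. skips cs v D \<and> region D w"
    then obtain D where "skips cs v D" "region D w" by (elim exE conjE)
    then show "v = x" by (rule uniq)
  qed (use x in \<open>intro exI[of _ C], simp\<close>)
  ultimately show ?thesis by metis
qed

section \<open>Sorting words\<close>

lemma reduced_iff: "reduced W S xs \<longleftrightarrow> set xs \<subseteq> S \<and> length xs = len S (prod xs)"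
  by (auto simp: reduced_def lists_eq_set)

lemma reduced_Cons:
  assumes "s \<in> S" "set xs \<subseteq> S"
  shows "reduced W S (s # xs) \<longleftrightarrow> reduced W S xs \<and> len S (prod xs) < len S (s \<otimes> prod xs)"
proof -
  obtain ys where ys: "set ys \<subseteq> S" "prod ys = prod xs" "length ys = len S (prod xs)"
    using len_word[of "prod xs" S] assms gen_S by auto
  have up: "len S (s \<otimes> prod xs) \<le> Suc (len S (prod xs))"
    using len_le[of "s # ys" S] ys assms by simp
  have le: "len S (prod xs) \<le> length xs" using len_le[OF assms(2)] .
  obtain zs where zs: "set zs \<subseteq> S" "prod zs = s \<otimes> prod xs" "length zs = len S (s \<otimes> prod xs)"
    using len_word[of "s \<otimes> prod xs" S] assms gen_S by auto
  have "len S (prod xs) \<le> Suc (len S (s \<otimes> prod xs))"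
    using len_le[of "s # zs" S] zs assms by simp
  with up le show ?thesis using assms by (auto simp: reduced_iff)
qed

definition sorting_list :: "'a list \<Rightarrow> 'a \<Rightarrow> nat list \<Rightarrow> bool" where
  "sorting_list cs v ps \<longleftrightarrow> reduced_subword_for W S cs v ps \<and>
     (\<forall>qs. reduced_subword_for W S cs v qs \<longrightarrow> qs = ps \<or> (ps, qs) \<in> lexord less_than)"

lemma sorting_positions_eq: assumes "sorting_list cs v ps" shows "sorting_positions W S cs v = ps"
  unfolding sorting_positions_def
proof (rule the_equality)
  fix qs assume "reduced_subword_for W S cs v qs \<and>
    (\<forall>rs. reduced_subword_for W S cs v rs \<longrightarrow> rs = qs \<or> (qs, rs) \<in> lexord less_than)"
  then show "qs = ps" using assms lexord_less_asym unfolding sorting_list_def by blast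
qed (use assms in \<open>simp add: sorting_list_def\<close>)

lemma subword_Suc:
  assumes "cs \<noteq> []"
  shows "reduced_subword_for W S cs v (map Suc ps) \<longleftrightarrow> reduced_subword_for W S (rotate1 cs) v ps"
proof -
  have "letter_at (rotate1 cs) = (\<lambda>p. letter_at cs (Suc p))" using letter_at_rotate1[OF assms] by blast
  then show ?thesis by (simp add: reduced_subword_for_def sorted_wrt_map comp_def)
qed

lemma subword_zero:
  assumes "s \<in> S" "v \<in> carrier W"
  shows "reduced_subword_for W S (s # cs) v (0 # map Suc ps) \<longleftrightarrow>
    reduced_subword_for W S (rotate1 (s # cs)) (s \<otimes> v) ps \<and> len S (s \<otimes> v) < len S v"
proof -
  let ?xs = "map (letter_at (rotate1 (s # cs))) ps"
  have l: "map (letter_at (s # cs)) (0 # map Suc ps) = s # ?xs"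
    by (simp add: letter_at_rotate1 comp_def del: rotate1.simps) (simp add: letter_at_def)
  have so: "sorted_wrt (<) (0 # map Suc ps) \<longleftrightarrow> sorted_wrt (<) ps" by (simp add: sorted_wrt_map)
  have "reduced W S (s # ?xs) \<and> prod (s # ?xs) = v \<longleftrightarrow>
      (reduced W S ?xs \<and> prod ?xs = s \<otimes> v) \<and> len S (s \<otimes> v) < len S v"
  proof (cases "set ?xs \<subseteq> S")
    case True
    have "s \<otimes> prod ?xs = v \<longleftrightarrow> prod ?xs = s \<otimes> v" using assms True by (metis S_cancel word_prod_in)
    then show ?thesis using reduced_Cons[OF assms(1) True] assms by auto
  qed (auto simp: reduced_iff)
  then show ?thesis unfolding reduced_subword_for_def reduced_word_for_def l so by blast
qed

text \<open>Lexicographic order by positions makes the sorting word greedy: if \<open>s\<close> is a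
  left descent, a list starting at position 0 exists, and it precedes all lists that do not start
  there.\<close>

lemma sorting_list_used:
  assumes "s \<in> S" "v \<in> carrier W" "len S (s \<otimes> v) < len S v" "sorting_list (rotate1 (s # cs)) (s \<otimes> v) ps"
  shows "sorting_list (s # cs) v (0 # map Suc ps)"
  unfolding sorting_list_def
proof (intro conjI allI impI)
  show "reduced_subword_for W S (s # cs) v (0 # map Suc ps)"
    using assms subword_zero by (simp add: sorting_list_def del: rotate1.simps)
  fix qs assume qs: "reduced_subword_for W S (s # cs) v qs"
  then have "sorted_wrt (<) qs" by (simp add: reduced_subword_for_def)
  then show "qs = 0 # map Suc ps \<or> (0 # map Suc ps, qs) \<in> lexord less_than"
  proof (cases rule: position_list_cases)
    case (pos rs)
    have "qs \<noteq> []"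
    proof
      assume "qs = []"
      then have "v = \<one>" using qs by (simp add: reduced_subword_for_def reduced_word_for_def)
      then show False using assms by simp
    qed
    then show ?thesis using pos by (cases rs) auto
  next
    case (zero rs)
    then have "reduced_subword_for W S (rotate1 (s # cs)) (s \<otimes> v) rs"
      using qs subword_zero[OF assms(1,2)] by blast
    then have "rs = ps \<or> (ps, rs) \<in> lexord less_than" using assms(4) unfolding sorting_list_def by blast
    then show ?thesis using zero lexord_map_Suc by auto
  qed
qed

lemma sorting_list_skipped:
  assumes "s \<in> S" "v \<in> carrier W" "\<not> len S (s \<otimes> v) < len S v" "sorting_list (rotate1 (s # cs)) v ps"
  shows "sorting_list (s # cs) v (map Suc ps)"
  unfolding sorting_list_def
proof (intro conjI allI impI)
  show "reduced_subword_for W S (s # cs) v (map Suc ps)"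
    using assms subword_Suc[of "s # cs" v ps] by (simp add: sorting_list_def del: rotate1.simps)
  fix qs assume qs: "reduced_subword_for W S (s # cs) v qs"
  then have "sorted_wrt (<) qs" by (simp add: reduced_subword_for_def)
  then show "qs = map Suc ps \<or> (map Suc ps, qs) \<in> lexord less_than"
  proof (cases rule: position_list_cases)
    case (pos rs)
    then have "reduced_subword_for W S (rotate1 (s # cs)) v rs" using qs subword_Suc[of "s # cs" v rs] by simp
    then have "rs = ps \<or> (ps, rs) \<in> lexord less_than" using assms(4) unfolding sorting_list_def by blast
    then show ?thesis using pos lexord_map_Suc by auto
  next
    case (zero rs)
    then show ?thesis using qs subword_zero[OF assms(1,2)] assms(3) by blast
  qed
qed

text \<open>A used letter lowers the length; a skipped one brings the next left descent closer to
  the front, which the second component of the measure counts.\<close>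

lemma sorting_list_exists:
  assumes "set cs = S" "cs \<noteq> []" "v \<in> carrier W"
  shows "\<exists>ps. sorting_list cs v ps"
  using assms
proof (induction "(len S v, length (takeWhile (\<lambda>s. \<not> len S (s \<otimes> v) < len S v) cs))" arbitrary: cs v
    rule: wf_induct_rule[OF wf_lex_prod[OF wf_less_than wf_less_than]])
  case 1
  show ?case
  proof (cases "v = \<one>")
    case True
    have "reduced_subword_for W S cs \<one> qs \<longleftrightarrow> qs = []" for qs
      by (auto simp: reduced_subword_for_def reduced_word_for_def reduced_iff)
    then have "sorting_list cs \<one> []" by (simp add: sorting_list_def)
    then show ?thesis using True by (intro exI[of _ "[]"]) simp
  next
    case False
    obtain s ds where cs: "cs = s # ds" using 1(3) by (cases cs) auto
    have s: "s \<in> S" using 1(2) cs by auto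
    have rot: "set (rotate1 cs) = S" "rotate1 cs \<noteq> []" using 1(2,3) by auto
    show ?thesis
    proof (cases "len S (s \<otimes> v) < len S v")
      case True
      have "\<exists>ps. sorting_list (rotate1 cs) (s \<otimes> v) ps"
        using rot s 1(4) True by (intro 1(1)) simp_all
      then show ?thesis using sorting_list_used[OF s 1(4) True] unfolding cs by blast
    next
      case n: False
      obtain xs where xs: "set xs \<subseteq> S" "prod xs = v" "length xs = len S v"
        using len_word[of v S] 1(4) gen_S by auto
      then obtain t ys where t: "xs = t # ys" using False by (cases xs) auto
      then have "reduced W S (t # ys)" using xs by (simp add: reduced_iff)
      then have "len S (prod ys) < len S v" using reduced_Cons[of t ys] xs t by auto
      moreover have "t \<otimes> v = prod ys" using xs t by auto
      ultimately have "t \<in> set ds" "len S (t \<otimes> v) < len S v" using n 1(2) cs xs t by auto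
      then have "length (takeWhile (\<lambda>s. \<not> len S (s \<otimes> v) < len S v) (rotate1 cs))
          < length (takeWhile (\<lambda>s. \<not> len S (s \<otimes> v) < len S v) cs)"
        using n cs by simp
      then have "\<exists>ps. sorting_list (rotate1 cs) v ps" using rot 1(4) by (intro 1(1)) simp_all
      then show ?thesis using sorting_list_skipped[OF s 1(4) n] unfolding cs by blast
    qed
  qed
qed

lemma sorting_list_positions:
  "set cs = S \<Longrightarrow> cs \<noteq> [] \<Longrightarrow> v \<in> carrier W \<Longrightarrow> sorting_list cs v (sorting_positions W S cs v)"
  using sorting_list_exists sorting_positions_eq by metis

lemma sorting_positions_used:
  assumes "set (s # cs) = S" "v \<in> carrier W" "len S (s \<otimes> v) < len S v"
  shows "sorting_positions W S (s # cs) v = 0 # map Suc (sorting_positions W S (cs @ [s]) (s \<otimes> v))"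
proof -
  have "sorting_list (cs @ [s]) (s \<otimes> v) (sorting_positions W S (cs @ [s]) (s \<otimes> v))"
    using assms by (intro sorting_list_positions) auto
  then show ?thesis using sorting_list_used[of s v cs] assms by (intro sorting_positions_eq) auto
qed

lemma sorting_positions_skipped:
  assumes "set (s # cs) = S" "v \<in> carrier W" "\<not> len S (s \<otimes> v) < len S v"
  shows "sorting_positions W S (s # cs) v = map Suc (sorting_positions W S (cs @ [s]) v)"
proof -
  have "sorting_list (cs @ [s]) v (sorting_positions W S (cs @ [s]) v)"
    using assms by (intro sorting_list_positions) auto
  then show ?thesis using sorting_list_skipped[of s v cs] assms by (intro sorting_positions_eq) auto
qed

section \<open>First skips and their prefixes\<close>

lemma first_skip_exists:
  assumes "r \<in> set cs" shows "\<exists>p. letter_at cs p = r \<and> p \<notin> set (ps :: nat list)"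
proof -
  obtain i where i: "i < length cs" "cs ! i = r" using assms by (auto simp: in_set_conv_nth)
  \<comment> \<open>A later copy of the letter, placed beyond \<open>sum_list ps\<close> and hence
    beyond every used position.\<close>
  let ?p = "i + length cs * Suc (sum_list ps)"
  have "1 \<le> length cs" using i by simp
  then have "1 * Suc (sum_list ps) \<le> length cs * Suc (sum_list ps)" by (rule mult_le_mono1)
  then have "sum_list ps < ?p" by simp
  then have "?p \<notin> set ps" using member_le_sum_list[of ?p ps] by auto
  moreover have "letter_at cs ?p = r" using i by (simp add: letter_at_def del: mult_Suc_right)
  ultimately show ?thesis by blast
qed

lemma first_skip_shift:
  assumes "r \<in> set (s # cs)" "r = s \<longrightarrow> 0 \<in> set (sorting_positions W S (s # cs) v)"
    and "\<And>p. Suc p \<in> set (sorting_positions W S (s # cs) v) \<longleftrightarrow> p \<in> set (sorting_positions W S (cs @ [s]) v')"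
  shows "first_skip W S (s # cs) v r = Suc (first_skip W S (cs @ [s]) v' r)"
proof -
  obtain p where p: "letter_at (s # cs) p = r \<and> p \<notin> set (sorting_positions W S (s # cs) v)"
    using first_skip_exists[OF assms(1)] by blast
  have "\<not> (letter_at (s # cs) 0 = r \<and> 0 \<notin> set (sorting_positions W S (s # cs) v))"
    using assms(2) by (auto simp: letter_at_def)
  from Least_Suc[OF p this] show ?thesis
    unfolding first_skip_def assms(3) using letter_at_rotate1[of "s # cs"] by simp
qed

lemma letter_at_snoc: "letter_at (cs @ [s]) p = letter_at (s # cs) (Suc p)"
  using letter_at_rotate1[of "s # cs"] by simp

lemma skip_prefix_used:
  assumes "r \<in> set (s # cs)"
    and "sorting_positions W S (s # cs) v = 0 # map Suc (sorting_positions W S (cs @ [s]) v')"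
  shows "skip_prefix W S (s # cs) v r = s # skip_prefix W S (cs @ [s]) v' r"
proof -
  have f: "first_skip W S (s # cs) v r = Suc (first_skip W S (cs @ [s]) v' r)"
    using assms by (intro first_skip_shift) auto
  show ?thesis unfolding skip_prefix_def f assms(2)
    by (simp add: filter_map comp_def letter_at_snoc) (simp add: letter_at_def)
qed

lemma skip_prefix_skipped:
  assumes "r \<in> set cs" "r \<noteq> s"
    and "sorting_positions W S (s # cs) v = map Suc (sorting_positions W S (cs @ [s]) v)"
  shows "skip_prefix W S (s # cs) v r = skip_prefix W S (cs @ [s]) v r"
proof -
  have f: "first_skip W S (s # cs) v r = Suc (first_skip W S (cs @ [s]) v r)"
    using assms by (intro first_skip_shift) auto
  show ?thesis unfolding skip_prefix_def f assms(3)
    by (simp add: filter_map comp_def letter_at_snoc)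
qed

lemma skip_prefix_head:
  assumes "0 \<notin> set (sorting_positions W S (s # cs) v)" shows "skip_prefix W S (s # cs) v s = []"
proof -
  have "first_skip W S (s # cs) v s = 0"
    unfolding first_skip_def using assms by (intro Least_eq_0) (simp add: letter_at_def)
  then show ?thesis by (simp add: skip_prefix_def)
qed

text \<open>The first letter of a reduced word is a left descent, and a letter outside
  \<open>J\<close> is never a left descent of an element of the subgroup of
  \<open>J\<close>.\<close>

lemma reduced_letters:
  assumes "reduced W S xs" "prod xs \<in> gen J" "J \<subseteq> S"
  shows "set xs \<subseteq> J"
  using assms(1,2)
proof (induction xs)
  case (Cons x xs)
  have S: "x \<in> S" "set xs \<subseteq> S" using Cons.prems by (auto simp: reduced_iff)
  have red: "reduced W S xs" "len S (prod xs) < len S (prod (x # xs))"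
    using Cons.prems reduced_Cons[OF S] by auto
  have "x \<otimes> prod (x # xs) = prod xs" using S by simp
  then have np: "nonpos (act (inv (prod (x # xs))) (simple x))"
    using red len_left_less[of S "prod (x # xs)" x] S gen_S by auto
  have x: "x \<in> J"
  proof (rule ccontr)
    assume "x \<notin> J"
    then show False using act_skipped(2)[OF assms(3) S(1) _ gen_inv[OF assms(3) Cons.prems(2)]] np by blast
  qed
  then have "prod xs \<in> gen J" using gen_mult_left[OF x assms(3), of "prod xs"] Cons.prems S by simp
  then show ?case using Cons.IH red x by simp
qed simp

text \<open>The sorting word runs through all of \<open>S\<close>, while \<open>skips\<close> drops
  letters. The set \<open>J\<close> of letters still alive reconciles the two: letters outside it
  are only rotated past. Sortability appears as closure of the positions under subtracting the
  period, which passes to the rotated word at once.\<close>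

lemma skips_sorting:
  assumes "distinct cs" "set cs = S" "cs \<noteq> []" "J \<subseteq> S" "v \<in> gen J"
    and "\<And>p. p + length cs \<in> set (sorting_positions W S cs v) \<Longrightarrow> p \<in> set (sorting_positions W S cs v)"
  shows "skips (filter (\<lambda>x. x \<in> J) cs) v {wact (skip_prefix W S cs v r) (simple r) | r. r \<in> J}"
  using assms
proof (induction "(card J, len S v, length (takeWhile (\<lambda>x. x \<notin> J) cs))" arbitrary: cs v J
    rule: wf_induct_rule[OF wf_lex_prod[OF wf_less_than wf_lex_prod[OF wf_less_than wf_less_than]]])
  case 1
  note IH = 1(1)
  obtain s ds where cs: "cs = s # ds" using 1(4) by (cases cs) auto
  have v: "v \<in> carrier W" using 1(6) gen_closed[OF 1(5)] by blast
  have s: "s \<in> S" and setS: "set (s # ds) = S" using 1(3) cs by auto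
  have dr: "distinct (ds @ [s])" "set (ds @ [s]) = S" "ds @ [s] \<noteq> []" using 1(2,3) cs by auto
  have finJ: "finite J" using 1(5) finite_S finite_subset by blast
  let ?ps = "sorting_positions W S cs v"
  have desc: "len S (s \<otimes> v) < len S v \<longleftrightarrow> nonpos (act (inv v) (simple s))"
    using len_left_less[of S v s] v s gen_S by auto
  show ?case
  proof (cases "s \<in> J")
    case False
    show ?thesis
    proof (cases "J = {}")
      case True
      then have "v = \<one>" using 1(6) generate_empty by simp
      then show ?thesis using True skips.Nil by simp
    next
      case ne: False
      have nd: "\<not> len S (s \<otimes> v) < len S v"
        unfolding desc using act_skipped(2)[OF 1(5) s False gen_inv[OF 1(5,6)]] .
      have ps: "?ps = map Suc (sorting_positions W S (ds @ [s]) v)"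
        unfolding cs using setS v nd by (rule sorting_positions_skipped)
      obtain j where "j \<in> J" "j \<in> set ds" using ne 1(3,5) cs False by auto
      then have lt: "length (takeWhile (\<lambda>x. x \<notin> J) (ds @ [s])) < length (takeWhile (\<lambda>x. x \<notin> J) cs)"
        using cs False by simp
      have "skips (filter (\<lambda>x. x \<in> J) (ds @ [s])) v {wact (skip_prefix W S (ds @ [s]) v r) (simple r) | r. r \<in> J}"
      proof (rule IH)
        fix p assume "p + length (ds @ [s]) \<in> set (sorting_positions W S (ds @ [s]) v)"
        then have "Suc p + length cs \<in> set ?ps" unfolding ps by (simp add: cs)
        then have "Suc p \<in> set ?ps" by (rule 1(7))
        then show "p \<in> set (sorting_positions W S (ds @ [s]) v)" unfolding ps by auto
      qed (use lt dr 1(5,6) in simp_all)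
      moreover have "skip_prefix W S cs v r = skip_prefix W S (ds @ [s]) v r" if "r \<in> J" for r
        unfolding cs using that False 1(3,5) cs ps by (intro skip_prefix_skipped) auto
      then have "{wact (skip_prefix W S cs v r) (simple r) | r. r \<in> J} =
          {wact (skip_prefix W S (ds @ [s]) v r) (simple r) | r. r \<in> J}" by force
      ultimately show ?thesis using False cs by simp
    qed
  next
    case True
    show ?thesis
    proof (cases "len S (s \<otimes> v) < len S v")
      case d: True
      have ps: "?ps = 0 # map Suc (sorting_positions W S (ds @ [s]) (s \<otimes> v))"
        unfolding cs using setS v d by (rule sorting_positions_used)
      let ?C = "{wact (skip_prefix W S (ds @ [s]) (s \<otimes> v) r) (simple r) | r. r \<in> J}"
      have "skips (filter (\<lambda>x. x \<in> J) (ds @ [s])) (s \<otimes> v) ?C"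
      proof (rule IH)
        show "s \<otimes> v \<in> gen J" using gen_mult_left[OF True 1(5) v] 1(6) by simp
        fix p assume "p + length (ds @ [s]) \<in> set (sorting_positions W S (ds @ [s]) (s \<otimes> v))"
        then have "Suc p + length cs \<in> set ?ps" unfolding ps by (simp add: cs)
        then have "Suc p \<in> set ?ps" by (rule 1(7))
        then show "p \<in> set (sorting_positions W S (ds @ [s]) (s \<otimes> v))" unfolding ps by auto
      qed (use d dr 1(5) in simp_all)
      then have "skips (s # filter (\<lambda>x. x \<in> J) ds) v (reflect s ` ?C)"
        using True d desc v by (intro skips.used) auto
      moreover have "skip_prefix W S cs v r = s # skip_prefix W S (ds @ [s]) (s \<otimes> v) r" if "r \<in> J" for r
        unfolding cs using that 1(3,5) cs ps by (intro skip_prefix_used) auto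
      then have "{wact (skip_prefix W S cs v r) (simple r) | r. r \<in> J} = reflect s ` ?C" by force
      ultimately show ?thesis using True cs by simp
    next
      case nd: False
      have ps: "?ps = map Suc (sorting_positions W S (ds @ [s]) v)"
        unfolding cs using setS v nd by (rule sorting_positions_skipped)
      let ?K = "J - {s}"
      let ?C = "{wact (skip_prefix W S (ds @ [s]) v r) (simple r) | r. r \<in> ?K}"
      have mult: "length cs * k \<notin> set ?ps" for k
      proof (induction k)
        case (Suc k) then show ?case using 1(7)[of "length cs * k"] by (auto simp: add.commute)
      qed (auto simp: ps)
      have "sorting_list cs v ?ps" using 1(3,4) v by (intro sorting_list_positions)
      then have rw: "reduced W S (map (letter_at cs) ?ps)" "prod (map (letter_at cs) ?ps) = v"
        by (auto simp: sorting_list_def reduced_subword_for_def reduced_word_for_def)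
      have "letter_at cs p \<noteq> s" if "p \<in> set ?ps" for p
      proof
        assume "letter_at cs p = s"
        then have "cs ! (p mod length cs) = cs ! 0" by (simp add: letter_at_def cs)
        moreover have "p mod length cs < length cs" "0 < length cs" using cs by auto
        ultimately have "p mod length cs = 0" using nth_eq_iff_index_eq[OF 1(2)] by blast
        then obtain k where "p = length cs * k" by auto
        then show False using mult that by simp
      qed
      moreover have "set (map (letter_at cs) ?ps) \<subseteq> J" using reduced_letters[OF rw(1) _ 1(5)] rw(2) 1(6) by simp
      ultimately have "set (map (letter_at cs) ?ps) \<subseteq> ?K" by auto
      then have vK: "v \<in> gen ?K" using gen_word_intro[of ?K "map (letter_at cs) ?ps"] rw(2) 1(5) by auto
      have card: "card ?K < card J" using True finJ by (intro psubset_card_mono) auto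
      have sk: "skips (filter (\<lambda>x. x \<in> ?K) (ds @ [s])) v ?C"
      proof (rule IH)
        fix p assume "p + length (ds @ [s]) \<in> set (sorting_positions W S (ds @ [s]) v)"
        then have "Suc p + length cs \<in> set ?ps" unfolding ps by (simp add: cs)
        then have "Suc p \<in> set ?ps" by (rule 1(7))
        then show "p \<in> set (sorting_positions W S (ds @ [s]) v)" unfolding ps by auto
      qed (use card vK dr 1(5) in auto)
      have "filter (\<lambda>x. x \<in> ?K) (ds @ [s]) = filter (\<lambda>x. x \<in> J) ds"
        using 1(2) cs by (auto intro!: filter_cong)
      from skips.skipped[OF sk[unfolded this], of s]
      have sk': "skips (s # filter (\<lambda>x. x \<in> J) ds) v (insert (simple s) ?C)" .
      have e: "skip_prefix W S cs v r = skip_prefix W S (ds @ [s]) v r" if "r \<in> ?K" for r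
        unfolding cs using that 1(3,5) cs ps by (intro skip_prefix_skipped) auto
      have es: "skip_prefix W S cs v s = []" unfolding cs using ps cs by (intro skip_prefix_head) auto
      let ?f = "\<lambda>r. wact (skip_prefix W S cs v r) (simple r)"
      have "?f ` J = insert (?f s) (?f ` ?K)" using True by auto
      also have "?f ` ?K = (\<lambda>r. wact (skip_prefix W S (ds @ [s]) v r) (simple r)) ` ?K"
        by (rule image_cong) (simp_all add: e)
      finally have "{wact (skip_prefix W S cs v r) (simple r) | r. r \<in> J} = insert (simple s) ?C"
        by (simp only: Setcompr_eq_image es wact_simps)
      then show ?thesis using sk' True cs by simp
    qed
  qed
qed

text \<open>Within one copy of the word each letter has a single position, so inclusion of letter
  sets is inclusion of positions shifted by the period.\<close>

lemma c_sortable_closed: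
  assumes "c_sortable W S cs v" "distinct cs" "cs \<noteq> []"
    and "p + length cs \<in> set (sorting_positions W S cs v)"
  shows "p \<in> set (sorting_positions W S cs v)"
proof -
  let ?ps = "set (sorting_positions W S cs v)" and ?n = "length cs"
  have "(p + ?n) div ?n = Suc (p div ?n)" using assms(3) by simp
  then have "letter_at cs (p + ?n) \<in> letter_at cs ` {q \<in> ?ps. q div ?n = Suc (p div ?n)}"
    using assms(4) by blast
  then have "letter_at cs (p + ?n) \<in> letter_at cs ` {q \<in> ?ps. q div ?n = p div ?n}"
    using assms(1) unfolding c_sortable_def Let_def by blast
  then obtain q where q: "q \<in> ?ps" "q div ?n = p div ?n" "letter_at cs (p + ?n) = letter_at cs q" by blast
  have "cs ! (q mod ?n) = cs ! (p mod ?n)" using q(3) by (simp add: letter_at_def)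
  then have "q mod ?n = p mod ?n" using assms(2,3) by (simp add: nth_eq_iff_index_eq)
  then have "q = p" using q(2) by (metis div_mult_mod_eq)
  then show ?thesis using q by simp
qed

lemma skips_sortable:
  assumes "c_sortable W S cs v" "distinct cs" "set cs = S" "v \<in> carrier W"
  shows "skips cs v {wact (skip_prefix W S cs v r) (simple r) | r. r \<in> S}"
proof (cases "cs = []")
  \<comment> \<open>\<open>letter_at\<close> is meaningful only for a nonempty word; for empty
    \<open>S\<close> the group is trivial.\<close>
  case True
  then have "S = {}" using assms by simp
  have "carrier W = {\<one>}" unfolding gen_S[symmetric] \<open>S = {}\<close> by (rule generate_empty)
  then have "v = \<one>" using assms(4) by blast
  moreover have "{wact (skip_prefix W S cs v r) (simple r) | r. r \<in> S} = {}" using \<open>S = {}\<close> by blast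
  ultimately show ?thesis using True skips.Nil by metis
next
  case False
  have "skips (filter (\<lambda>x. x \<in> S) cs) v {wact (skip_prefix W S cs v r) (simple r) | r. r \<in> S}"
  proof (rule skips_sorting[OF assms(2,3) False order.refl])
    show "v \<in> gen S" using assms(4) gen_S by simp
  qed (rule c_sortable_closed[OF assms(1,2) False])
  moreover have "filter (\<lambda>x. x \<in> S) cs = cs" using assms(3) by (intro filter_True) auto
  ultimately show ?thesis by simp
qed

section \<open>From skip vectors to cover reflections and unforced skips\<close>

lemma reduced_prefix: "reduced W S (xs @ ys) \<Longrightarrow> reduced W S xs"
  using len_reduced_prefix[OF order.refl, of xs ys] unfolding reduced_iff by auto

lemma skip_prefix_reduced:
  assumes "set cs = S" "r \<in> S" "v \<in> carrier W"
  shows "reduced W S (skip_prefix W S cs v r)"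
proof -
  let ?ps = "sorting_positions W S cs v" and ?f = "first_skip W S cs v r"
  have "sorting_list cs v ?ps" using assms by (intro sorting_list_positions) auto
  then have ps: "sorted_wrt (<) ?ps" "reduced W S (map (letter_at cs) ?ps)"
    by (auto simp: sorting_list_def reduced_subword_for_def reduced_word_for_def)
  have "map (letter_at cs) ?ps = skip_prefix W S cs v r @ map (letter_at cs) (filter (\<lambda>p. \<not> p < ?f) ?ps)"
    unfolding skip_prefix_def by (metis map_append sorted_filter_split[OF ps(1)])
  then show ?thesis using ps(2) reduced_prefix by metis
qed

text \<open>One direction needs that every cover root occurs among the skip vectors, which is
  \<open>cover_in_skips\<close>; the other needs that a negative skip vector is a cover root, which
  is \<open>skip_dichotomy\<close>.\<close>

lemma region_iff:
  assumes "skips cs v C" "C = {wact (skip_prefix W S cs v r) (simple r) | r. r \<in> S}"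
    and "distinct cs" "set cs = S" "w \<in> carrier W"
  shows "region C w \<longleftrightarrow>
    cover_reflections W S v \<subseteq> inversions W S w \<and> ufs W S cs v \<inter> inversions W S w = {}"
proof -
  have sub: "set cs \<subseteq> S" using assms by simp
  have v: "v \<in> carrier W" using skips_carrier[OF assms(1) sub] .
  have inv_iff: "conj u r \<in> inversions W S z \<longleftrightarrow> (nonneg (act u (simple r)) \<longleftrightarrow> nonpos (act (inv z) (act u (simple r))))"
    if "u \<in> carrier W" "r \<in> S" "z \<in> carrier W" for u r z
    using conj_inversion_iff[OF order.refl, unfolded PW_S gen_S, OF that(3,1,2)] .
  have sign: "nonpos (act u (simple r)) \<longleftrightarrow> \<not> nonneg (act u (simple r))" if "u \<in> carrier W" "r \<in> S" for u r
    using root_sign[OF roots_S[OF that] order.refl] .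
  have sign': "nonpos (act (inv w) (act u (simple r))) \<longleftrightarrow> \<not> nonneg (act (inv w) (act u (simple r)))"
    if "u \<in> carrier W" "r \<in> S" for u r
    using sign[of "inv w \<otimes> u" r] that assms(5) by (simp add: act_mult)
  define xs where "xs = skip_prefix W S cs v"
  have xs: "set (xs r) \<subseteq> S" "length (xs r) = len S (prod (xs r))" if "r \<in> S" for r
    using skip_prefix_reduced[OF assms(4) that v] by (auto simp: reduced_iff xs_def)
  have act_xs: "act (prod (xs r)) = wact (xs r)" if "r \<in> S" for r
    using act_word xs(1)[OF that] by blast
  have C: "C = {act (prod (xs r)) (simple r) | r. r \<in> S}"
    unfolding assms(2) xs_def[symmetric] Setcompr_eq_image by (intro image_cong) (simp_all add: act_xs)
  have ufs: "ufs W S cs v = {conj (prod (xs r)) r | r. r \<in> S \<and> nonneg (act (prod (xs r)) (simple r))}"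
  proof -
    have a: "word_prod W (xs r @ [r] @ rev (xs r)) = conj (prod (xs r)) r" if "r \<in> S" for r
      using xs[OF that] that by (simp add: word_prod_rev m_assoc)
    have b: "unforced_skip W S cs v r \<longleftrightarrow> nonneg (act (prod (xs r)) (simple r))" if "r \<in> S" for r
      unfolding unforced_skip_def xs_def[symmetric] reduced_iff
      using len_snoc[OF order.refl xs(1)[OF that] that xs(2)[OF that]] xs(1)[OF that] that
      by (simp add: act_xs)
    have "(t = word_prod W (xs r @ [r] @ rev (xs r)) \<and> r \<in> S \<and> unforced_skip W S cs v r) \<longleftrightarrow>
        (t = conj (prod (xs r)) r \<and> r \<in> S \<and> nonneg (act (prod (xs r)) (simple r)))" for t r
    proof (cases "r \<in> S")
      case True
      show ?thesis unfolding a[OF True] b[OF True] ..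
    qed blast
    then show ?thesis unfolding ufs_def xs_def[symmetric] by (simp only:)
  qed
  show ?thesis
  proof (intro iffI conjI subsetI)
    fix t assume R: "region C w" and t: "t \<in> cover_reflections W S v"
    then obtain p where p: "t \<in> inversions W S v" "p \<in> S" "t \<otimes> v = v \<otimes> p"
      by (auto simp: cover_reflections_def)
    obtain u r where "u \<in> gen S" "r \<in> S" "t = conj u r"
      using inversion_cases[OF order.refl, unfolded PW_S, OF p(1)] by metis
    then have "t \<in> carrier W" using gen_S by simp
    then have "(t \<otimes> v) \<otimes> inv v = t" using v by (simp add: m_assoc)
    then have t: "t = conj v p" unfolding p(3) by simp
    let ?x = "act v (simple p)"
    have "nonpos ?x" using p(1,2) v unfolding t by (simp add: inv_iff sign)
    then have "?x \<in> C" using cover_in_skips[OF assms(1,3) sub, of ?x p] p v assms(4) by simp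
    then have "nonneg (act (inv w) ?x)" using R by (simp add: region_def)
    then show "t \<in> inversions W S w"
      using \<open>nonpos ?x\<close> p(2) v assms(5) unfolding t by (simp add: inv_iff sign sign')
  next
    assume R: "region C w"
    have "conj (prod (xs r)) r \<notin> inversions W S w" if "r \<in> S" "nonneg (act (prod (xs r)) (simple r))" for r
      using R that xs[OF that(1)] assms(5) by (auto simp: C region_def inv_iff sign')
    then show "ufs W S cs v \<inter> inversions W S w = {}" unfolding ufs by blast
  next
    assume R: "cover_reflections W S v \<subseteq> inversions W S w \<and> ufs W S cs v \<inter> inversions W S w = {}"
    show "region C w" unfolding region_def
    proof
      fix d assume d: "d \<in> C"
      then obtain r where r: "r \<in> S" "d = act (prod (xs r)) (simple r)" using C by blast
      have pc: "prod (xs r) \<in> carrier W" using xs[OF r(1)] by simp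
      show "nonneg (act (inv w) d)"
      proof (cases "nonneg d")
        case True
        then have "conj (prod (xs r)) r \<notin> inversions W S w" using R r unfolding ufs by blast
        then show ?thesis using True r pc assms(5) by (simp add: inv_iff sign')
      next
        case False
        then obtain p where p: "p \<in> S" "act (inv v) d = simple p"
          using skip_dichotomy[OF assms(1,3) sub d] assms(4) by auto
        have dv: "d = act v (simple p)" using p v by (metis act_inv(2))
        have "conj v p \<in> inversions W S v" using False p v unfolding dv by (simp add: inv_iff)
        moreover have "conj v p \<otimes> v = v \<otimes> p" using p v by (simp add: m_assoc)
        ultimately have "conj v p \<in> inversions W S w" using R p by (auto simp: cover_reflections_def)
        then show ?thesis using False p v assms(5) unfolding dv by (simp add: inv_iff sign')
      qed
    qed
  qed
qed

end

theorem theorem6p4: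
  fixes W :: "('a, 'b) monoid_scheme" and S :: "'a set"
    and cs :: "'a list" and c w v :: 'a
  assumes "coxeter_system W S" and "finite S"
    and "coxeter_word S cs" and "c = word_prod W cs"
    and "w \<in> carrier W"
    and "v \<in> carrier W" and "c_sortable W S cs v"
  shows "pi_down W S c w = v \<longleftrightarrow>
    cover_reflections W S v \<subseteq> inversions W S w \<and> ufs W S cs v \<inter> inversions W S w = {}"
proof -
  interpret coxeter W S using assms by unfold_locales
  have cs: "distinct cs" "set cs = S" using assms by (auto simp: coxeter_word_def)
  let ?C = "{wact (skip_prefix W S cs v r) (simple r) | r. r \<in> S}"
  have sk: "skips cs v ?C" using skips_sortable assms cs by blast
  have "pi_down W S c w = v \<longleftrightarrow> (\<exists>C. skips cs v C \<and> region C w)"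
    using pi_down_iff[OF cs assms(5)] assms(4) by simp
  \<comment> \<open>\<open>skips_unique\<close> with the same \<open>v\<close> on both sides:
    \<open>?C\<close> is the only set of skip vectors of \<open>v\<close>.\<close>
  also have "\<dots> \<longleftrightarrow> region ?C w"
    using sk skips_unique[OF _ sk cs(1)] cs(2) by blast
  finally show ?thesis using region_iff[OF sk refl cs assms(5)] by simp
qed

end
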